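(* Let $\Omega\subset\mathbb{R}^n$ be open and bounded, and let $\mathbb{A}$ be a first order $\mathbb{C}$-elliptic differential operator from $V$ to $W$. Suppose that $\Omega$ is such that there is a constant $C>0$ with $$\|\mathbf{u}\|_{L^{\frac{n}{n-1}}(\Omega)}\le C\big(\|\mathbf{u}\|_{L^1(\Omega)}+|\mathbb{A}\mathbf{u}|(\Omega)\big)\quad\text{and}\quad\inf_{\boldsymbol{\rho}\in\ker(\mathbb{A};\mathbb{R}^n)}\|\mathbf{u}-\boldsymbol{\rho}\|_{L^1(\Omega)}\le C\,|\mathbb{A}\mathbf{u}|(\Omega)$$ for all $\mathbf{u}\in \mathrm{BV}^{\mathbb{A}}(\Omega)$, and let $|||\cdot|||$ be a seminorm on $\mathrm{BV}^{\mathbb{A}}(\Omega)$. Then there is a constant $c>0$ with $$\|\mathbf{u}\|_{L^{\frac{n}{n-1}}(\Omega)}\le c\big(|||\mathbf{u}|||+|\mathbb{A}\mathbf{u}|(\Omega)\big)\qquad\text{for all }\mathbf{u}\in\mathrm{BV}^{\mathbb{A}}(\Omega)$$ if and only if $|||\cdot|||$ is a norm on $\ker(\mathbb{A};\mathbb{R}^n)|_\Omega$ (the space of restrictions to $\Omega$ of elements of $\ker(\mathbb{A};\mathbb{R}^n)$).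
   Context: Throughout $n\ge2$; $V,W$ are finite-dimensional inner product spaces. A first order differential operator is $\mathbb{A}=\sum_{|\alpha|=1}\mathbb{A}_\alpha\partial^\alpha$ with fixed linear maps $\mathbb{A}_\alpha:V\to W$, with symbol $\mathbb{A}[\xi]=\sum_{|\alpha|=1}\xi^\alpha\mathbb{A}_\alpha$. It is $\mathbb{C}$-elliptic if $\mathbb{A}[\xi]:V+\mathrm{i}V\to W+\mathrm{i}W$ is injective for every $\xi\in\mathbb{C}^n\setminus\{0\}$. Put $\ker(\mathbb{A};\mathbb{R}^n)=\{\mathbf{v}\in\mathscr{D}'(\mathbb{R}^n;V):\mathbb{A}\mathbf{v}=0\}$, which for $\mathbb{C}$-elliptic $\mathbb{A}$ is a finite-dimensional space of $V$-valued polynomials. $\mathrm{BV}^{\mathbb{A}}(\Omega)=\{\mathbf{u}\in L^1(\Omega;V):\mathbb{A}\mathbf{u}\text{ is a finite }W\text{-valued Radon measure}\}$, and $|\mathbb{A}\mathbf{u}|(\Omega)$ denotes the total variation of $\mathbb{A}\mathbf{u}$.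
   Formalization: The seminorm is additionally assumed continuous with respect to the norm ‖u‖_{L¹(Ω)}+|𝔸u|(Ω) of BV^𝔸(Ω); for discontinuous seminorms the "if" direction is false (gradient on a disc, |f| with f a discontinuous functional, f(1)=1). *)

theory Defs
  imports "HOL-Analysis.Analysis" "HOL-Library.Disjoint_Sets"
begin

section \<open>First order operators and complex ellipticity\<close>

text \<open>
  The multi-indices of length one are the unit vectors, so the operator
  \<open>\<Sum>i. A\<^sub>i \<partial>\<^sub>i\<close> is given by a family \<open>A\<close> of linear maps indexed by the coordinates.
  An element \<open>a + \<i> b\<close> of the complexification of a real vector space is encoded as the
  pair \<open>(a, b)\<close>; the symbol at a complex frequency is extended complex linearly.
\<close>

definition complex_symbol ::
    "('n::finite \<Rightarrow> 'v::euclidean_space \<Rightarrow> 'w::euclidean_space) \<Rightarrow> complex ^ 'n \<Rightarrow> 'v \<times> 'v \<Rightarrow> 'w \<times> 'w"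
  where
  "complex_symbol A \<xi> z =
     (\<Sum>i\<in>UNIV. (Re (\<xi> $ i) *\<^sub>R A i (fst z) - Im (\<xi> $ i) *\<^sub>R A i (snd z),
                 Re (\<xi> $ i) *\<^sub>R A i (snd z) + Im (\<xi> $ i) *\<^sub>R A i (fst z)))"

definition first_order_operator ::
    "('n::finite \<Rightarrow> 'v::euclidean_space \<Rightarrow> 'w::euclidean_space) \<Rightarrow> bool" where
  "first_order_operator A \<longleftrightarrow> (\<forall>i. linear (A i))"

definition C_elliptic ::
    "('n::finite \<Rightarrow> 'v::euclidean_space \<Rightarrow> 'w::euclidean_space) \<Rightarrow> bool" where
  "C_elliptic A \<longleftrightarrow> (\<forall>\<xi>. \<xi> \<noteq> 0 \<longrightarrow> inj (complex_symbol A \<xi>))"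


section \<open>Test functions and distributions\<close>

definition partial :: "'n::finite \<Rightarrow> (real ^ 'n \<Rightarrow> real) \<Rightarrow> real ^ 'n \<Rightarrow> real" where
  "partial i \<phi> x = frechet_derivative \<phi> (at x) (axis i 1)"

text \<open>A list of coordinates stands for the iterated partial derivative along its entries.\<close>

definition partials :: "'n::finite list \<Rightarrow> (real ^ 'n \<Rightarrow> real) \<Rightarrow> real ^ 'n \<Rightarrow> real" where
  "partials is \<phi> = foldr partial is \<phi>"

text \<open>
  If all iterated partial derivatives are (totally) differentiable, they are all continuous,
  so this is \<open>C\<^sup>\<infinity>\<close>.
\<close>

definition smooth :: "(real ^ 'n::finite \<Rightarrow> real) \<Rightarrow> bool" where
  "smooth \<phi> \<longleftrightarrow> (\<forall>is x. partials is \<phi> differentiable (at x))"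

definition test_functions_on :: "(real ^ 'n::finite) set \<Rightarrow> (real ^ 'n \<Rightarrow> real) set" where
  "test_functions_on K = {\<phi>. smooth \<phi> \<and> (\<forall>x. x \<notin> K \<longrightarrow> \<phi> x = 0)}"

definition test_functions :: "(real ^ 'n::finite) set \<Rightarrow> (real ^ 'n \<Rightarrow> real) set" where
  "test_functions \<Omega> = (\<Union>K\<in>{K. compact K \<and> K \<subseteq> \<Omega>}. test_functions_on K)"

text \<open>
  A \<open>'v\<close>-valued distribution is a linear map on real test functions with the usual seminorm
  estimate on each compact set. Its values off the test functions carry no meaning.
\<close>

definition distributions ::
    "(real ^ 'n::finite) set \<Rightarrow> ((real ^ 'n \<Rightarrow> real) \<Rightarrow> 'v::euclidean_space) set" where
  "distributions \<Omega> = {T.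
     (\<forall>\<phi>\<in>test_functions \<Omega>. \<forall>\<psi>\<in>test_functions \<Omega>. T (\<lambda>x. \<phi> x + \<psi> x) = T \<phi> + T \<psi>) \<and>
     (\<forall>\<phi>\<in>test_functions \<Omega>. \<forall>c. T (\<lambda>x. c * \<phi> x) = c *\<^sub>R T \<phi>) \<and>
     (\<forall>K. compact K \<and> K \<subseteq> \<Omega> \<longrightarrow>
        (\<exists>m C. \<forall>\<phi>\<in>test_functions_on K. \<forall>B.
           (\<forall>is x. length is \<le> m \<longrightarrow> \<bar>partials is \<phi> x\<bar> \<le> B) \<longrightarrow> norm (T \<phi>) \<le> C * B))}"

definition apply_op ::
    "('n::finite \<Rightarrow> 'v::euclidean_space \<Rightarrow> 'w::euclidean_space) \<Rightarrow>
     ((real ^ 'n \<Rightarrow> real) \<Rightarrow> 'v) \<Rightarrow> (real ^ 'n \<Rightarrow> real) \<Rightarrow> 'w" where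
  "apply_op A T \<phi> = - (\<Sum>i\<in>UNIV. A i (T (partial i \<phi>)))"

definition regular_distribution ::
    "(real ^ 'n::finite) set \<Rightarrow> (real ^ 'n \<Rightarrow> 'v::euclidean_space) \<Rightarrow> (real ^ 'n \<Rightarrow> real) \<Rightarrow> 'v" where
  "regular_distribution \<Omega> u \<phi> = (LINT x:\<Omega>|lborel. \<phi> x *\<^sub>R u x)"

definition locally_integrable :: "(real ^ 'n::finite \<Rightarrow> 'v::euclidean_space) \<Rightarrow> bool" where
  "locally_integrable u \<longleftrightarrow> (\<forall>K. compact K \<longrightarrow> set_integrable lborel K u)"

definition ker_distr ::
    "('n::finite \<Rightarrow> 'v::euclidean_space \<Rightarrow> 'w::euclidean_space) \<Rightarrow> ((real ^ 'n \<Rightarrow> real) \<Rightarrow> 'v) set" where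
  "ker_distr A = {T \<in> distributions UNIV. \<forall>\<phi>\<in>test_functions UNIV. apply_op A T \<phi> = 0}"

text \<open>
  The functions on \<open>\<real>\<^sup>n\<close> that represent kernel distributions. For complex elliptic operators
  every kernel distribution is a polynomial, so none is lost. A function is included together
  with all its Borel modifications on null sets.
\<close>

definition ker_op ::
    "('n::finite \<Rightarrow> 'v::euclidean_space \<Rightarrow> 'w::euclidean_space) \<Rightarrow> (real ^ 'n \<Rightarrow> 'v) set" where
  "ker_op A = {\<rho>. locally_integrable \<rho> \<and> regular_distribution UNIV \<rho> \<in> ker_distr A}"

text \<open>Functions on \<open>\<Omega>\<close> are total functions whose values off \<open>\<Omega>\<close> are ignored.\<close>

definition ker_restrict ::
    "(real ^ 'n::finite) set \<Rightarrow> ('n \<Rightarrow> 'v::euclidean_space \<Rightarrow> 'w::euclidean_space) \<Rightarrow> (real ^ 'n \<Rightarrow> 'v) set"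
  where
  "ker_restrict \<Omega> A = {u. \<exists>\<rho>\<in>ker_op A. \<forall>x\<in>\<Omega>. u x = \<rho> x}"


section \<open>Finite vector-valued measures\<close>

definition variation ::
    "'a measure \<Rightarrow> ('a set \<Rightarrow> 'w::euclidean_space) \<Rightarrow> ennreal" where
  "variation M \<mu> =
     (SUP P\<in>{P. finite P \<and> P \<subseteq> sets M \<and> disjoint P}. \<Sum>E\<in>P. ennreal (norm (\<mu> E)))"

text \<open>
  The measure \<open>M\<close> only supplies the space and its sigma-algebra. A finite Borel measure on an open
  subset of \<open>\<real>\<^sup>n\<close> is automatically Radon.
\<close>

definition finite_vector_measure ::
    "'a measure \<Rightarrow> ('a set \<Rightarrow> 'w::euclidean_space) \<Rightarrow> bool" where
  "finite_vector_measure M \<mu> \<longleftrightarrow>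
     (\<forall>E::nat \<Rightarrow> 'a set. range E \<subseteq> sets M \<and> disjoint_family E \<longrightarrow> (\<lambda>k. \<mu> (E k)) sums \<mu> (\<Union>k. E k)) \<and>
     variation M \<mu> < \<infinity>"

text \<open>
  The positive part of the Jordan decomposition of a signed measure \<open>s\<close>; the negative part is
  the positive part of \<open>- s\<close>. Since \<open>s {} = 0\<close>, truncation at zero by \<^term>\<open>ennreal\<close> is harmless.
\<close>

definition positive_part :: "'a measure \<Rightarrow> ('a set \<Rightarrow> real) \<Rightarrow> 'a measure" where
  "positive_part M s =
     measure_of (space M) (sets M) (\<lambda>E. SUP F\<in>{F \<in> sets M. F \<subseteq> E}. ennreal (s F))"

definition signed_integral :: "'a measure \<Rightarrow> ('a set \<Rightarrow> real) \<Rightarrow> ('a \<Rightarrow> real) \<Rightarrow> real" where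
  "signed_integral M s \<phi> =
     (LINT x|positive_part M s. \<phi> x) - (LINT x|positive_part M (\<lambda>E. - s E). \<phi> x)"

definition vector_integral ::
    "'a measure \<Rightarrow> ('a set \<Rightarrow> 'w::euclidean_space) \<Rightarrow> ('a \<Rightarrow> real) \<Rightarrow> 'w" where
  "vector_integral M \<mu> \<phi> = (\<Sum>b\<in>Basis. signed_integral M (\<lambda>E. \<mu> E \<bullet> b) \<phi> *\<^sub>R b)"


section \<open>Functions of bounded variation with respect to an operator\<close>

definition op_measure ::
    "(real ^ 'n::finite) set \<Rightarrow> ('n \<Rightarrow> 'v::euclidean_space \<Rightarrow> 'w::euclidean_space) \<Rightarrow>
     (real ^ 'n \<Rightarrow> 'v) \<Rightarrow> ((real ^ 'n) set \<Rightarrow> 'w) \<Rightarrow> bool" where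
  "op_measure \<Omega> A u \<mu> \<longleftrightarrow>
     finite_vector_measure (restrict_space borel \<Omega>) \<mu> \<and>
     (\<forall>\<phi>\<in>test_functions \<Omega>.
        apply_op A (regular_distribution \<Omega> u) \<phi> = vector_integral (restrict_space borel \<Omega>) \<mu> \<phi>)"

definition BV ::
    "(real ^ 'n::finite) set \<Rightarrow> ('n \<Rightarrow> 'v::euclidean_space \<Rightarrow> 'w::euclidean_space) \<Rightarrow> (real ^ 'n \<Rightarrow> 'v) set"
  where
  "BV \<Omega> A = {u. set_integrable lborel \<Omega> u \<and> (\<exists>\<mu>. op_measure \<Omega> A u \<mu>)}"

text \<open>The measure is unique on the Borel subsets of \<open>\<Omega>\<close>, and the variation sees only those.\<close>

definition total_variation ::
    "(real ^ 'n::finite) set \<Rightarrow> ('n \<Rightarrow> 'v::euclidean_space \<Rightarrow> 'w::euclidean_space) \<Rightarrow>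
     (real ^ 'n \<Rightarrow> 'v) \<Rightarrow> ennreal" where
  "total_variation \<Omega> A u = variation (restrict_space borel \<Omega>) (SOME \<mu>. op_measure \<Omega> A u \<mu>)"

definition Lp_norm ::
    "real \<Rightarrow> (real ^ 'n::finite) set \<Rightarrow> (real ^ 'n \<Rightarrow> 'v::euclidean_space) \<Rightarrow> ennreal" where
  "Lp_norm p \<Omega> u =
     (let I = (\<integral>\<^sup>+x\<in>\<Omega>. ennreal (norm (u x) powr p) \<partial>lborel)
      in if I = \<infinity> then \<infinity> else ennreal (enn2real I powr (1 / p)))"


section \<open>Seminorms and norms on spaces of function classes\<close>

text \<open>
  The elements of the spaces above are classes modulo equality almost everywhere on \<open>\<Omega>\<close>, so a
  seminorm has to respect this equality.
\<close>

definition ae_eq_on ::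
    "(real ^ 'n::finite) set \<Rightarrow> (real ^ 'n \<Rightarrow> 'v::euclidean_space) \<Rightarrow> (real ^ 'n \<Rightarrow> 'v) \<Rightarrow> bool" where
  "ae_eq_on \<Omega> u v \<longleftrightarrow> (AE x in lborel. x \<in> \<Omega> \<longrightarrow> u x = v x)"

definition seminorm_on ::
    "(real ^ 'n::finite) set \<Rightarrow> (real ^ 'n \<Rightarrow> 'v::euclidean_space) set \<Rightarrow>
     ((real ^ 'n \<Rightarrow> 'v) \<Rightarrow> real) \<Rightarrow> bool" where
  "seminorm_on \<Omega> S N \<longleftrightarrow>
     (\<forall>u\<in>S. \<forall>v\<in>S. ae_eq_on \<Omega> u v \<longrightarrow> N u = N v) \<and>
     (\<forall>u\<in>S. 0 \<le> N u) \<and>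
     (\<forall>u\<in>S. \<forall>c. N (\<lambda>x. c *\<^sub>R u x) = \<bar>c\<bar> * N u) \<and>
     (\<forall>u\<in>S. \<forall>v\<in>S. N (\<lambda>x. u x + v x) \<le> N u + N v)"

definition norm_on ::
    "(real ^ 'n::finite) set \<Rightarrow> (real ^ 'n \<Rightarrow> 'v::euclidean_space) set \<Rightarrow>
     ((real ^ 'n \<Rightarrow> 'v) \<Rightarrow> real) \<Rightarrow> bool" where
  "norm_on \<Omega> S N \<longleftrightarrow> seminorm_on \<Omega> S N \<and> (\<forall>u\<in>S. N u = 0 \<longrightarrow> ae_eq_on \<Omega> u (\<lambda>x. 0))"

text \<open>
  Continuity of a seminorm for the norm \<open>u \<mapsto> \<parallel>u\<parallel>\<^bsub>L\<^sup>1\<^esub> + |Au|(\<Omega>)\<close>. It cannot be dropped: for the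
  gradient on a planar disc choose a discontinuous linear functional \<open>f\<close> on BV with
  \<open>f 1 = 1\<close>; then \<open>|f|\<close> is a norm on the constants, but since the kernel of \<open>f\<close> is dense there
  are \<open>u\<^sub>k \<rightarrow> 1\<close> in BV with \<open>f u\<^sub>k = 0\<close>, and no estimate by \<open>|f u| + |Du|(\<Omega>)\<close> can hold.
\<close>

definition BV_continuous ::
    "(real ^ 'n::finite) set \<Rightarrow> ('n \<Rightarrow> 'v::euclidean_space \<Rightarrow> 'w::euclidean_space) \<Rightarrow>
     ((real ^ 'n \<Rightarrow> 'v) \<Rightarrow> real) \<Rightarrow> bool" where
  "BV_continuous \<Omega> A N \<longleftrightarrow>
     (\<exists>K>0. \<forall>u\<in>BV \<Omega> A. ennreal (N u) \<le> ennreal K * (Lp_norm 1 \<Omega> u + total_variation \<Omega> A u))"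

end

theory Submission
  imports Defs "HOL-Library.Function_Algebras"
begin

text \<open>
  The kernel \<open>X\<close> of the operator is invariant under translations and dilations. If \<open>q \<in> X\<close> is
  homogeneous of high degree, dilation shows that its mass on \<open>\<Omega>\<close> sits on a small set near the
  boundary, which is incompatible with the estimate of the \<open>L\<^sup>p\<close> norm by the \<open>L\<^sup>1\<close> norm; hence the
  degrees of homogeneous elements of \<open>X\<close> are bounded. The Taylor coefficients of mollified elements
  of \<open>X\<close> are homogeneous elements of \<open>X\<close>, so all mollifications are polynomials of bounded degree on
  lines, and finitely many values of mollifications, taken inside \<open>\<Omega>\<close>, determine an element of \<open>X\<close>.
  So \<open>X\<close> is finite-dimensional, and a seminorm that is a norm on \<open>X\<close> dominates the \<open>L\<^sup>1(\<Omega>)\<close> norm there;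
  subtracting from \<open>u\<close> an almost optimal \<open>\<rho> \<in> X\<close> gives the estimate. Conversely, \<open>|Au|(\<Omega>) = 0\<close>
  for \<open>u \<in> X\<close> because the measure representing \<open>Au\<close> is unique.
\<close>

section \<open>Smooth functions and test functions\<close>

text \<open>The total variation vanishes on the kernel, so there the first assumed estimate becomes
  a reverse Holder inequality: the \<open>L^p\<close> norm is at most \<open>C\<close> times the
  \<open>L^1\<close> norm. This is the bound that excludes high degrees. Elements of
  \<open>ker_op A\<close> are merely locally integrable and matter only up to null sets, so neither
  point values nor derivatives make sense for them. Mollification supplies both. A second obstacle
  is that \<open>N\<close> sees a kernel element only on \<Omega>, while the element lives on the
  whole space. The functionals that determine it are therefore averages against dilates of one fixed
  test function, all supported in one ball inside \<Omega>. The dilation factor does not tend to 0: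
  a polynomial in that factor with enough roots vanishes at 0 as well, which replaces the limit. No
  basis of the kernel is chosen. Finite dimension enters as a finite separating family of linear
  functionals, and the comparison of seminorms is proved directly from it. The infimum over the
  kernel is not known to be attained, which is why the last estimate carries an error
  \<open>e\<close> that is removed at the end.\<close>

lemma smooth_differentiable: "smooth \<phi> \<Longrightarrow> \<phi> differentiable (at x)"
  unfolding smooth_def partials_def by (metis foldr_Nil id_apply)

lemma smooth_partial: "smooth \<phi> \<Longrightarrow> smooth (partial i \<phi>)"
proof -
  have "partials is (partial i \<phi>) = partials (is @ [i]) \<phi>" for "is"
    by (simp add: partials_def)
  then show "smooth \<phi> \<Longrightarrow> smooth (partial i \<phi>)"
    unfolding smooth_def by metis
qed

text \<open>Replaces reasoning about iterated partial derivatives by exhibiting a class of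
  differentiable functions that \<open>partial\<close> does not leave. It serves affine
  substitutions and the bump functions.\<close>

lemma smooth_coinduct:
  assumes "\<phi> \<in> S"
    and "\<And>\<phi> x. \<phi> \<in> S \<Longrightarrow> \<phi> differentiable (at x)"
    and "\<And>\<phi> i. \<phi> \<in> S \<Longrightarrow> partial i \<phi> \<in> S"
  shows "smooth \<phi>"
proof -
  have "partials is \<phi> \<in> S" for "is"
    by (induction "is") (auto simp: partials_def assms)
  then show ?thesis
    unfolding smooth_def using assms(2) by blast
qed

lemma partial_eqI:
  assumes "(\<phi> has_derivative D) (at x)"
  shows "partial i \<phi> x = D (axis i 1)"
  using frechet_derivative_at[OF assms] by (simp add: partial_def)

lemma smooth_has_derivative:
  assumes "smooth \<phi>"
  shows "(\<phi> has_derivative (\<lambda>h. \<Sum>i\<in>UNIV. h $ i * partial i \<phi> x)) (at x)"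
proof -
  have d: "(\<phi> has_derivative frechet_derivative \<phi> (at x)) (at x)"
    using smooth_differentiable[OF assms] frechet_derivative_works by blast
  have lin: "linear (frechet_derivative \<phi> (at x))"
    using d has_derivative_linear by blast
  have "frechet_derivative \<phi> (at x) h = (\<Sum>i\<in>UNIV. h $ i * partial i \<phi> x)" for h
  proof -
    have "frechet_derivative \<phi> (at x) h = frechet_derivative \<phi> (at x) (\<Sum>i\<in>UNIV. h $ i *s axis i 1)"
      by (simp add: basis_expansion)
    then show ?thesis
      by (simp add: linear_sum[OF lin] linear_cmul[OF lin] partial_def scalar_mult_eq_scaleR)
  qed
  then show ?thesis
    using d by presburger
qed

lemma smooth_continuous: "smooth \<phi> \<Longrightarrow> continuous_on S \<phi>"
  by (meson continuous_at_imp_continuous_on differentiable_imp_continuous_within smooth_differentiable)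

text \<open>The prefactor \<open>k\<close> is carried along because each partial derivative produces
  a factor \<open>c\<close>; with it the functions of this shape are closed under
  \<open>partial\<close>, as \<open>smooth_coinduct\<close> requires.\<close>

lemma partial_affine:
  assumes "smooth \<phi>"
  shows "partial i (\<lambda>x. k * \<phi> (a + c *\<^sub>R x)) = (\<lambda>x. (k * c) * partial i \<phi> (a + c *\<^sub>R x))"
    and "(\<lambda>x. k * \<phi> (a + c *\<^sub>R x)) differentiable (at x)"
proof -
  have d: "((\<lambda>x. k * \<phi> (a + c *\<^sub>R x)) has_derivative
          (\<lambda>h. k * (\<Sum>i\<in>UNIV. (c *\<^sub>R h) $ i * partial i \<phi> (a + c *\<^sub>R x)))) (at x)" for x
    by (rule has_derivative_mult_right, rule has_derivative_compose[OF _ smooth_has_derivative[OF assms]])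
       (auto intro!: derivative_eq_intros)
  show "partial i (\<lambda>x. k * \<phi> (a + c *\<^sub>R x)) = (\<lambda>x. (k * c) * partial i \<phi> (a + c *\<^sub>R x))"
  proof
    fix x
    have "(\<Sum>j\<in>UNIV. c * (if j = i then 1 else 0) * partial j \<phi> (a + c *\<^sub>R x)) = c * partial i \<phi> (a + c *\<^sub>R x)"
      by (simp add: if_distrib[of "\<lambda>t. c * t * _"] cong: if_cong)
    then show "partial i (\<lambda>x. k * \<phi> (a + c *\<^sub>R x)) x = k * c * partial i \<phi> (a + c *\<^sub>R x)"
      by (simp add: partial_eqI[OF d] axis_def eq_commute mult.assoc)
  qed
  show "(\<lambda>x. k * \<phi> (a + c *\<^sub>R x)) differentiable (at x)"
    using d differentiable_def by blast
qed

lemma smooth_affine: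
  assumes "smooth \<phi>"
  shows "smooth (\<lambda>x. \<phi> (a + c *\<^sub>R x))"
proof -
  have "(\<lambda>x. \<phi> (a + c *\<^sub>R x)) \<in> {\<lambda>x. k * \<psi> (a + c *\<^sub>R x) |k \<psi>. smooth \<psi>}"
    using assms by (auto intro!: exI[of _ "1::real"])
  then show ?thesis
  proof (rule smooth_coinduct)
    fix \<psi> assume "\<psi> \<in> {\<lambda>x. k * \<psi> (a + c *\<^sub>R x) |k \<psi>. smooth \<psi>}"
    then obtain k \<eta> where k: "\<psi> = (\<lambda>x. k * \<eta> (a + c *\<^sub>R x))" "smooth \<eta>"
      by blast
    show "\<psi> differentiable (at x)" for x
      using k partial_affine(2) by simp
    show "partial i \<psi> \<in> {\<lambda>x. k * \<psi> (a + c *\<^sub>R x) |k \<psi>. smooth \<psi>}" for i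
      unfolding k(1) partial_affine(1)[OF k(2)] using smooth_partial[OF k(2)] by blast
  qed
qed

section \<open>Supports, bounds and affine images of test functions\<close>

lemma partial_outside:
  assumes "closed K" "\<And>x. x \<notin> K \<Longrightarrow> \<phi> x = 0" "x \<notin> K"
  shows "partial i \<phi> x = 0"
proof -
  have "(\<phi> has_derivative (\<lambda>_. 0)) (at x)"
    by (rule has_derivative_transform_within_open[of "\<lambda>_. 0" _ _ _ "- K"]) (use assms in auto)
  then show ?thesis
    by (simp add: partial_eqI)
qed

lemma test_functions_on_partial:
  "closed K \<Longrightarrow> \<phi> \<in> test_functions_on K \<Longrightarrow> partial i \<phi> \<in> test_functions_on K"
  by (auto simp: test_functions_on_def smooth_partial partial_outside)

lemma test_functions_partial: "\<phi> \<in> test_functions \<Omega> \<Longrightarrow> partial i \<phi> \<in> test_functions \<Omega>"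
  unfolding test_functions_def using test_functions_on_partial compact_imp_closed by blast

lemma test_functions_mono: "S \<subseteq> T \<Longrightarrow> test_functions S \<subseteq> test_functions T"
  unfolding test_functions_def by blast

lemma test_functionsE:
  assumes "\<phi> \<in> test_functions \<Omega>"
  obtains K where "compact K" "K \<subseteq> \<Omega>" "smooth \<phi>" "\<And>x. x \<notin> K \<Longrightarrow> \<phi> x = 0"
  using assms unfolding test_functions_def test_functions_on_def by blast

lemma test_functionsI:
  assumes "compact K" "K \<subseteq> \<Omega>" "smooth \<phi>" "\<And>x. x \<notin> K \<Longrightarrow> \<phi> x = 0"
  shows "\<phi> \<in> test_functions \<Omega>"
  using assms unfolding test_functions_def test_functions_on_def by blast

lemma test_functions_continuous: "\<phi> \<in> test_functions \<Omega> \<Longrightarrow> continuous_on S \<phi>"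
  by (metis test_functionsE smooth_continuous)

lemma test_functions_bounded:
  assumes "\<phi> \<in> test_functions \<Omega>"
  obtains M where "M > 0" "\<And>x. \<bar>\<phi> x\<bar> \<le> M"
proof -
  obtain K where K: "compact K" "K \<subseteq> \<Omega>" "smooth \<phi>" "\<And>x. x \<notin> K \<Longrightarrow> \<phi> x = 0"
    using test_functionsE[OF assms] by blast
  have "bounded (\<phi> ` K)"
    by (simp add: K compact_continuous_image compact_imp_bounded smooth_continuous)
  then obtain M where M: "\<And>x. x \<in> K \<Longrightarrow> \<bar>\<phi> x\<bar> \<le> M"
    by (auto simp: bounded_iff)
  show ?thesis
    by (rule that[of "max 1 M"]) (use M K(4) in \<open>force simp: le_max_iff_disj\<close>)+
qed

lemma test_functions_support_ball:
  assumes "\<phi> \<in> test_functions \<Omega>"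
  obtains R where "R > 0" "\<And>x. norm x > R \<Longrightarrow> \<phi> x = 0"
proof -
  obtain K where K: "compact K" "\<And>x. x \<notin> K \<Longrightarrow> \<phi> x = 0"
    using test_functionsE[OF assms] by metis
  then obtain R where "R > 0" "K \<subseteq> cball 0 R"
    by (metis bounded_subset_cbox_symmetric bounded_subset_ballD compact_imp_bounded ball_subset_cball subset_trans)
  show ?thesis
    by (rule that[OF \<open>R > 0\<close>]) (use K(2) \<open>K \<subseteq> cball 0 R\<close> in fastforce)
qed

lemma test_functions_affine:
  assumes "\<phi> \<in> test_functions UNIV" "c \<noteq> 0"
  shows "(\<lambda>x. \<phi> (a + c *\<^sub>R x)) \<in> test_functions UNIV"
proof -
  obtain K where K: "compact K" "smooth \<phi>" "\<And>x. x \<notin> K \<Longrightarrow> \<phi> x = 0"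
    using test_functionsE[OF assms(1)] by metis
  have "compact ((\<lambda>x. inverse c *\<^sub>R (x - a)) ` K)"
    by (intro compact_continuous_image continuous_intros K)
  moreover have "\<phi> (a + c *\<^sub>R x) = 0" if "x \<notin> (\<lambda>x. inverse c *\<^sub>R (x - a)) ` K" for x
  proof -
    have "x = inverse c *\<^sub>R ((a + c *\<^sub>R x) - a)"
      using assms(2) by simp
    then show ?thesis
      using that K(3) by blast
  qed
  ultimately show ?thesis
    using test_functionsI[OF _ subset_UNIV smooth_affine[OF K(2)]] by blast
qed



subsection \<open>Bump functions on boxes\<close>

text \<open>For \<open>m = 0\<close> this is the classical flat function exp(-1/t). The negative
  powers of \<open>t\<close> are those that differentiation creates, so the derivative of a member
  is a linear combination of the members with indices \<open>m + 1\<close> and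
  \<open>m + 2\<close>.\<close>

definition exp_flat :: "nat \<Rightarrow> real \<Rightarrow> real" where
  "exp_flat m t = (if t > 0 then exp (- 1 / t) / t ^ m else 0)"

lemma power_le_fact_exp:
  assumes "0 \<le> (s::real)"
  shows "s ^ k \<le> fact k * exp s"
proof -
  have "(\<Sum>n\<in>{k}. s ^ n /\<^sub>R fact n) \<le> (\<Sum>n. s ^ n /\<^sub>R fact n)"
    by (rule sum_le_suminf[OF summable_exp_generic]) (use assms in auto)
  then show ?thesis
    by (simp add: exp_def field_simps)
qed

text \<open>One term of the exponential series at 1/t, of order \<open>m + 2\<close>, beats the
  negative power and leaves a factor \<open>t\<^sup>2\<close>. A quadratic bound is what makes the
  difference quotient at 0 tend to 0.\<close>

lemma exp_flat_le: "\<bar>exp_flat m t\<bar> \<le> fact (m + 2) * t\<^sup>2"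
proof (cases "t > 0")
  case True
  have "(1 / t) ^ (m + 2) \<le> fact (m + 2) * exp (1 / t)"
    using True by (intro power_le_fact_exp) auto
  then have "exp (- 1 / t) / t ^ m \<le> fact (m + 2) * t\<^sup>2"
    using True by (simp add: exp_minus field_simps power_add power2_eq_square)
  then show ?thesis
    using True by (simp add: exp_flat_def)
qed (simp add: exp_flat_def)

lemma exp_flat_has_derivative:
  "(exp_flat m has_real_derivative (exp_flat (m + 2) t - of_nat m * exp_flat (m + 1) t)) (at t)"
proof -
  consider "t < 0" | "t = 0" | "t > 0" by linarith
  then show ?thesis
  proof cases
    case 1
    have "(exp_flat m has_real_derivative 0) (at t)"
      by (rule has_field_derivative_transform_within_open[of "\<lambda>_. 0" _ _ "{..<0}"])
         (use 1 in \<open>auto simp: exp_flat_def\<close>)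
    then show ?thesis
      using 1 by (simp add: exp_flat_def)
  next
    case 2
    have "(\<lambda>h. exp_flat m h / h) \<midarrow>0\<rightarrow> 0"
    proof (rule Lim_null_comparison)
      have "norm (exp_flat m h / h) \<le> fact (m + 2) * \<bar>h\<bar>" if "h \<noteq> 0" for h
      proof -
        have "\<bar>exp_flat m h\<bar> / \<bar>h\<bar> \<le> fact (m + 2) * h\<^sup>2 / \<bar>h\<bar>"
          using exp_flat_le[of m h] by (intro divide_right_mono) auto
        also have "fact (m + 2) * h\<^sup>2 / \<bar>h\<bar> = fact (m + 2) * \<bar>h\<bar>"
          using that by (simp add: power2_eq_square divide_eq_eq del: fact_Suc)
        finally show ?thesis
          by simp
      qed
      then show "\<forall>\<^sub>F h in at 0. norm (exp_flat m h / h) \<le> fact (m + 2) * \<bar>h\<bar>"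
        by (simp add: eventually_at_filter)
      show "(\<lambda>h. fact (m + 2) * \<bar>h\<bar>) \<midarrow>0\<rightarrow> (0::real)"
        by (auto intro!: tendsto_eq_intros)
    qed
    then show ?thesis
      using 2 by (simp add: DERIV_def exp_flat_def)
  next
    case 3
    have "((\<lambda>t. exp (- 1 / t) / t ^ m) has_real_derivative
        (exp_flat (m + 2) t - of_nat m * exp_flat (m + 1) t)) (at t)"
      using 3 by (auto intro!: derivative_eq_intros simp: exp_flat_def field_simps power2_eq_square)
         (cases m; simp add: field_simps)
    then show ?thesis
      by (rule has_field_derivative_transform_within_open[of _ _ _ "{0<..}"]) (use 3 in \<open>auto simp: exp_flat_def\<close>)
  qed
qed

lemma exp_flat_0_bounds: "0 \<le> exp_flat 0 t" "exp_flat 0 t \<le> 1"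
  by (auto simp: exp_flat_def)

text \<open>A class closed under \<open>partial\<close> that contains the bumps: constants and
  products absorb the chain and product rules, so \<open>smooth_coinduct\<close> applies.\<close>

inductive_set flat_algebra :: "(real ^ 'n::finite \<Rightarrow> real) set" where
  const: "(\<lambda>x. c) \<in> flat_algebra"
| flat: "(\<lambda>x. exp_flat m (c * x $ i + d)) \<in> flat_algebra"
| add: "\<phi> \<in> flat_algebra \<Longrightarrow> \<psi> \<in> flat_algebra \<Longrightarrow> (\<lambda>x. \<phi> x + \<psi> x) \<in> flat_algebra"
| mult: "\<phi> \<in> flat_algebra \<Longrightarrow> \<psi> \<in> flat_algebra \<Longrightarrow> (\<lambda>x. \<phi> x * \<psi> x) \<in> flat_algebra"

lemma flat_algebra_cmult:
  "\<phi> \<in> flat_algebra \<Longrightarrow> (\<lambda>x. k * \<phi> x) \<in> flat_algebra"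
  using flat_algebra.mult[of "\<lambda>_. k" \<phi>] flat_algebra.const[of k] by simp

lemma flat_algebra_closed:
  assumes "\<phi> \<in> flat_algebra"
  shows "(\<forall>x. \<phi> differentiable (at x)) \<and> (\<forall>i. partial i \<phi> \<in> flat_algebra)"
  using assms
proof induction
  case (const c)
  have "partial i (\<lambda>x. c) = (\<lambda>x. 0)" for i :: 'a
    by (rule ext, subst partial_eqI[where D="\<lambda>_. 0"]) auto
  then show ?case
    by (auto intro: flat_algebra.const)
next
  case (flat m c j d)
  have d: "((\<lambda>x. exp_flat m (c * x $ j + d)) has_derivative
      (\<lambda>h. c * h $ j * (exp_flat (m + 2) (c * x $ j + d) - of_nat m * exp_flat (m + 1) (c * x $ j + d)))) (at x)"
    for x :: "real ^ 'a"
    by (rule has_derivative_eq_rhs[OF has_derivative_compose[where g="exp_flat m", OF _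
          exp_flat_has_derivative[unfolded has_field_derivative_def]]])
       (auto intro!: derivative_eq_intros bounded_linear_imp_has_derivative[OF bounded_linear_vec_nth])
  have "partial i (\<lambda>x. exp_flat m (c * x $ j + d)) = (\<lambda>x. c * axis i 1 $ j *
     (exp_flat (m + 2) (c * x $ j + d) + (- of_nat m) * exp_flat (m + 1) (c * x $ j + d)))" for i
    by (rule ext, subst partial_eqI[OF d]) simp
  moreover have "(\<lambda>x. c * axis i 1 $ j *
     (exp_flat (m + 2) (c * x $ j + d) + (- of_nat m) * exp_flat (m + 1) (c * x $ j + d))) \<in> flat_algebra" for i
    using flat_algebra_cmult[OF flat_algebra.add[OF flat_algebra.flat[of "m + 2" c j d]
          flat_algebra_cmult[OF flat_algebra.flat[of "m + 1" c j d], of "- of_nat m"]], of "c * axis i 1 $ j"]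
    by simp
  ultimately show ?case
    using differentiableI[OF d] by simp
next
  case (add \<phi> \<psi>)
  have d: "((\<lambda>x. \<phi> x + \<psi> x) has_derivative
      (\<lambda>h. frechet_derivative \<phi> (at x) h + frechet_derivative \<psi> (at x) h)) (at x)" for x
    using add.IH by (auto intro!: derivative_eq_intros simp: frechet_derivative_works[symmetric])
  have "partial i (\<lambda>x. \<phi> x + \<psi> x) = (\<lambda>x. partial i \<phi> x + partial i \<psi> x)" for i
    by (rule ext, subst partial_eqI[OF d]) (simp add: partial_def)
  moreover have "(\<lambda>x. partial i \<phi> x + partial i \<psi> x) \<in> flat_algebra" for i
    by (intro flat_algebra.add) (simp_all add: add)
  ultimately show ?case
    using differentiableI[OF d] by simp
next
  case (mult \<phi> \<psi>)
  have d: "((\<lambda>x. \<phi> x * \<psi> x) has_derivative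
      (\<lambda>h. \<phi> x * frechet_derivative \<psi> (at x) h + frechet_derivative \<phi> (at x) h * \<psi> x)) (at x)" for x
    using mult.IH by (auto intro!: derivative_eq_intros simp: frechet_derivative_works[symmetric])
  have "partial i (\<lambda>x. \<phi> x * \<psi> x) = (\<lambda>x. \<phi> x * partial i \<psi> x + partial i \<phi> x * \<psi> x)" for i
    by (rule ext, subst partial_eqI[OF d]) (simp add: partial_def)
  moreover have "(\<lambda>x. \<phi> x * partial i \<psi> x + partial i \<phi> x * \<psi> x) \<in> flat_algebra" for i
    by (intro flat_algebra.add flat_algebra.mult) (simp_all add: mult)
  ultimately show ?case
    using differentiableI[OF d] by simp
qed

lemma flat_algebra_smooth: "\<phi> \<in> flat_algebra \<Longrightarrow> smooth \<phi>"
  by (erule smooth_coinduct) (simp_all add: flat_algebra_closed)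

lemma flat_algebra_prod:
  "finite I \<Longrightarrow> (\<And>i. i \<in> I \<Longrightarrow> F i \<in> flat_algebra) \<Longrightarrow> (\<lambda>x. \<Prod>i\<in>I. F i x) \<in> flat_algebra"
  by (induction I rule: finite_induct) (auto intro: flat_algebra.const flat_algebra.mult)

text \<open>The shift by 1 moves the support to distance 1/k inside the box, hence into a compact
  subset. As \<open>k\<close> grows the bumps converge to the indicator of the open box.\<close>

definition bump :: "real \<Rightarrow> real ^ 'n::finite \<Rightarrow> real ^ 'n \<Rightarrow> real ^ 'n \<Rightarrow> real" where
  "bump k a b x = (\<Prod>i\<in>UNIV. exp_flat 0 (k * (x $ i - a $ i) - 1) * exp_flat 0 (k * (b $ i - x $ i) - 1))"

lemma bump_bounds: "0 \<le> bump k a b x" "bump k a b x \<le> 1"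
  unfolding bump_def
  by (auto intro!: prod_nonneg prod_le_1 mult_nonneg_nonneg mult_le_one exp_flat_0_bounds)

lemma smooth_bump: "smooth (bump k a b)"
proof -
  have eq: "bump k a b = (\<lambda>x. \<Prod>i\<in>UNIV. exp_flat 0 (k * x $ i + (- k * a $ i - 1)) *
       exp_flat 0 ((- k) * x $ i + (k * b $ i - 1)))"
    by (auto simp: bump_def fun_eq_iff algebra_simps)
  show ?thesis
    unfolding eq
    by (intro flat_algebra_smooth flat_algebra_prod flat_algebra.mult flat_algebra.flat) simp
qed

lemma bump_test_function:
  assumes "k > 0"
  shows "bump k a b \<in> test_functions (box a b)"
proof (rule test_functionsI)
  let ?K = "cbox (\<chi> i. a $ i + 1 / k) (\<chi> i. b $ i - 1 / k)"
  show "compact ?K"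
    by (rule compact_cbox)
  have "1 / k > 0"
    using assms by simp
  show "?K \<subseteq> box a b"
  proof
    fix x assume "x \<in> ?K"
    then have "a $ i + 1 / k \<le> x $ i" "x $ i \<le> b $ i - 1 / k" for i
      by (auto simp: mem_box_cart)
    with \<open>1 / k > 0\<close> have "a $ i < x $ i \<and> x $ i < b $ i" for i
      by (smt (verit))
    then show "x \<in> box a b"
      by (simp add: mem_box_cart)
  qed
  show "smooth (bump k a b)"
    by (rule smooth_bump)
  show "bump k a b x = 0" if "x \<notin> ?K" for x
  proof -
    have "\<not> (\<forall>i. a $ i + 1 / k \<le> x $ i \<and> x $ i \<le> b $ i - 1 / k)"
      using that by (simp add: mem_box_cart)
    then obtain i where "\<not> (a $ i + 1 / k \<le> x $ i \<and> x $ i \<le> b $ i - 1 / k)"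
      by blast
    then have "k * (x $ i - a $ i) - 1 \<le> 0 \<or> k * (b $ i - x $ i) - 1 \<le> 0"
      using assms by (auto simp: field_simps)
    then show ?thesis
      unfolding bump_def by (intro prod_zero bexI[of _ i]) (auto simp: exp_flat_def)
  qed
qed

lemma exp_flat_scaled_limit:
  "(\<lambda>k. exp_flat 0 (real (Suc k) * s - 1)) \<longlonglongrightarrow> (if s > 0 then 1 else 0)"
proof (cases "s > 0")
  case True
  have lim: "filterlim (\<lambda>k. real (Suc k) * s - 1) at_top sequentially"
    unfolding filterlim_at_top
  proof
    fix Z :: real
    obtain N where N: "real N > (Z + 1) / s"
      using reals_Archimedean2 by blast
    have "Z \<le> real (Suc k) * s - 1" if "k \<ge> N" for k
    proof -
      have "(Z + 1) / s < real (Suc k)"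
        using N that by simp
      then show ?thesis
        using True by (simp add: field_simps)
    qed
    then show "\<forall>\<^sub>F k in sequentially. Z \<le> real (Suc k) * s - 1"
      using eventually_sequentially by blast
  qed
  have "(\<lambda>k. exp (- 1 / (real (Suc k) * s - 1))) \<longlonglongrightarrow> exp 0"
    by (intro tendsto_intros tendsto_divide_0[OF tendsto_const] filterlim_at_top_imp_at_infinity lim)
  moreover have "\<forall>\<^sub>F k in sequentially. exp (- 1 / (real (Suc k) * s - 1)) = exp_flat 0 (real (Suc k) * s - 1)"
    using filterlim_at_top_dense[THEN iffD1, OF lim, rule_format, of 0]
    by eventually_elim (simp add: exp_flat_def)
  ultimately show ?thesis
    using True Lim_transform_eventually by fastforce
next
  case False
  then have "real (Suc k) * s - 1 \<le> 0" for k
    using mult_nonneg_nonpos[of "real (Suc k)" s] by (simp del: of_nat_Suc)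
  then have "exp_flat 0 (real (Suc k) * s - 1) = 0" for k
    by (simp add: exp_flat_def leD)
  then show ?thesis
    using False by simp
qed

lemma bump_tendsto_indicator: "(\<lambda>k. bump (real (Suc k)) a b x) \<longlonglongrightarrow> indicator (box a b) x"
proof -
  have "(\<lambda>k. bump (real (Suc k)) a b x) \<longlonglongrightarrow>
     (\<Prod>i\<in>UNIV. (if x $ i - a $ i > 0 then 1 else 0) * (if b $ i - x $ i > 0 then 1 else 0))"
    unfolding bump_def by (intro tendsto_intros exp_flat_scaled_limit)
  also have "(\<Prod>i\<in>UNIV. (if x $ i - a $ i > 0 then 1 else 0) * (if b $ i - x $ i > 0 then 1 else 0)) =
     (indicator (box a b) x :: real)"
  proof (cases "x \<in> box a b")
    case False
    then obtain i where "\<not> (a $ i < x $ i \<and> x $ i < b $ i)"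
      by (auto simp: mem_box_cart)
    with False show ?thesis
      by (subst prod_zero) (auto intro!: exI[of _ i])
  qed (simp add: mem_box_cart)
  finally show ?thesis .
qed

section \<open>Locally integrable functions and kernel functions\<close>

text \<open>Local integrability speaks only of compact sets; the truncations to balls of integer
  radius are measurable and converge pointwise to \<open>v\<close>.\<close>

lemma locally_integrable_borel_measurable:
  fixes v :: "real ^ 'n::finite \<Rightarrow> 'v::euclidean_space"
  assumes "locally_integrable v"
  shows "v \<in> borel_measurable borel"
proof -
  have *: "(\<lambda>x. indicator (cball 0 (real k)) x *\<^sub>R v x) \<in> borel_measurable borel" for k
  proof -
    have "integrable lborel (\<lambda>x. indicator (cball 0 (real k)) x *\<^sub>R v x)"
      using assms compact_cball unfolding locally_integrable_def set_integrable_def by blast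
    then show ?thesis
      using borel_measurable_integrable by fastforce
  qed
  show ?thesis
  proof (rule borel_measurable_LIMSEQ_metric[OF *])
    fix x :: "real ^ 'n"
    obtain k0 where "norm x \<le> real k0"
      using real_arch_simple by blast
    then have "\<forall>\<^sub>F k in sequentially. v x = indicator (cball 0 (real k)) x *\<^sub>R v x"
      by (auto simp: eventually_sequentially intro!: exI[of _ k0])
    then show "(\<lambda>k. indicator (cball 0 (real k)) x *\<^sub>R v x) \<longlonglongrightarrow> v x"
      by (rule Lim_transform_eventually[OF tendsto_const])
  qed
qed

lemma locally_integrable_test_bound:
  fixes v :: "real ^ 'n::finite \<Rightarrow> 'v::euclidean_space"
  assumes "locally_integrable v" "\<phi> \<in> borel_measurable borel" "\<And>x. \<bar>\<phi> x\<bar> \<le> M"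
    and "compact K" "\<And>x. x \<notin> K \<Longrightarrow> \<phi> x = 0"
  shows "integrable lborel (\<lambda>x. \<phi> x *\<^sub>R v x)"
    and "norm (LINT x|lborel. \<phi> x *\<^sub>R v x) \<le> M * (LINT x:K|lborel. norm (v x))"
proof -
  note [measurable] = locally_integrable_borel_measurable[OF assms(1)] assms(2)
  have *: "integrable lborel (\<lambda>x. indicator K x *\<^sub>R norm (v x))"
    using assms(1,4) set_integrable_norm unfolding locally_integrable_def set_integrable_def by blast
  then have i: "integrable lborel (\<lambda>x. M * (indicator K x *\<^sub>R norm (v x)))"
    by (rule integrable_mult_right)
  have b: "norm (\<phi> x *\<^sub>R v x) \<le> M * (indicator K x *\<^sub>R norm (v x))" for x
    using assms(3)[of x] assms(5)[of x] by (cases "x \<in> K") (auto intro: mult_right_mono)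
  show "integrable lborel (\<lambda>x. \<phi> x *\<^sub>R v x)"
    by (rule Bochner_Integration.integrable_bound[OF i]) (use b order_trans[OF b abs_ge_self] in auto)
  have "norm (LINT x|lborel. \<phi> x *\<^sub>R v x) \<le> (LINT x|lborel. M * (indicator K x *\<^sub>R norm (v x)))"
    using integral_norm_bound[of lborel "\<lambda>x. \<phi> x *\<^sub>R v x"]
      integral_mono[OF integrable_norm[OF \<open>integrable lborel (\<lambda>x. \<phi> x *\<^sub>R v x)\<close>] i b] by linarith
  then show "norm (LINT x|lborel. \<phi> x *\<^sub>R v x) \<le> M * (LINT x:K|lborel. norm (v x))"
    by (simp add: set_lebesgue_integral_def)
qed

lemma test_functions_measurable: "\<phi> \<in> test_functions \<Omega> \<Longrightarrow> \<phi> \<in> borel_measurable borel"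
  by (intro borel_measurable_continuous_onI test_functions_continuous)

lemma locally_integrable_test_integrable:
  assumes "locally_integrable v" "\<phi> \<in> test_functions \<Omega>"
  shows "integrable lborel (\<lambda>x. \<phi> x *\<^sub>R v x)"
proof -
  obtain M where M: "\<And>x. \<bar>\<phi> x\<bar> \<le> M"
    using test_functions_bounded[OF assms(2)] by metis
  obtain K where K: "compact K" "\<And>x. x \<notin> K \<Longrightarrow> \<phi> x = 0"
    using test_functionsE[OF assms(2)] by metis
  show ?thesis
    by (rule locally_integrable_test_bound[OF assms(1) test_functions_measurable[OF assms(2)] M K])
qed

lemma locally_integrable_set_integrable:
  assumes "locally_integrable v" "bounded S" "S \<in> sets borel"
  shows "set_integrable lborel S v"
proof (rule set_integrable_subset)
  show "set_integrable lborel (closure S) v"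
    using assms compact_closure unfolding locally_integrable_def by blast
qed (use assms closure_subset in auto)

lemma continuous_locally_integrable:
  fixes v :: "real ^ 'n::finite \<Rightarrow> 'v::euclidean_space"
  assumes "continuous_on UNIV v"
  shows "locally_integrable v"
  unfolding locally_integrable_def set_integrable_def
  using assms by (auto intro!: borel_integrable_compact continuous_on_subset[OF assms])

lemma locally_integrable_lincomb:
  assumes "locally_integrable v" "locally_integrable w"
  shows "locally_integrable (\<lambda>x. a *\<^sub>R v x + b *\<^sub>R w x)"
  using assms unfolding locally_integrable_def
  by (auto intro!: set_integral_add set_integrable_scaleR_right)

section \<open>Distributions given by functions, and the kernel in weak form\<close>

lemma regular_distribution_UNIV:
  "regular_distribution UNIV v \<phi> = (LINT x|lborel. \<phi> x *\<^sub>R v x)"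
  by (simp add: regular_distribution_def set_lebesgue_integral_def)

lemma locally_integrable_distribution:
  assumes "locally_integrable v"
  shows "regular_distribution UNIV v \<in> distributions UNIV"
  unfolding distributions_def
proof (intro CollectI conjI ballI allI impI)
  fix \<phi> \<psi> :: "real ^ 'a \<Rightarrow> real"
  assume "\<phi> \<in> test_functions UNIV" "\<psi> \<in> test_functions UNIV"
  then have "integrable lborel (\<lambda>x. \<phi> x *\<^sub>R v x)" "integrable lborel (\<lambda>x. \<psi> x *\<^sub>R v x)"
    using assms locally_integrable_test_integrable by blast+
  then show "regular_distribution UNIV v (\<lambda>x. \<phi> x + \<psi> x) =
      regular_distribution UNIV v \<phi> + regular_distribution UNIV v \<psi>"
    by (simp add: regular_distribution_UNIV scaleR_add_left)
next
  fix \<phi> :: "real ^ 'a \<Rightarrow> real" and c :: real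
  show "regular_distribution UNIV v (\<lambda>x. c * \<phi> x) = c *\<^sub>R regular_distribution UNIV v \<phi>"
    by (simp add: regular_distribution_UNIV flip: scaleR_scaleR)
next
  fix K :: "(real ^ 'a) set"
  assume K: "compact K \<and> K \<subseteq> UNIV"
  show "\<exists>m C. \<forall>\<phi>\<in>test_functions_on K. \<forall>B.
      (\<forall>is x. length is \<le> m \<longrightarrow> \<bar>partials is \<phi> x\<bar> \<le> B) \<longrightarrow> norm (regular_distribution UNIV v \<phi>) \<le> C * B"
  \<comment> \<open>Such a distribution has order 0: no derivative of the test function enters, and
    the \<open>L^1\<close> norm of \<open>v\<close> on \<open>K\<close> is the constant.\<close>
  proof (intro exI[of _ "0::nat"] exI[of _ "LINT x:K|lborel. norm (v x)"] ballI allI impI)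
    fix \<phi> B assume \<phi>: "\<phi> \<in> test_functions_on K"
      and B: "\<forall>is x. length is \<le> 0 \<longrightarrow> \<bar>partials is \<phi> x\<bar> \<le> B"
    have "\<bar>\<phi> x\<bar> \<le> B" for x
      using B by (simp add: partials_def)
    moreover have "\<phi> \<in> borel_measurable borel" "\<And>x. x \<notin> K \<Longrightarrow> \<phi> x = 0"
      using \<phi> by (auto simp: test_functions_on_def intro!: borel_measurable_continuous_onI smooth_continuous)
    ultimately show "norm (regular_distribution UNIV v \<phi>) \<le> (LINT x:K|lborel. norm (v x)) * B"
      using locally_integrable_test_bound(2)[OF assms, of \<phi> B K] K
      by (simp add: regular_distribution_UNIV mult.commute)
  qed
qed

text \<open>Being a distribution is automatic for a locally integrable function, so membership
  reduces to the weak equation. All later work uses this form.\<close>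

lemma ker_op_iff:
  "v \<in> ker_op A \<longleftrightarrow> locally_integrable v \<and>
     (\<forall>\<phi>\<in>test_functions UNIV. (\<Sum>i\<in>UNIV. A i (LINT x|lborel. partial i \<phi> x *\<^sub>R v x)) = 0)"
  using locally_integrable_distribution
  by (auto simp: ker_op_def ker_distr_def apply_op_def regular_distribution_UNIV)

lemma ker_op_locally_integrable: "v \<in> ker_op A \<Longrightarrow> locally_integrable v"
  by (simp add: ker_op_iff)

lemma ker_op_lincomb:
  fixes A :: "'n::finite \<Rightarrow> 'v::euclidean_space \<Rightarrow> 'w::euclidean_space"
  assumes "first_order_operator A" "v \<in> ker_op A" "w \<in> ker_op A"
  shows "(\<lambda>x. a *\<^sub>R v x + b *\<^sub>R w x) \<in> ker_op A"
  unfolding ker_op_iff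
proof (intro conjI ballI)
  note vl = ker_op_locally_integrable[OF assms(2)] and wl = ker_op_locally_integrable[OF assms(3)]
  show "locally_integrable (\<lambda>x. a *\<^sub>R v x + b *\<^sub>R w x)"
    by (rule locally_integrable_lincomb[OF vl wl])
  fix \<phi> :: "real ^ 'n \<Rightarrow> real" assume \<phi>: "\<phi> \<in> test_functions UNIV"
  have lin: "linear (A i)" for i
    using assms(1) by (simp add: first_order_operator_def)
  have "(LINT x|lborel. partial i \<phi> x *\<^sub>R (a *\<^sub>R v x + b *\<^sub>R w x)) =
      a *\<^sub>R (LINT x|lborel. partial i \<phi> x *\<^sub>R v x) + b *\<^sub>R (LINT x|lborel. partial i \<phi> x *\<^sub>R w x)" for i
  proof -
    have "integrable lborel (\<lambda>x. partial i \<phi> x *\<^sub>R v x)" "integrable lborel (\<lambda>x. partial i \<phi> x *\<^sub>R w x)"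
      using \<phi> vl wl locally_integrable_test_integrable test_functions_partial by blast+
    moreover have "(\<lambda>x. partial i \<phi> x *\<^sub>R (a *\<^sub>R v x + b *\<^sub>R w x)) =
        (\<lambda>x. a *\<^sub>R (partial i \<phi> x *\<^sub>R v x) + b *\<^sub>R (partial i \<phi> x *\<^sub>R w x))"
      by (auto simp: scaleR_add_right mult.commute)
    ultimately show ?thesis
      by (simp del: scaleR_scaleR)
  qed
  then have "(\<Sum>i\<in>UNIV. A i (LINT x|lborel. partial i \<phi> x *\<^sub>R (a *\<^sub>R v x + b *\<^sub>R w x))) =
     a *\<^sub>R (\<Sum>i\<in>UNIV. A i (LINT x|lborel. partial i \<phi> x *\<^sub>R v x)) +
     b *\<^sub>R (\<Sum>i\<in>UNIV. A i (LINT x|lborel. partial i \<phi> x *\<^sub>R w x))"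
    by (simp add: linear_add[OF lin] linear_cmul[OF lin] sum.distrib scaleR_sum_right)
  then show "(\<Sum>i\<in>UNIV. A i (LINT x|lborel. partial i \<phi> x *\<^sub>R (a *\<^sub>R v x + b *\<^sub>R w x))) = 0"
    using assms(2,3) \<phi> by (simp add: ker_op_iff)
qed


section \<open>Functions and measures annihilating all test functions\<close>

text \<open>Bumps increase from inside the box to its indicator in the limit. The dominating
  function lives on the closed box, since local integrability concerns compact sets.\<close>

lemma box_integral_zero:
  fixes v :: "real ^ 'n::finite \<Rightarrow> 'v::euclidean_space"
  assumes "locally_integrable v"
    and "\<And>\<phi>. \<phi> \<in> test_functions UNIV \<Longrightarrow> (LINT x|lborel. \<phi> x *\<^sub>R v x) = 0"
  shows "(LINT x:box a b|lborel. v x) = 0"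
proof -
  note [measurable] = locally_integrable_borel_measurable[OF assms(1)]
  have [measurable]: "bump k a b \<in> borel_measurable borel" for k
    by (intro borel_measurable_continuous_onI smooth_continuous smooth_bump)
  have zero: "(LINT x|lborel. bump (real (Suc k)) a b x *\<^sub>R v x) = 0" for k
    using assms(2) bump_test_function[of "real (Suc k)" a b] test_functions_mono[OF subset_UNIV] by fastforce
  have "(\<lambda>k. LINT x|lborel. bump (real (Suc k)) a b x *\<^sub>R v x) \<longlonglongrightarrow>
      (LINT x|lborel. indicator (box a b) x *\<^sub>R v x)"
  proof (rule integral_dominated_convergence)
    have "integrable lborel (\<lambda>x. indicator (cbox a b) x *\<^sub>R v x)"
      using assms(1) compact_cbox unfolding locally_integrable_def set_integrable_def by blast
    then show "integrable lborel (\<lambda>x. norm (indicator (cbox a b) x *\<^sub>R v x))"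
      by (rule integrable_norm)
    show "AE x in lborel. norm (bump (real (Suc k)) a b x *\<^sub>R v x) \<le> norm (indicator (cbox a b) x *\<^sub>R v x)" for k
    proof (intro AE_I2)
      fix x
      have "bump (real (Suc k)) a b x = 0" if "x \<notin> box a b"
        using bump_test_function[of "real (Suc k)" a b] that
        by (metis of_nat_0_less_iff subsetD test_functionsE zero_less_Suc)
      then show "norm (bump (real (Suc k)) a b x *\<^sub>R v x) \<le> norm (indicator (cbox a b) x *\<^sub>R v x)"
        using bump_bounds[of "real (Suc k)" a b x] box_subset_cbox[of a b]
        by (cases "x \<in> box a b") (auto intro!: mult_left_le_one_le simp: subset_iff)
    qed
  qed (auto intro!: tendsto_intros bump_tendsto_indicator simp del: of_nat_Suc)
  then show ?thesis
    unfolding zero by (simp add: LIMSEQ_const_iff set_lebesgue_integral_def)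
qed

text \<open>Open boxes form an intersection-stable generator of the Borel sets, so by Dynkin
  induction the integral vanishes over every Borel set.\<close>

lemma AE_zero_of_box_integrals:
  fixes v :: "real ^ 'n::finite \<Rightarrow> 'v::euclidean_space"
  assumes v: "integrable lborel v" and box: "\<And>a b. (LINT x:box a b|lborel. v x) = 0"
  shows "AE x in lborel. v x = 0"
proof (rule sigma_finite_measure.density_zero[OF sigma_finite_lborel v])
  have si: "set_integrable lborel E v" if "E \<in> sets borel" for E
    using v that by (auto simp: set_integrable_def intro: integrable_mult_indicator)
  \<comment> \<open>The complement step of the induction subtracts from the integral over the whole
    space, which is the limit of integrals over growing boxes.\<close>
  have UNIV: "(LINT x:UNIV|lborel. v x) = 0"
  proof -
    have U: "(\<Union>k. box (\<chi> i. - real k) (\<chi> i. real k)) = (UNIV :: (real ^ 'n) set)"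
    proof -
      have "x \<in> (\<Union>k. box (\<chi> i. - real k) (\<chi> i. real k))" for x :: "real ^ 'n"
      proof -
        obtain k where "norm x < real k"
          using reals_Archimedean2 by blast
        then have "\<bar>x $ i\<bar> < real k" for i
          using component_le_norm_cart[of x i] by linarith
        then have "- real k < x $ i \<and> x $ i < real k" for i
          by (smt (verit))
        then have "x \<in> box (\<chi> i. - real k) (\<chi> i. real k)"
          by (simp add: mem_box_cart)
        then show ?thesis
          by blast
      qed
      then show ?thesis by blast
    qed
    have "(\<lambda>k. LINT x:box (\<chi> i. - real k) (\<chi> i. real k)|lborel. v x) \<longlonglongrightarrow>
        (LINT x:(\<Union>k. box (\<chi> i. - real k) (\<chi> i. real k))|lborel. v x)"
    proof (rule set_integral_cont_up)
      show "incseq (\<lambda>k. box (\<chi> i. - real k) (\<chi> i. real k) :: (real ^ 'n) set)"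
        unfolding incseq_def
      proof (intro allI impI subsetI)
        fix j k :: nat and x :: "real ^ 'n"
        assume "j \<le> k" "x \<in> box (\<chi> i. - real j) (\<chi> i. real j)"
        then have "real j \<le> real k" "- real j < x $ i \<and> x $ i < real j" for i
          by (auto simp: mem_box_cart)
        then have "- real k < x $ i \<and> x $ i < real k" for i
          by (smt (verit))
        then show "x \<in> box (\<chi> i. - real k) (\<chi> i. real k)"
          by (simp add: mem_box_cart)
      qed
    qed (auto intro!: si)
    then show ?thesis
      unfolding box U by (simp add: LIMSEQ_const_iff)
  qed
  fix E :: "(real ^ 'n) set" assume "E \<in> sets lborel"
  then have E: "E \<in> sigma_sets UNIV (range (\<lambda>(a, b). box a b))"
    by (simp add: borel_eq_box)
  have "Int_stable (range (\<lambda>(a, b). box a (b :: real ^ 'n)))"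
    by (auto simp: Int_stable_def box_Int_box)
  moreover have "range (\<lambda>(a, b). box a (b :: real ^ 'n)) \<subseteq> Pow UNIV"
    by simp
  ultimately show "(LINT x:E|lborel. v x) = 0"
    using E
  proof (induction E rule: sigma_sets_induct_disjoint)
    case (compl E)
    then have "E \<in> sets borel"
      by (simp add: borel_eq_box)
    then have "(LINT x:(E \<union> (UNIV - E))|lborel. v x) = (LINT x:E|lborel. v x) + (LINT x:(UNIV - E)|lborel. v x)"
      by (intro set_integral_Un si) auto
    then show ?case
      using compl UNIV by simp
  next
    case (union E)
    then have "range E \<subseteq> sets borel"
      by (auto simp: borel_eq_box)
    then have "(LINT x:(\<Union>i. E i)|lborel. v x) = (\<Sum>i. (LINT x:(E i)|lborel. v x))"
      using union by (intro lebesgue_integral_countable_add si) (auto simp: disjoint_family_on_def)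
    then show ?case
      using union by simp
  qed (use box in \<open>auto simp: set_lebesgue_integral_def\<close>)
qed

text \<open>Truncation to a large box makes \<open>v\<close> integrable, and since two boxes meet in
  a box, the truncated function still has vanishing box integrals. Countably many truncations cover
  the space.\<close>

lemma AE_zero_of_test_functions:
  fixes v :: "real ^ 'n::finite \<Rightarrow> 'v::euclidean_space"
  assumes "locally_integrable v"
    and "\<And>\<phi>. \<phi> \<in> test_functions UNIV \<Longrightarrow> (LINT x|lborel. \<phi> x *\<^sub>R v x) = 0"
  shows "AE x in lborel. v x = 0"
proof -
  have "AE x in lborel. indicator (box (\<chi> i. - real k) (\<chi> i. real k)) x *\<^sub>R v x = 0" for k
  proof (rule AE_zero_of_box_integrals)
    show "integrable lborel (\<lambda>x. indicator (box (\<chi> i. - real k) (\<chi> i. real k)) x *\<^sub>R v x)"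
      using locally_integrable_set_integrable[OF assms(1) bounded_box] unfolding set_integrable_def by auto
    fix a b :: "real ^ 'n"
    obtain c d where "box a b \<inter> box (\<chi> i. - real k) (\<chi> i. real k) = box c d"
      using box_Int_box by blast
    then have "(LINT x:box a b|lborel. indicator (box (\<chi> i. - real k) (\<chi> i. real k)) x *\<^sub>R v x) = (LINT x:box c d|lborel. v x)"
      by (auto simp: set_lebesgue_integral_def indicator_inter_arith[symmetric])
    then show "(LINT x:box a b|lborel. indicator (box (\<chi> i. - real k) (\<chi> i. real k)) x *\<^sub>R v x) = 0"
      using box_integral_zero[OF assms] by simp
  qed
  then have "AE x in lborel. \<forall>k. indicator (box (\<chi> i. - real k) (\<chi> i. real k)) x *\<^sub>R v x = 0"
    unfolding AE_all_countable by blast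
  then show ?thesis
  proof (rule AE_mp, intro AE_I2 impI)
    fix x :: "real ^ 'n"
    assume *: "\<forall>k. indicator (box (\<chi> i. - real k) (\<chi> i. real k)) x *\<^sub>R v x = 0"
    obtain k where "norm x < real k"
      using reals_Archimedean2 by blast
    then have "\<bar>x $ i\<bar> < real k" for i
      using component_le_norm_cart[of x i] by linarith
    then have "- real k < x $ i \<and> x $ i < real k" for i
      by (smt (verit))
    then have "x \<in> box (\<chi> i. - real k) (\<chi> i. real k)"
      by (simp add: mem_box_cart)
    with * show "v x = 0"
      by (metis indicator_simps(1) scaleR_one)
  qed
qed

text \<open>Every open subset of \<Omega> is a countable union of open boxes contained in it. These
  boxes matter because their indicators are limits of test functions on \<Omega>.\<close>

lemma restrict_borel_eq_sigma_boxes: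
  fixes \<Omega> :: "(real ^ 'n::finite) set"
  assumes "open \<Omega>"
  shows "sets (restrict_space borel \<Omega>) = sigma_sets \<Omega> {box a b |a b. box a b \<subseteq> \<Omega>}"
proof
  let ?E = "{box a b |a b. box a b \<subseteq> \<Omega>}"
  interpret S: sigma_algebra \<Omega> "sigma_sets \<Omega> ?E"
    by (rule sigma_algebra_sigma_sets) auto
  have "sets (restrict_space borel \<Omega>) = (\<inter>) \<Omega> ` sigma_sets UNIV {S. open S}"
    by (simp add: sets_restrict_space borel_def)
  also have "\<dots> = sigma_sets \<Omega> ((\<inter>) \<Omega> ` {S. open S})"
    using assms by (intro sigma_sets_Int) auto
  also have "\<dots> \<subseteq> sigma_sets \<Omega> ?E"
  proof (rule S.sigma_sets_subset, clarify)
    fix S :: "(real ^ 'n) set" assume "open S"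
    then have "open (\<Omega> \<inter> S)"
      using assms by blast
    then obtain D where D: "countable D" "D \<subseteq> Pow (\<Omega> \<inter> S)" "\<And>X. X \<in> D \<Longrightarrow> \<exists>a b. X = box a b" "\<Union>D = \<Omega> \<inter> S"
      using open_countable_Union_open_box by metis
    have "D \<subseteq> sigma_sets \<Omega> ?E"
    proof
      fix X assume "X \<in> D"
      then have "X \<in> ?E"
        using D(2,3) by blast
      then show "X \<in> sigma_sets \<Omega> ?E"
        by (rule sigma_sets.Basic)
    qed
    then show "\<Omega> \<inter> S \<in> sigma_sets \<Omega> ?E"
      using S.countable_Union[OF D(1)] D(4) by metis
  qed
  finally show "sets (restrict_space borel \<Omega>) \<subseteq> sigma_sets \<Omega> ?E" .
  show "sigma_sets \<Omega> ?E \<subseteq> sets (restrict_space borel \<Omega>)"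
  proof -
    have "?E \<subseteq> sets (restrict_space borel \<Omega>)"
      using assms by (auto simp: sets_restrict_space_iff)
    then show ?thesis
      using sets.sigma_sets_subset[of ?E "restrict_space borel \<Omega>"] by (simp add: space_restrict_space)
  qed
qed

text \<open>Integrating the bumps of a box inside \<Omega> gives, in the limit, the measure of the
  box; two finite measures that agree on the boxes agree on what they generate.\<close>

lemma measure_eqI_test_functions:
  fixes \<Omega> :: "(real ^ 'n::finite) set"
  assumes "open \<Omega>" "finite_measure P" "finite_measure Q"
    and sets: "sets P = sets (restrict_space borel \<Omega>)" "sets Q = sets (restrict_space borel \<Omega>)"
    and eq: "\<And>\<phi>. \<phi> \<in> test_functions \<Omega> \<Longrightarrow> (LINT x|P. \<phi> x) = (LINT x|Q. \<phi> x)"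
  shows "P = Q"
proof -
  let ?E = "{box a b |a b. box a b \<subseteq> \<Omega>}"
  have lim: "(\<lambda>k. LINT x|R. bump (real (Suc k)) a b x) \<longlonglongrightarrow> measure R (box a b)"
    if R: "finite_measure R" "sets R = sets (restrict_space borel \<Omega>)" and ab: "box a b \<subseteq> \<Omega>" for R a b
  proof -
    interpret finite_measure R by (fact R)
    have [measurable]: "f \<in> borel_measurable R" if "f \<in> borel_measurable borel" for f :: "real ^ 'n \<Rightarrow> real"
      using measurable_restrict_space1[OF that] R(2) by (simp cong: measurable_cong_sets)
    have "(\<lambda>k. LINT x|R. bump (real (Suc k)) a b x) \<longlonglongrightarrow> (LINT x|R. indicator (box a b) x)"
    proof (rule integral_dominated_convergence[where w="\<lambda>_. 1"])
      show "bump (real (Suc k)) a b \<in> borel_measurable R" for k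
        by (intro \<open>\<And>f. f \<in> borel_measurable borel \<Longrightarrow> f \<in> borel_measurable R\<close>
            borel_measurable_continuous_onI smooth_continuous smooth_bump)
        show "AE x in R. norm (bump (real (Suc k)) a b x) \<le> 1" for k
        using bump_bounds[of "real (Suc k)" a b] by (intro AE_I2) (simp del: of_nat_Suc)
    qed (auto intro!: bump_tendsto_indicator simp del: of_nat_Suc)
    moreover have "box a b \<subseteq> space R"
      using R(2)[THEN sets_eq_imp_space_eq] ab by (simp add: space_restrict_space)
    ultimately show ?thesis
      by (simp add: Int_absorb2)
  qed
  obtain D where D: "countable D" "D \<subseteq> Pow \<Omega>" "\<And>X. X \<in> D \<Longrightarrow> \<exists>a b. X = box a b" "\<Union>D = \<Omega>"
    using open_countable_Union_open_box[OF assms(1)] by metis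
  \<comment> \<open>The uniqueness theorem wants a sequence of generator sets covering \<Omega>.
    Adding the empty set, itself a degenerate box, keeps the family nonempty so that it can be
    enumerated.\<close>
  define B where "B = from_nat_into (insert {} D)"
  have B: "range B = insert {} D"
    unfolding B_def by (intro range_from_nat_into) (use D(1) in auto)
  show ?thesis
  proof (rule measure_eqI_generator_eq[where E="?E" and A=B])
    show "Int_stable ?E"
      unfolding Int_stable_def using box_Int_box by (smt (verit) Int_subset_iff le_infI1 mem_Collect_eq)
    show "emeasure P X = emeasure Q X" if "X \<in> ?E" for X
    proof -
      obtain a b where X: "X = box a b" and ab: "box a b \<subseteq> \<Omega>"
        using \<open>X \<in> ?E\<close> by blast
      have "(LINT x|P. bump (real (Suc k)) a b x) = (LINT x|Q. bump (real (Suc k)) a b x)" for k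
        using eq bump_test_function[of "real (Suc k)" a b] test_functions_mono[OF ab] by fastforce
      then have "measure P X = measure Q X"
        using lim[OF assms(2) sets(1) ab] lim[OF assms(3) sets(2) ab] LIMSEQ_unique
        unfolding X by auto
      then show ?thesis
        using assms(2,3) by (simp add: finite_measure.emeasure_eq_measure)
    qed
    show "range B \<subseteq> ?E"
    proof -
      have "{} = box (0 :: real ^ 'n) 0"
        by simp
      then show ?thesis
        unfolding B using D(2,3) by blast
    qed
    show "\<Union>(range B) = \<Omega>"
      unfolding B using D(4) by simp
    show "emeasure P (B i) \<noteq> \<infinity>" for i
      using assms(2) finite_measure.emeasure_finite by auto
  qed (use sets restrict_borel_eq_sigma_boxes[OF assms(1)] in auto)
qed

section \<open>The measure representing a kernel function\<close>

locale bounded_signed_measure =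
  fixes M :: "'a measure" and s :: "'a set \<Rightarrow> real" and B :: real
  assumes sums: "\<And>E::nat \<Rightarrow> 'a set. range E \<subseteq> sets M \<Longrightarrow> disjoint_family E \<Longrightarrow> (\<lambda>k. s (E k)) sums s (\<Union>k. E k)"
    and bounded: "\<And>E. E \<in> sets M \<Longrightarrow> \<bar>s E\<bar> \<le> B"
begin

definition pos :: "'a set \<Rightarrow> ennreal" where
  "pos E = (SUP F\<in>{F \<in> sets M. F \<subseteq> E}. ennreal (s F))"

lemma empty: "s {} = 0"
proof -
  have "(\<lambda>k. s {}) sums s (\<Union>k::nat. {})"
    by (rule sums) (auto simp: disjoint_family_on_def)
  then have "(\<lambda>k. s {}) \<longlonglongrightarrow> 0"
    by (rule summable_LIMSEQ_zero[OF sums_summable])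
  then show ?thesis
    by (simp add: LIMSEQ_const_iff)
qed

lemma Un:
  assumes "E \<in> sets M" "F \<in> sets M" "E \<inter> F = {}"
  shows "s (E \<union> F) = s E + s F"
proof -
  let ?G = "binaryset E F"
  have "(\<lambda>k. s (?G k)) sums s (\<Union>k. ?G k)"
    by (rule sums) (use assms in \<open>auto simp: disjoint_family_on_def binaryset_def\<close>)
  moreover have "(\<lambda>k. s (?G k)) sums (s E + s F)"
    using binaryset_sums[of s] empty by simp
  ultimately show ?thesis
    using sums_unique2 by (fastforce simp: UN_binaryset_eq)
qed

lemma pos_upper: "F \<in> sets M \<Longrightarrow> F \<subseteq> E \<Longrightarrow> ennreal (s F) \<le> pos E"
  unfolding pos_def by (intro SUP_upper) auto

lemma pos_mono: "E \<subseteq> F \<Longrightarrow> pos E \<le> pos F"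
  unfolding pos_def by (intro SUP_subset_mono) auto

lemma pos_empty: "pos {} = 0"
proof -
  have "{F \<in> sets M. F \<subseteq> {}} = {{}}"
    by auto
  then show ?thesis
    by (simp add: pos_def empty)
qed

lemma pos_le: "pos E \<le> ennreal B"
  unfolding pos_def using bounded by (intro SUP_least ennreal_leI) (auto simp: abs_le_iff)

text \<open>A set competing for \<open>E\<close> and one competing for \<open>F\<close> are
  disjoint, so their union competes for the union. Truncation at 0 forces the case split: if one
  value is nonpositive, the other set alone is the competitor.\<close>

lemma pos_superadditive:
  assumes "E \<inter> F = {}"
  shows "pos E + pos F \<le> pos (E \<union> F)"
proof -
  have *: "ennreal (s G) + ennreal (s H) \<le> pos (E \<union> F)"
    if "G \<in> sets M" "G \<subseteq> E" "H \<in> sets M" "H \<subseteq> F" for G H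
  proof -
    consider "s G \<le> 0" | "s H \<le> 0" | "s G \<ge> 0" "s H \<ge> 0" by linarith
    then show ?thesis
    proof cases
      case 1
      then show ?thesis
        using pos_upper[of H "E \<union> F"] that by (auto simp: ennreal_neg)
    next
      case 2
      then show ?thesis
        using pos_upper[of G "E \<union> F"] that by (auto simp: ennreal_neg)
    next
      case 3
      then have "ennreal (s G) + ennreal (s H) = ennreal (s (G \<union> H))"
        using Un[OF that(1,3)] that(2,4) assms by (subst ennreal_plus[symmetric]) force+
      then show ?thesis
        using pos_upper[of "G \<union> H" "E \<union> F"] that by auto
    qed
  qed
  have ne: "{F' \<in> sets M. F' \<subseteq> D} \<noteq> {}" for D
    by blast
  have "ennreal (s G) + pos F \<le> pos (E \<union> F)" if "G \<in> sets M" "G \<subseteq> E" for G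
    unfolding pos_def[of F] ennreal_SUP_add_right[OF ne] using * that by (intro SUP_least) auto
  then show ?thesis
    unfolding pos_def[of E] ennreal_SUP_add_left[OF ne, symmetric] by (intro SUP_least) auto
qed

text \<open>This is what makes \<open>measure_of\<close> inside \<open>positive_part\<close> return
  the values \<open>pos\<close>. One inequality is superadditivity; for the other a competitor
  \<open>F\<close> of the union is cut into the pieces \<open>F \<inter> E k\<close>.\<close>

lemma pos_countably_additive: "countably_additive (sets M) pos"
proof (rule countably_additiveI)
  fix E :: "nat \<Rightarrow> 'a set"
  assume E: "range E \<subseteq> sets M" "disjoint_family E" and "(\<Union>i. E i) \<in> sets M"
  show "(\<Sum>i. pos (E i)) = pos (\<Union>i. E i)"
  proof (rule antisym)
    have "(\<Sum>i<n. pos (E i)) \<le> pos (\<Union>i<n. E i)" for n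
    proof (induction n)
      case 0
      then show ?case by simp
    next
      case (Suc n)
      have "(\<Union>i<n. E i) \<inter> E n = {}"
        using E(2) disjoint_family_onD[of E UNIV _ n] by fast
      then have "(\<Sum>i<n. pos (E i)) + pos (E n) \<le> pos ((\<Union>i<n. E i) \<union> E n)"
        using add_right_mono[OF Suc.IH] pos_superadditive order_trans by blast
      then show ?case
        by (simp add: lessThan_Suc Un_commute add.commute)
    qed
    moreover have "pos (\<Union>i<n. E i) \<le> pos (\<Union>i. E i)" for n
      by (rule pos_mono) blast
    ultimately have "(\<Sum>i<n. pos (E i)) \<le> pos (\<Union>i. E i)" for n
      using order_trans by blast
    then show "(\<Sum>i. pos (E i)) \<le> pos (\<Union>i. E i)"
      by (rule suminf_le_const[OF summableI])
    show "pos (\<Union>i. E i) \<le> (\<Sum>i. pos (E i))"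
      unfolding pos_def[of "\<Union>i. E i"]
    proof (rule SUP_least)
      fix F assume F: "F \<in> {F \<in> sets M. F \<subseteq> (\<Union>i. E i)}"
      have "(\<lambda>k. s (F \<inter> E k)) sums s (\<Union>k. F \<inter> E k)"
        by (rule sums) (use E F in \<open>auto simp: disjoint_family_on_def\<close>)
      moreover have "(\<Union>k. F \<inter> E k) = F"
        using F by auto
      ultimately have lim: "(\<lambda>n. ennreal (\<Sum>k<n. s (F \<inter> E k))) \<longlonglongrightarrow> ennreal (s F)"
        by (simp add: sums_def tendsto_ennrealI)
      have "ennreal (\<Sum>k<n. s (F \<inter> E k)) \<le> (\<Sum>i. pos (E i))" for n
      proof -
        \<comment> \<open>The terms may be negative, and \<open>ennreal\<close> is additive only on
          nonnegative numbers, so they are first replaced by their positive parts.\<close>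
        have "ennreal (\<Sum>k<n. s (F \<inter> E k)) \<le> ennreal (\<Sum>k<n. max 0 (s (F \<inter> E k)))"
          by (intro ennreal_leI sum_mono) auto
        also have "\<dots> = (\<Sum>k<n. ennreal (s (F \<inter> E k)))"
          by (subst sum_ennreal[symmetric]) (auto simp: ennreal_max_0)
        also have "\<dots> \<le> (\<Sum>k<n. pos (E k))"
          by (intro sum_mono pos_upper) (use E F in auto)
        also have "\<dots> \<le> (\<Sum>i. pos (E i))"
          by (intro sum_le_suminf) auto
        finally show ?thesis .
      qed
      then show "ennreal (s F) \<le> (\<Sum>i. pos (E i))"
        by (intro LIMSEQ_le_const2[OF lim]) auto
    qed
  qed
qed

lemma space_positive_part: "space (positive_part M s) = space M"
  by (simp add: positive_part_def space_measure_of_conv)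

lemma sets_positive_part: "sets (positive_part M s) = sets M"
  by (simp add: positive_part_def)

lemma emeasure_positive_part:
  assumes "E \<in> sets M"
  shows "emeasure (positive_part M s) E = pos E"
proof -
  have "positive_part M s = measure_of (space M) (sets M) pos"
    unfolding positive_part_def pos_def ..
  then show ?thesis
    using emeasure_measure_of_sigma[OF sets.sigma_algebra_axioms _ pos_countably_additive assms]
    by (simp add: positive_def pos_empty)
qed

lemma finite_positive_part: "finite_measure (positive_part M s)"
proof
  have "emeasure (positive_part M s) (space M) \<le> ennreal B"
    using emeasure_positive_part[OF sets.top] pos_le by simp
  then show "emeasure (positive_part M s) (space (positive_part M s)) \<noteq> \<infinity>"
    unfolding space_positive_part using le_less_trans[OF _ ennreal_less_top] by fastforce
qed

end

section \<open>A measure is determined by its integrals against test functions\<close>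

lemma bounded_signed_measure_uminus:
  "bounded_signed_measure M s B \<Longrightarrow> bounded_signed_measure M (\<lambda>E. - s E) B"
  by (auto simp: bounded_signed_measure_def intro: sums_minus)

text \<open>If \<open>s E < 0\<close>, then each \<open>F\<close> in \<open>E\<close> with
  \<open>s F \<ge> 0\<close> satisfies \<open>s F - s E = - s (E - F)\<close>, a value competing for
  the negative part. So the negative part of \<open>E\<close> exceeds the positive part by at least
  \<open>- s E\<close>, which is impossible when both are equal and finite.\<close>

lemma signed_measure_nonneg_of_parts_eq:
  assumes "bounded_signed_measure M s B"
    and eq: "positive_part M s = positive_part M (\<lambda>E. - s E)" and E: "E \<in> sets M"
  shows "0 \<le> s E"
proof (rule ccontr)
  interpret P: bounded_signed_measure M s B by fact
  interpret N: bounded_signed_measure M "\<lambda>E. - s E" B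
    by (rule bounded_signed_measure_uminus[OF assms(1)])
  assume "\<not> 0 \<le> s E"
  then have d: "- s E > 0" by simp
  have pn: "P.pos E = N.pos E"
    using P.emeasure_positive_part[OF E] N.emeasure_positive_part[OF E] eq by simp
  have *: "ennreal (s F) + ennreal (- s E) \<le> N.pos E" if "F \<in> sets M" "F \<subseteq> E" for F
  proof (cases "s F \<ge> 0")
    case True
    have "s E = s F + s (E - F)"
      using P.Un[of F "E - F"] that E by (simp add: Un_absorb1 sets.Diff)
    then have "ennreal (s F) + ennreal (- s E) = ennreal (- s (E - F))"
      using True d by (subst ennreal_plus[symmetric]) auto
    then show ?thesis
      using N.pos_upper[of "E - F" E] that E by auto
  next
    case False
    then show ?thesis
      using N.pos_upper[of E E] E by (simp add: ennreal_neg)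
  qed
  have ne: "{F \<in> sets M. F \<subseteq> E} \<noteq> {}"
    by blast
  have "P.pos E + ennreal (- s E) \<le> P.pos E"
    unfolding pn unfolding pn[symmetric]
    unfolding P.pos_def[of E] ennreal_SUP_add_left[OF ne, symmetric]
    unfolding P.pos_def[of E, symmetric] pn using * by (intro SUP_least) auto
  moreover have "P.pos E < top"
    using le_less_trans[OF P.pos_le ennreal_less_top] .
  ultimately have "ennreal (- s E) \<le> 0"
    using ennreal_add_left_cancel_le[of "P.pos E" "ennreal (- s E)" 0] by auto
  with d show False
    by (simp add: ennreal_eq_0_iff)
qed

text \<open>Vanishing integrals say that the two Jordan parts have the same integrals, hence
  coincide; the sign argument then applies to \<open>s\<close> and to \<open>- s\<close>.\<close>

lemma signed_measure_zero_of_integrals: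
  fixes \<Omega> :: "(real ^ 'n::finite) set"
  assumes "open \<Omega>" and s: "bounded_signed_measure (restrict_space borel \<Omega>) s B"
    and int: "\<And>\<phi>. \<phi> \<in> test_functions \<Omega> \<Longrightarrow> signed_integral (restrict_space borel \<Omega>) s \<phi> = 0"
    and E: "E \<in> sets (restrict_space borel \<Omega>)"
  shows "s E = 0"
proof -
  let ?M = "restrict_space borel \<Omega>"
  note n = bounded_signed_measure_uminus[OF s]
  have eq: "positive_part ?M s = positive_part ?M (\<lambda>E. - s E)"
  proof (rule measure_eqI_test_functions[OF assms(1)])
    fix \<phi> assume "\<phi> \<in> test_functions \<Omega>"
    then show "(LINT x|positive_part ?M s. \<phi> x) = (LINT x|positive_part ?M (\<lambda>E. - s E). \<phi> x)"
      using int by (simp add: signed_integral_def)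
  qed (rule bounded_signed_measure.finite_positive_part[OF s] bounded_signed_measure.finite_positive_part[OF n]
      bounded_signed_measure.sets_positive_part[OF s] bounded_signed_measure.sets_positive_part[OF n])+
  have "0 \<le> s E"
    by (rule signed_measure_nonneg_of_parts_eq[OF s eq E])
  moreover have "0 \<le> - s E"
    using signed_measure_nonneg_of_parts_eq[OF n _ E] eq by simp
  ultimately show ?thesis by simp
qed

lemma finite_vector_measure_component:
  assumes "finite_vector_measure M \<mu>"
  obtains B where "bounded_signed_measure M (\<lambda>E. \<mu> E \<bullet> b) B"
proof
  let ?V = "enn2real (variation M \<mu>)"
  have fin: "variation M \<mu> < top"
    using assms by (simp add: finite_vector_measure_def)
  show "bounded_signed_measure M (\<lambda>E. \<mu> E \<bullet> b) (?V * norm b)"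
  proof
    fix E :: "nat \<Rightarrow> _" assume "range E \<subseteq> sets M" "disjoint_family E"
    then have "(\<lambda>k. \<mu> (E k)) sums \<mu> (\<Union>k. E k)"
      using assms by (simp add: finite_vector_measure_def)
    then show "(\<lambda>k. \<mu> (E k) \<bullet> b) sums (\<mu> (\<Union>k. E k) \<bullet> b)"
      by (rule bounded_linear.sums[OF bounded_linear_inner_left])
  next
    fix E assume E: "E \<in> sets M"
    \<comment> \<open>A single set is an admissible family in the supremum defining the
      variation.\<close>
    have "(\<Sum>E\<in>{E}. ennreal (norm (\<mu> E))) \<le> variation M \<mu>"
      unfolding variation_def by (intro SUP_upper) (use E in \<open>auto simp: disjoint_def\<close>)
    then have "norm (\<mu> E) \<le> ?V"
      using fin enn2real_mono[of "ennreal (norm (\<mu> E))" "variation M \<mu>"] by simp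
    then show "\<bar>\<mu> E \<bullet> b\<bar> \<le> ?V * norm b"
      by (meson Cauchy_Schwarz_ineq2 mult_right_mono norm_ge_zero order_trans)
  qed
qed

lemma variation_zero:
  assumes "\<And>E. E \<in> sets M \<Longrightarrow> \<mu> E = 0"
  shows "variation M \<mu> = 0"
proof -
  have "variation M \<mu> \<le> 0"
    unfolding variation_def
  proof (rule SUP_least)
    fix P assume "P \<in> {P. finite P \<and> P \<subseteq> sets M \<and> disjoint P}"
    then have "ennreal (norm (\<mu> E)) = 0" if "E \<in> P" for E
      using assms that by auto
    then show "(\<Sum>E\<in>P. ennreal (norm (\<mu> E))) \<le> 0"
      by (simp add: sum.neutral)
  qed
  then show ?thesis
    by simp
qed

lemma variation_zero_of_integrals:
  fixes \<Omega> :: "(real ^ 'n::finite) set"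
  assumes "open \<Omega>" "finite_vector_measure (restrict_space borel \<Omega>) \<mu>"
    and int: "\<And>\<phi>. \<phi> \<in> test_functions \<Omega> \<Longrightarrow> vector_integral (restrict_space borel \<Omega>) \<mu> \<phi> = 0"
  shows "variation (restrict_space borel \<Omega>) \<mu> = 0"
proof (rule variation_zero)
  fix E assume E: "E \<in> sets (restrict_space borel \<Omega>)"
  have "\<mu> E \<bullet> b = 0" if b: "b \<in> Basis" for b
  proof -
    obtain B where "bounded_signed_measure (restrict_space borel \<Omega>) (\<lambda>E. \<mu> E \<bullet> b) B"
      using finite_vector_measure_component[OF assms(2)] .
    then show ?thesis
    proof (rule signed_measure_zero_of_integrals[OF assms(1) _ _ E])
      fix \<phi> assume "\<phi> \<in> test_functions \<Omega>"
      then have "vector_integral (restrict_space borel \<Omega>) \<mu> \<phi> \<bullet> b = 0"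
        using int by simp
      then show "signed_integral (restrict_space borel \<Omega>) (\<lambda>E. \<mu> E \<bullet> b) \<phi> = 0"
        unfolding vector_integral_def inner_sum_left_Basis[OF b] .
    qed
  qed
  with euclidean_eqI[of "\<mu> E" 0] show "\<mu> E = 0"
    by simp
qed

lemma op_measure_zero:
  fixes A :: "'n::finite \<Rightarrow> 'v::euclidean_space \<Rightarrow> 'w::euclidean_space"
  assumes "\<And>\<phi>. \<phi> \<in> test_functions \<Omega> \<Longrightarrow> apply_op A (regular_distribution \<Omega> u) \<phi> = 0"
  shows "op_measure \<Omega> A u (\<lambda>_. 0)"
  unfolding op_measure_def finite_vector_measure_def
proof (intro conjI ballI allI impI)
  show "variation (restrict_space borel \<Omega>) (\<lambda>_. 0 :: 'w) < \<infinity>"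
    by (subst variation_zero) auto
  fix \<phi> assume "\<phi> \<in> test_functions \<Omega>"
  then show "apply_op A (regular_distribution \<Omega> u) \<phi> = vector_integral (restrict_space borel \<Omega>) (\<lambda>_. 0) \<phi>"
    using assms by (simp add: vector_integral_def signed_integral_def)
qed simp

section \<open>Kernel functions inside the space BV\<close>

lemma variation_uminus: "variation M (\<lambda>E. - \<mu> E) = variation M \<mu>"
  by (simp add: variation_def)

lemma vector_integral_uminus: "vector_integral M (\<lambda>E. - \<mu> E) \<phi> = - vector_integral M \<mu> \<phi>"
  by (simp add: vector_integral_def signed_integral_def sum_negf[symmetric] scaleR_minus_left[symmetric]
      del: scaleR_minus_left)

text \<open>Used to write \<rho> as \<open>u + (- 1) *\<^sub>R (u - \<rho>)\<close> in the final
  estimate, where the triangle inequality for \<open>N\<close> is available only on BV.\<close>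

lemma BV_uminus:
  fixes A :: "'n::finite \<Rightarrow> 'v::euclidean_space \<Rightarrow> 'w::euclidean_space"
  assumes "first_order_operator A" "u \<in> BV \<Omega> A"
  shows "(\<lambda>x. (- 1) *\<^sub>R u x) \<in> BV \<Omega> A"
proof -
  obtain \<mu> where \<mu>: "op_measure \<Omega> A u \<mu>" and u: "set_integrable lborel \<Omega> u"
    using assms(2) by (auto simp: BV_def)
  have lin: "linear (A i)" for i
    using assms(1) by (simp add: first_order_operator_def)
  have "regular_distribution \<Omega> (\<lambda>x. (- 1) *\<^sub>R u x) \<phi> = - regular_distribution \<Omega> u \<phi>" for \<phi>
    by (simp add: regular_distribution_def set_lebesgue_integral_def)
  then have "apply_op A (regular_distribution \<Omega> (\<lambda>x. (- 1) *\<^sub>R u x)) \<phi> = - apply_op A (regular_distribution \<Omega> u) \<phi>" for \<phi>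
    by (simp add: apply_op_def linear_neg[OF lin] sum_negf)
  then have "op_measure \<Omega> A (\<lambda>x. (- 1) *\<^sub>R u x) (\<lambda>E. - \<mu> E)"
    using \<mu> by (auto simp: op_measure_def finite_vector_measure_def variation_uminus vector_integral_uminus intro: sums_minus)
  then show ?thesis
    using set_integrable_scaleR_right[OF u, of "- 1"] u by (auto simp: BV_def)
qed

lemma kernel_apply_op_zero:
  fixes A :: "'n::finite \<Rightarrow> 'v::euclidean_space \<Rightarrow> 'w::euclidean_space"
  assumes "\<rho> \<in> ker_op A" "\<phi> \<in> test_functions \<Omega>"
  shows "(\<Sum>i\<in>UNIV. A i (regular_distribution \<Omega> \<rho> (partial i \<phi>))) = 0"
proof -
  have "regular_distribution \<Omega> \<rho> (partial i \<phi>) = (LINT x|lborel. partial i \<phi> x *\<^sub>R \<rho> x)" for i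
  proof -
    obtain K where "K \<subseteq> \<Omega>" "\<And>x. x \<notin> K \<Longrightarrow> partial i \<phi> x = 0"
      using test_functionsE[OF test_functions_partial[OF assms(2)]] by metis
    then show ?thesis
      unfolding regular_distribution_def set_lebesgue_integral_def
      by (intro Bochner_Integration.integral_cong) (auto simp: indicator_def)
  qed
  moreover have "\<phi> \<in> test_functions UNIV"
    using assms(2) test_functions_mono[OF subset_UNIV] by blast
  ultimately show ?thesis
    using assms(1) by (simp add: ker_op_iff)
qed

text \<open>Stated as equality of predicates: then the measures chosen by \<open>SOME\<close> are
  literally the same, and both membership in BV and the total variation carry over from
  \<open>u\<close> to \<open>u - \<rho>\<close>.\<close>

lemma op_measure_diff_kernel:
  fixes A :: "'n::finite \<Rightarrow> 'v::euclidean_space \<Rightarrow> 'w::euclidean_space"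
  assumes A: "first_order_operator A" and "open \<Omega>" "bounded \<Omega>"
    and u: "set_integrable lborel \<Omega> u" and \<rho>: "\<rho> \<in> ker_op A"
  shows "op_measure \<Omega> A (\<lambda>x. u x - \<rho> x) = op_measure \<Omega> A u"
proof -
  have lin: "linear (A i)" for i
    using A by (simp add: first_order_operator_def)
  have "apply_op A (regular_distribution \<Omega> (\<lambda>x. u x - \<rho> x)) \<phi> = apply_op A (regular_distribution \<Omega> u) \<phi>"
    if \<phi>: "\<phi> \<in> test_functions \<Omega>" for \<phi>
  proof -
    have int: "set_integrable lborel \<Omega> (\<lambda>x. \<psi> x *\<^sub>R w x)"
      if w: "set_integrable lborel \<Omega> w" and \<psi>: "\<psi> \<in> test_functions \<Omega>" for w :: "real ^ 'n \<Rightarrow> 'v" and \<psi>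
    proof -
      obtain M where M: "\<And>x. \<bar>\<psi> x\<bar> \<le> M"
        using test_functions_bounded[OF \<psi>] by metis
      have "\<psi> \<in> borel_measurable borel"
        by (rule test_functions_measurable[OF \<psi>])
      moreover have "integrable lborel (\<lambda>x. M *\<^sub>R (indicator \<Omega> x *\<^sub>R w x))"
        using w by (simp add: set_integrable_def del: scaleR_scaleR)
      moreover have "(\<lambda>x. indicator \<Omega> x *\<^sub>R w x) \<in> borel_measurable borel"
        using borel_measurable_integrable[OF w[unfolded set_integrable_def]] by simp
      ultimately have "integrable lborel (\<lambda>x. \<psi> x *\<^sub>R (indicator \<Omega> x *\<^sub>R w x))"
        using M by (elim Bochner_Integration.integrable_bound)
          (auto intro!: AE_I2 mult_right_mono order_trans[OF M abs_ge_self] simp del: scaleR_scaleR)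
      then show ?thesis
        by (simp add: set_integrable_def mult.commute)
    qed
    have \<rho>i: "set_integrable lborel \<Omega> \<rho>"
      using locally_integrable_set_integrable[OF ker_op_locally_integrable[OF \<rho>]] assms by simp
    have "regular_distribution \<Omega> (\<lambda>x. u x - \<rho> x) (partial i \<phi>) =
        regular_distribution \<Omega> u (partial i \<phi>) - regular_distribution \<Omega> \<rho> (partial i \<phi>)" for i
      unfolding regular_distribution_def scaleR_diff_right
      by (intro set_integral_diff int u \<rho>i test_functions_partial \<phi>)
    then show ?thesis
      using kernel_apply_op_zero[OF \<rho> \<phi>] by (simp add: apply_op_def linear_diff[OF lin] sum_subtractf)
  qed
  then show ?thesis
    by (auto simp: op_measure_def fun_eq_iff)
qed

lemma ker_restrict_apply_op:
  assumes "u \<in> ker_restrict \<Omega> A" "\<phi> \<in> test_functions \<Omega>"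
  shows "apply_op A (regular_distribution \<Omega> u) \<phi> = 0"
proof -
  obtain \<rho> where \<rho>: "\<rho> \<in> ker_op A" "\<forall>x\<in>\<Omega>. u x = \<rho> x"
    using assms(1) by (auto simp: ker_restrict_def)
  have "regular_distribution \<Omega> u = regular_distribution \<Omega> \<rho>"
    unfolding regular_distribution_def set_lebesgue_integral_def
    by (intro ext Bochner_Integration.integral_cong) (auto simp: indicator_def \<rho>(2))
  then show ?thesis
    using kernel_apply_op_zero[OF \<rho>(1) assms(2)] by (simp add: apply_op_def)
qed

lemma ker_restrict_set_integrable:
  assumes "open \<Omega>" "bounded \<Omega>" "u \<in> ker_restrict \<Omega> A"
  shows "set_integrable lborel \<Omega> u"
proof -
  obtain \<rho> where \<rho>: "\<rho> \<in> ker_op A" "\<forall>x\<in>\<Omega>. u x = \<rho> x"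
    using assms(3) by (auto simp: ker_restrict_def)
  have "set_integrable lborel \<Omega> \<rho>"
    using locally_integrable_set_integrable[OF ker_op_locally_integrable[OF \<rho>(1)]] assms by simp
  moreover have "(\<lambda>x. indicator \<Omega> x *\<^sub>R u x) = (\<lambda>x. indicator \<Omega> x *\<^sub>R \<rho> x)"
    using \<rho>(2) by (auto simp: indicator_def fun_eq_iff)
  ultimately show ?thesis
    by (simp add: set_integrable_def)
qed

lemma ker_restrict_BV:
  assumes "open \<Omega>" "bounded \<Omega>"
  shows "ker_restrict \<Omega> A \<subseteq> BV \<Omega> A"
  using ker_restrict_set_integrable[OF assms] op_measure_zero ker_restrict_apply_op
  unfolding BV_def by blast

lemma ker_op_subset_ker_restrict: "ker_op A \<subseteq> ker_restrict \<Omega> A"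
  by (auto simp: ker_restrict_def)

text \<open>The zero measure represents the derivative, but \<open>SOME\<close> need not pick it;
  the uniqueness result shows that any choice has zero variation.\<close>

lemma total_variation_ker_restrict:
  assumes "open \<Omega>" "u \<in> ker_restrict \<Omega> A"
  shows "total_variation \<Omega> A u = 0"
proof -
  define \<mu> where "\<mu> = (SOME \<mu>. op_measure \<Omega> A u \<mu>)"
  have "op_measure \<Omega> A u \<mu>"
    unfolding \<mu>_def by (rule someI[where P="op_measure \<Omega> A u" and x="\<lambda>_. 0"])
       (rule op_measure_zero, rule ker_restrict_apply_op[OF assms(2)])
  then show ?thesis
    unfolding total_variation_def \<mu>_def[symmetric]
    by (intro variation_zero_of_integrals[OF assms(1)])
       (simp_all add: op_measure_def ker_restrict_apply_op[OF assms(2)])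
qed

section \<open>Affine invariance and mollification\<close>

lemma test_functions_smooth: "\<phi> \<in> test_functions \<Omega> \<Longrightarrow> smooth \<phi>"
  by (auto simp: test_functions_def test_functions_on_def)

section \<open>Change of variables under translations and dilations\<close>

lemma lborel_integral_affine:
  fixes f :: "real ^ 'n::finite \<Rightarrow> 'b::{banach, second_countable_topology}"
  assumes "c \<noteq> 0" and [measurable]: "f \<in> borel_measurable borel"
  shows "(LINT x|lborel. f x) = \<bar>c\<bar> ^ CARD('n) *\<^sub>R (LINT x|lborel. f (a + c *\<^sub>R x))"
proof -
  have "(LINT x|lborel. f x) = (LINT x|density (distr lborel borel (\<lambda>x. a + c *\<^sub>R x)) (\<lambda>_. \<bar>c\<bar> ^ CARD('n)). f x)"
    using lborel_affine[OF assms(1), of a] by simp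
  also have "\<dots> = \<bar>c\<bar> ^ CARD('n) *\<^sub>R (LINT x|lborel. f (a + c *\<^sub>R x))"
    by (subst integral_density) (auto simp: integral_distr)
  finally show ?thesis .
qed

lemma lborel_integrable_affine:
  fixes f :: "real ^ 'n::finite \<Rightarrow> 'b::{banach, second_countable_topology}"
  assumes "c \<noteq> 0" "integrable lborel f"
  shows "integrable lborel (\<lambda>x. f (a + c *\<^sub>R x))"
proof -
  have [measurable]: "f \<in> borel_measurable borel"
    using assms(2) by (auto dest: borel_measurable_integrable)
  have "integrable (density (distr lborel borel (\<lambda>x. a + c *\<^sub>R x)) (\<lambda>_. \<bar>c\<bar> ^ CARD('n))) f"
    using lborel_affine[OF assms(1), of a] assms(2) by simp
  then have "integrable lborel (\<lambda>x. \<bar>c\<bar> ^ CARD('n) *\<^sub>R f (a + c *\<^sub>R x))"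
    by (simp add: integrable_density integrable_distr_eq)
  then have "integrable lborel (\<lambda>x. inverse (\<bar>c\<bar> ^ CARD('n)) *\<^sub>R (\<bar>c\<bar> ^ CARD('n) *\<^sub>R f (a + c *\<^sub>R x)))"
    by (rule integrable_scaleR_right)
  then show ?thesis
    using assms(1) by simp
qed

lemma nn_integral_lborel_translate:
  fixes f :: "'a::euclidean_space \<Rightarrow> ennreal"
  assumes [measurable]: "f \<in> borel_measurable borel"
  shows "(\<integral>\<^sup>+x. f (c + x) \<partial>lborel) = (\<integral>\<^sup>+x. f x \<partial>lborel)"
  by (subst (2) lborel_distr_plus[of c, symmetric]) (simp add: nn_integral_distr)

lemma locally_integrable_affine:
  fixes v :: "real ^ 'n::finite \<Rightarrow> 'v::euclidean_space"
  assumes "locally_integrable v" "t \<noteq> 0"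
  shows "locally_integrable (\<lambda>y. v (a + t *\<^sub>R y))"
  unfolding locally_integrable_def
proof (intro allI impI)
  fix K :: "(real ^ 'n) set" assume "compact K"
  then have "compact ((\<lambda>y. a + t *\<^sub>R y) ` K)"
    by (intro compact_continuous_image continuous_intros)
  then have "integrable lborel (\<lambda>x. indicator ((\<lambda>y. a + t *\<^sub>R y) ` K) x *\<^sub>R v x)"
    using assms(1) by (simp add: locally_integrable_def set_integrable_def)
  from lborel_integrable_affine[OF assms(2) this, of a]
  have "integrable lborel (\<lambda>x. indicator ((\<lambda>y. a + t *\<^sub>R y) ` K) (a + t *\<^sub>R x) *\<^sub>R v (a + t *\<^sub>R x))" .
  moreover have "indicator ((\<lambda>y. a + t *\<^sub>R y) ` K) (a + t *\<^sub>R x) = (indicator K x :: real)" for x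
    using assms(2) by (auto simp: indicator_def image_iff)
  ultimately show "set_integrable lborel K (\<lambda>y. v (a + t *\<^sub>R y))"
    by (simp add: set_integrable_def)
qed

text \<open>Moving the affine map from \<open>v\<close> to the test function multiplies every
  partial derivative by the same nonzero factor, because the operator has constant coefficients and
  is homogeneous of order one.\<close>

lemma ker_op_affine:
  fixes A :: "'n::finite \<Rightarrow> 'v::euclidean_space \<Rightarrow> 'w::euclidean_space"
  assumes A: "first_order_operator A" and v: "v \<in> ker_op A" and t: "t \<noteq> 0"
  shows "(\<lambda>y. v (a + t *\<^sub>R y)) \<in> ker_op A"
  unfolding ker_op_iff
proof (intro conjI ballI)
  note vl = ker_op_locally_integrable[OF v]
  note [measurable] = locally_integrable_borel_measurable[OF vl]
  show "locally_integrable (\<lambda>y. v (a + t *\<^sub>R y))"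
    by (rule locally_integrable_affine[OF vl t])
  fix \<phi> :: "real ^ 'n \<Rightarrow> real" assume \<phi>: "\<phi> \<in> test_functions UNIV"
  have lin: "linear (A i)" for i
    using A by (simp add: first_order_operator_def)
  let ?b = "- (inverse t *\<^sub>R a)"
  define \<psi> where "\<psi> = (\<lambda>x. \<phi> (?b + inverse t *\<^sub>R x))"
  have \<psi>: "\<psi> \<in> test_functions UNIV"
    unfolding \<psi>_def using \<phi> t by (intro test_functions_affine) auto
  have p\<psi>: "partial i \<psi> x = inverse t * partial i \<phi> (?b + inverse t *\<^sub>R x)" for i x
    using partial_affine(1)[OF test_functions_smooth[OF \<phi>], of i 1 ?b "inverse t"] unfolding \<psi>_def by simp
  have "(LINT x|lborel. partial i \<psi> x *\<^sub>R v x) =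
      (\<bar>t\<bar> ^ CARD('n) * inverse t) *\<^sub>R (LINT y|lborel. partial i \<phi> y *\<^sub>R v (a + t *\<^sub>R y))" for i
  proof -
    have [measurable]: "partial i \<psi> \<in> borel_measurable borel"
      by (intro test_functions_measurable[OF test_functions_partial[OF \<psi>]])
    have "(LINT x|lborel. partial i \<psi> x *\<^sub>R v x) =
        \<bar>t\<bar> ^ CARD('n) *\<^sub>R (LINT y|lborel. partial i \<psi> (a + t *\<^sub>R y) *\<^sub>R v (a + t *\<^sub>R y))"
      by (rule lborel_integral_affine[OF t]) measurable
    also have "(\<lambda>y. partial i \<psi> (a + t *\<^sub>R y) *\<^sub>R v (a + t *\<^sub>R y)) =
        (\<lambda>y. inverse t *\<^sub>R (partial i \<phi> y *\<^sub>R v (a + t *\<^sub>R y)))"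
      using t by (simp add: p\<psi> scaleR_add_right)
    also have "(LINT y|lborel. inverse t *\<^sub>R (partial i \<phi> y *\<^sub>R v (a + t *\<^sub>R y))) =
        inverse t *\<^sub>R (LINT y|lborel. partial i \<phi> y *\<^sub>R v (a + t *\<^sub>R y))"
      by (rule integral_scaleR_right)
    finally show ?thesis
      by (simp only: scaleR_scaleR)
  qed
  then have "(\<Sum>i\<in>UNIV. A i (LINT x|lborel. partial i \<psi> x *\<^sub>R v x)) = (\<bar>t\<bar> ^ CARD('n) * inverse t) *\<^sub>R
      (\<Sum>i\<in>UNIV. A i (LINT y|lborel. partial i \<phi> y *\<^sub>R v (a + t *\<^sub>R y)))"
    by (simp add: linear_cmul[OF lin] scaleR_sum_right)
  moreover have "(\<Sum>i\<in>UNIV. A i (LINT x|lborel. partial i \<psi> x *\<^sub>R v x)) = 0"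
    using v \<psi> by (simp add: ker_op_iff)
  ultimately show "(\<Sum>i\<in>UNIV. A i (LINT y|lborel. partial i \<phi> y *\<^sub>R v (a + t *\<^sub>R y))) = 0"
    using t by simp
qed

text \<open>The integrand is bounded by a multiple of
  \<open>norm (v (x + t *\<^sub>R y + z))\<close> for \<open>y\<close> and \<open>z\<close> in
  balls. Integrating the bound in \<open>z\<close> first uses only translation invariance, so no
  condition on \<open>t\<close> arises.\<close>

lemma Fubini_test_functions:
  fixes v :: "real ^ 'n::finite \<Rightarrow> 'v::euclidean_space"
  assumes v: "locally_integrable v" and \<alpha>: "\<alpha> \<in> test_functions UNIV" and \<beta>: "\<beta> \<in> test_functions UNIV"
  shows "(LINT y|lborel. \<alpha> y *\<^sub>R (LINT z|lborel. \<beta> z *\<^sub>R v (x + t *\<^sub>R y + z))) =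
         (LINT z|lborel. \<beta> z *\<^sub>R (LINT y|lborel. \<alpha> y *\<^sub>R v (x + t *\<^sub>R y + z)))" (is ?eq)
    and "integrable lborel (\<lambda>z. \<beta> z *\<^sub>R (LINT y|lborel. \<alpha> y *\<^sub>R v (x + t *\<^sub>R y + z)))" (is ?int)
proof -
  note [measurable] = locally_integrable_borel_measurable[OF v]
    test_functions_measurable[OF \<alpha>] test_functions_measurable[OF \<beta>]
  obtain Ma where Ma: "Ma > 0" "\<And>x. \<bar>\<alpha> x\<bar> \<le> Ma"
    using test_functions_bounded[OF \<alpha>] by metis
  obtain Mb where Mb: "Mb > 0" "\<And>x. \<bar>\<beta> x\<bar> \<le> Mb"
    using test_functions_bounded[OF \<beta>] by metis
  obtain Ra where Ra: "Ra > 0" "\<And>x. norm x > Ra \<Longrightarrow> \<alpha> x = 0"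
    using test_functions_support_ball[OF \<alpha>] by metis
  obtain Rb where Rb: "Rb > 0" "\<And>x. norm x > Rb \<Longrightarrow> \<beta> x = 0"
    using test_functions_support_ball[OF \<beta>] by metis
  \<comment> \<open>A radius reached by no point \<open>x + t *\<^sub>R y + z\<close> from outside:
    it bounds all of them when \<open>y\<close> and \<open>z\<close> lie in the two supporting
    balls.\<close>
  define R where "R = norm x + \<bar>t\<bar> * Ra + Rb"
  define f where "f = (\<lambda>y z. \<alpha> y *\<^sub>R (\<beta> z *\<^sub>R v (x + t *\<^sub>R y + z)))"
  define g where "g = (\<lambda>w. ennreal (indicator (cball 0 R) w * norm (v w)))"
  have [measurable]: "cball (0 :: real ^ 'n) R \<in> sets borel"
    by simp
  have [measurable]: "g \<in> borel_measurable borel"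
    unfolding g_def by measurable
  have fm: "(\<lambda>(y, z). f y z) \<in> borel_measurable (lborel \<Otimes>\<^sub>M lborel)"
    unfolding f_def by measurable
  have gfin: "(\<integral>\<^sup>+w. g w \<partial>lborel) < \<infinity>"
  proof -
    have "integrable lborel (\<lambda>w. indicator (cball 0 R) w *\<^sub>R v w)"
      using v compact_cball unfolding locally_integrable_def set_integrable_def by blast
    then show ?thesis
      by (auto simp: g_def integrable_iff_bounded)
  qed
  have bound: "ennreal (norm (f y z)) \<le> ennreal (Ma * Mb) * indicator (cball 0 Ra) y * g (x + t *\<^sub>R y + z)" for y z
  proof (cases "norm y \<le> Ra \<and> norm z \<le> Rb")
    case True
    have "norm (x + t *\<^sub>R y + z) \<le> norm x + \<bar>t\<bar> * norm y + norm z"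
      by (metis add_mono norm_scaleR norm_triangle_ineq norm_triangle_le order_refl)
    also have "\<dots> \<le> R"
      unfolding R_def using True by (intro add_mono mult_left_mono) auto
    finally have "x + t *\<^sub>R y + z \<in> cball 0 R"
      by simp
    moreover have "\<bar>\<alpha> y\<bar> * (\<bar>\<beta> z\<bar> * norm (v (x + t *\<^sub>R y + z))) \<le> Ma * (Mb * norm (v (x + t *\<^sub>R y + z)))"
      using Ma Mb by (intro mult_mono mult_right_mono) auto
    ultimately show ?thesis
      using True Ma(1) Mb(1) by (simp add: f_def g_def ennreal_mult[symmetric] abs_mult mult.assoc ennreal_leI)
  next
    case False
    then have "f y z = 0"
      using Ra(2)[of y] Rb(2)[of z] by (auto simp: f_def)
    then show ?thesis by simp
  qed
  have "(\<integral>\<^sup>+p. ennreal (norm (case p of (y, z) \<Rightarrow> f y z)) \<partial>(lborel \<Otimes>\<^sub>M lborel)) =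
      (\<integral>\<^sup>+y. \<integral>\<^sup>+z. ennreal (norm (f y z)) \<partial>lborel \<partial>lborel)"
    using fm by (subst lborel.nn_integral_fst[symmetric]) auto
  also have "\<dots> \<le> (\<integral>\<^sup>+y. \<integral>\<^sup>+z. ennreal (Ma * Mb) * indicator (cball 0 Ra) y * g (x + t *\<^sub>R y + z) \<partial>lborel \<partial>lborel)"
    by (intro nn_integral_mono bound)
  also have "\<dots> = (\<integral>\<^sup>+y. ennreal (Ma * Mb) * indicator (cball (0 :: real ^ 'n) Ra) y * (\<integral>\<^sup>+w. g w \<partial>lborel) \<partial>lborel)"
    by (simp add: nn_integral_cmult nn_integral_lborel_translate[of g])
  also have "\<dots> = ennreal (Ma * Mb) * (\<integral>\<^sup>+w. g w \<partial>lborel) * emeasure lborel (cball (0 :: real ^ 'n) Ra)"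
    by (subst nn_integral_cmult_indicator[symmetric]) (simp_all add: mult_ac)
  also have "\<dots> < \<infinity>"
    using gfin emeasure_lborel_cball_finite[of "0 :: real ^ 'n" Ra]
    by (simp add: ennreal_mult_less_top less_top[symmetric] ennreal_mult_eq_top_iff)
  finally have int: "integrable (lborel \<Otimes>\<^sub>M lborel) (\<lambda>(y, z). f y z)"
    using fm by (intro integrableI_bounded)
  have swap: "f y z = \<beta> z *\<^sub>R (\<alpha> y *\<^sub>R v (x + t *\<^sub>R y + z))" for y z
    by (simp add: f_def mult.commute)
  show ?eq
    using lborel_pair.Fubini_integral[OF int]
    by (subst (asm) (1) swap) (simp add: f_def del: scaleR_scaleR)
  show ?int
    using lborel_pair.integrable_snd[OF int] unfolding swap by (simp del: scaleR_scaleR)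
qed

text \<open>A correlation rather than a convolution: the value at 0 is the pairing of
  \<open>v\<close> with \<phi>, and differentiation in \<open>x\<close> falls on \<phi> with a minus
  sign.\<close>

definition moll :: "(real ^ 'n::finite \<Rightarrow> 'v::euclidean_space) \<Rightarrow> (real ^ 'n \<Rightarrow> real) \<Rightarrow> real ^ 'n \<Rightarrow> 'v" where
  "moll v \<phi> x = (LINT z|lborel. \<phi> (z - x) *\<^sub>R v z)"

lemma moll_alt:
  assumes "locally_integrable v" "\<phi> \<in> test_functions UNIV"
  shows "moll v \<phi> x = (LINT z|lborel. \<phi> z *\<^sub>R v (x + z))"
proof -
  note [measurable] = locally_integrable_borel_measurable[OF assms(1)] test_functions_measurable[OF assms(2)]
  show ?thesis
    unfolding moll_def by (subst lborel_integral_affine[where c=1 and a=x]) auto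
qed

section \<open>Taylor estimates for test functions and differentiability of mollifications\<close>

lemma test_functions_translate: "\<phi> \<in> test_functions UNIV \<Longrightarrow> (\<lambda>z. \<phi> (z - x)) \<in> test_functions UNIV"
  using test_functions_affine[of \<phi> 1 "- x"] by simp

lemma test_functions_sum_bound:
  fixes \<phi> :: "'n::finite \<Rightarrow> real ^ 'n \<Rightarrow> real"
  assumes "\<And>i x. \<bar>\<phi> i x\<bar> \<le> M"
  shows "\<bar>\<Sum>i\<in>UNIV. h $ i * \<phi> i x\<bar> \<le> real CARD('n) * M * norm h"
proof -
  have "\<bar>\<Sum>i\<in>UNIV. h $ i * \<phi> i x\<bar> \<le> (\<Sum>i\<in>(UNIV :: 'n set). norm h * M)"
    by (rule order_trans[OF sum_abs], rule sum_mono)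
       (use assms in \<open>auto simp: abs_mult intro!: mult_mono component_le_norm_cart\<close>)
  then show ?thesis
    by (simp add: mult_ac)
qed

lemma test_functions_Lipschitz:
  fixes \<phi> :: "real ^ 'n::finite \<Rightarrow> real"
  assumes \<phi>: "\<phi> \<in> test_functions UNIV"
  obtains L where "L \<ge> 0" "\<And>x y. \<bar>\<phi> x - \<phi> y\<bar> \<le> L * norm (x - y)"
proof -
  have "\<exists>M>0. \<forall>x. \<bar>partial i \<phi> x\<bar> \<le> M" for i
    by (rule test_functions_bounded[OF test_functions_partial[OF \<phi>, of i]]) blast
  then obtain M where M: "\<And>i. M i > 0" "\<And>i x. \<bar>partial i \<phi> x\<bar> \<le> M i"
    by metis
  let ?M = "\<Sum>i\<in>UNIV. M i"
  have MM: "\<bar>partial i \<phi> x\<bar> \<le> ?M" for i x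
    by (rule order_trans[OF M(2)], rule member_le_sum) (use M(1) in \<open>auto intro: less_imp_le\<close>)
  have "0 \<le> ?M"
    by (intro sum_nonneg less_imp_le M)
  show ?thesis
  proof (rule that[of "real CARD('n) * ?M"])
    show "\<bar>\<phi> x - \<phi> y\<bar> \<le> real CARD('n) * ?M * norm (x - y)" for x y
    proof -
      have "norm (\<phi> x - \<phi> y) \<le> real CARD('n) * ?M * norm (x - y)"
      proof (rule differentiable_bound[where S=UNIV])
        show "(\<phi> has_derivative (\<lambda>h. \<Sum>i\<in>UNIV. h $ i * partial i \<phi> x)) (at x within UNIV)" for x
          by (rule smooth_has_derivative[OF test_functions_smooth[OF \<phi>]])
        show "onorm (\<lambda>h. \<Sum>i\<in>UNIV. h $ i * partial i \<phi> x) \<le> real CARD('n) * ?M" for x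
          using test_functions_sum_bound[of "\<lambda>i. partial i \<phi>", OF MM] by (intro onorm_le) simp
      qed auto
      then show ?thesis by simp
    qed
  qed (use \<open>0 \<le> ?M\<close> in simp)
qed

lemma test_functions_Taylor1:
  fixes \<phi> :: "real ^ 'n::finite \<Rightarrow> real"
  assumes \<phi>: "\<phi> \<in> test_functions UNIV"
  obtains L where "\<And>x h. \<bar>\<phi> (x + h) - \<phi> x - (\<Sum>i\<in>UNIV. h $ i * partial i \<phi> x)\<bar> \<le> L * (norm h)\<^sup>2"
proof -
  have "\<exists>L\<ge>0. \<forall>x y. \<bar>partial i \<phi> x - partial i \<phi> y\<bar> \<le> L * norm (x - y)" for i
    by (rule test_functions_Lipschitz[OF test_functions_partial[OF \<phi>, of i]]) blast
  then obtain L where L: "\<And>i. L i \<ge> 0" "\<And>i x y. \<bar>partial i \<phi> x - partial i \<phi> y\<bar> \<le> L i * norm (x - y)"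
    by metis
  let ?L = "\<Sum>i\<in>UNIV. L i"
  have LL: "\<bar>partial i \<phi> x - partial i \<phi> y\<bar> \<le> ?L * norm (x - y)" for i x y
    by (rule order_trans[OF L(2)], intro mult_right_mono member_le_sum) (use L(1) in auto)
  show ?thesis
  proof (rule that[of "real CARD('n) * ?L"])
    fix x h :: "real ^ 'n"
    have "norm (\<phi> (x + h) - \<phi> x - (\<Sum>i\<in>UNIV. (x + h - x) $ i * partial i \<phi> x)) \<le>
        norm (x + h - x) * (real CARD('n) * (?L * norm h))"
    proof (rule differentiable_bound_linearization[where S="cball x (norm h)"])
      show "x + t *\<^sub>R (x + h - x) \<in> cball x (norm h)" if "t \<in> {0..1}" for t
        using that by (simp add: dist_norm mult_left_le_one_le)
      show "(\<phi> has_derivative (\<lambda>h. \<Sum>i\<in>UNIV. h $ i * partial i \<phi> y)) (at y within cball x (norm h))" for y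
        by (rule has_derivative_at_withinI[OF smooth_has_derivative[OF test_functions_smooth[OF \<phi>]]])
      show "onorm ((\<lambda>h. \<Sum>i\<in>UNIV. h $ i * partial i \<phi> y) - (\<lambda>h. \<Sum>i\<in>UNIV. h $ i * partial i \<phi> x))
          \<le> real CARD('n) * (?L * norm h)" if "y \<in> cball x (norm h)" for y
      proof (rule onorm_le)
        fix k :: "real ^ 'n"
        have "\<bar>partial i \<phi> y - partial i \<phi> x\<bar> \<le> ?L * norm h" for i
          by (rule order_trans[OF LL], intro mult_left_mono sum_nonneg L)
             (use that in \<open>auto simp: dist_norm norm_minus_commute\<close>)
        then have "\<bar>\<Sum>i\<in>UNIV. k $ i * (\<lambda>_. partial i \<phi> y - partial i \<phi> x) x\<bar> \<le> real CARD('n) * (?L * norm h) * norm k"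
          by (intro test_functions_sum_bound)
        then show "norm (((\<lambda>h. \<Sum>i\<in>UNIV. h $ i * partial i \<phi> y) - (\<lambda>h. \<Sum>i\<in>UNIV. h $ i * partial i \<phi> x)) k)
            \<le> real CARD('n) * (?L * norm h) * norm k"
          by (simp add: sum_subtractf[symmetric] right_diff_distrib)
      qed
    qed simp
    then show "\<bar>\<phi> (x + h) - \<phi> x - (\<Sum>i\<in>UNIV. h $ i * partial i \<phi> x)\<bar> \<le> real CARD('n) * ?L * (norm h)\<^sup>2"
      by (simp add: power2_eq_square mult_ac)
  qed
qed


text \<open>The first order Taylor remainder of \<phi> is quadratic in \<open>h\<close>, uniformly,
  and for \<open>norm h \<le> 1\<close> it is supported in one fixed ball; pairing it with the
  locally integrable \<open>v\<close> keeps the quadratic bound.\<close>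

lemma moll_has_derivative:
  fixes v :: "real ^ 'n::finite \<Rightarrow> 'v::euclidean_space"
  assumes v: "locally_integrable v" and \<phi>: "\<phi> \<in> test_functions UNIV"
  shows "(moll v \<phi> has_derivative (\<lambda>h. \<Sum>i\<in>UNIV. (- h $ i) *\<^sub>R moll v (partial i \<phi>) x)) (at x)"
proof -
  let ?D = "\<lambda>h. \<Sum>i\<in>UNIV. (- h $ i) *\<^sub>R moll v (partial i \<phi>) x"
  obtain L where L: "\<And>x h. \<bar>\<phi> (x + h) - \<phi> x - (\<Sum>i\<in>UNIV. h $ i * partial i \<phi> x)\<bar> \<le> L * (norm h)\<^sup>2"
    by (rule test_functions_Taylor1[OF \<phi>]) blast
  obtain R where R: "R > 0" "\<And>x. norm x > R \<Longrightarrow> \<phi> x = 0"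
    by (rule test_functions_support_ball[OF \<phi>]) blast
  have R': "partial i \<phi> x = 0" if "norm x > R" for i x
    by (rule partial_outside[of "cball 0 R"]) (use R(2) that in auto)
  \<comment> \<open>Radius \<open>R + 1\<close> accommodates every translate of the support by a
    vector \<open>h\<close> with \<open>norm h \<le> 1\<close>.\<close>
  define I where "I = (LINT z:cball x (R + 1)|lborel. norm (v z))"
  have bound: "norm (moll v \<phi> (x + h) - moll v \<phi> x - ?D h) \<le> L * I * (norm h)\<^sup>2" if h: "norm h \<le> 1" for h
  proof -
    define \<psi> where "\<psi> = (\<lambda>z. \<phi> (z - (x + h)) - \<phi> (z - x) - (\<Sum>i\<in>UNIV. (- h) $ i * partial i \<phi> (z - x)))"
    have int: "integrable lborel (\<lambda>z. \<eta> (z - y) *\<^sub>R v z)" if "\<eta> \<in> test_functions UNIV" for \<eta> y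
      by (rule locally_integrable_test_integrable[OF v test_functions_translate[OF that]])
    note pt = test_functions_partial[OF \<phi>]
    have intp: "integrable lborel (\<lambda>z. (- h $ i) *\<^sub>R (partial i \<phi> (z - x) *\<^sub>R v z))" for i
      by (rule integrable_scaleR_right[OF int[OF pt]])
    have "moll v \<phi> (x + h) - moll v \<phi> x - ?D h = (LINT z|lborel. \<phi> (z - (x + h)) *\<^sub>R v z - \<phi> (z - x) *\<^sub>R v z
        - (\<Sum>i\<in>UNIV. (- h $ i) *\<^sub>R (partial i \<phi> (z - x) *\<^sub>R v z)))"
      unfolding moll_def
      by (subst Bochner_Integration.integral_diff, intro Bochner_Integration.integrable_diff int \<phi>,
          intro Bochner_Integration.integrable_sum intp,
          subst Bochner_Integration.integral_diff, intro int \<phi>, intro int \<phi>,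
          subst Bochner_Integration.integral_sum, intro intp, simp only: integral_scaleR_right)
    also have "\<dots> = (LINT z|lborel. \<psi> z *\<^sub>R v z)"
      by (simp add: \<psi>_def scaleR_diff_left scaleR_sum_left scaleR_add_left)
    finally have eq: "moll v \<phi> (x + h) - moll v \<phi> x - ?D h = (LINT z|lborel. \<psi> z *\<^sub>R v z)" .
    show ?thesis
      unfolding eq
    proof (rule order_trans[OF locally_integrable_test_bound(2)[OF v, of \<psi> "L * (norm h)\<^sup>2" "cball x (R + 1)"]])
      have [measurable]: "\<phi> \<in> borel_measurable borel" "\<And>i. partial i \<phi> \<in> borel_measurable borel"
        by (intro test_functions_measurable[OF \<phi>] test_functions_measurable[OF pt])+
      show "\<psi> \<in> borel_measurable borel"
        unfolding \<psi>_def by measurable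
      show "\<bar>\<psi> z\<bar> \<le> L * (norm h)\<^sup>2" for z
        using L[of "z - x" "- h"] by (simp add: \<psi>_def algebra_simps)
      show "\<psi> z = 0" if "z \<notin> cball x (R + 1)" for z
      proof -
        have "norm (z - x) > R + 1"
          using that by (simp add: dist_norm norm_minus_commute)
        moreover have "norm (z - x) \<le> norm (z - (x + h)) + norm h"
          using norm_triangle_ineq[of "z - (x + h)" h] by (simp add: algebra_simps)
        ultimately show ?thesis
          using h by (simp add: \<psi>_def R(2) R')
      qed
    qed (simp_all add: I_def mult_ac)
  qed
  have "bounded_linear ?D"
    by (intro bounded_linear_sum bounded_linear_scaleR_const bounded_linear_minus bounded_linear_vec_nth)
  moreover have "(\<lambda>h. norm (moll v \<phi> (x + h) - moll v \<phi> x - ?D h) / norm h) \<midarrow>0\<rightarrow> 0"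
  proof (rule Lim_null_comparison)
    show "(\<lambda>h. \<bar>L * I\<bar> * norm h) \<midarrow>0\<rightarrow> 0"
      by (auto intro!: tendsto_eq_intros)
    have "norm (norm (moll v \<phi> (x + h) - moll v \<phi> x - ?D h) / norm h) \<le> \<bar>L * I\<bar> * norm h"
      if "norm h < 1" "h \<noteq> 0" for h
    proof -
      have "norm (moll v \<phi> (x + h) - moll v \<phi> x - ?D h) \<le> \<bar>L * I\<bar> * (norm h)\<^sup>2"
        using bound[of h] that mult_right_mono[OF abs_ge_self[of "L * I"] zero_le_power2[of "norm h"]] by linarith
      then show ?thesis
        using that by (simp add: divide_le_eq power2_eq_square mult.assoc)
    qed
    then show "\<forall>\<^sub>F h in at 0. norm (norm (moll v \<phi> (x + h) - moll v \<phi> x - ?D h) / norm h) \<le> \<bar>L * I\<bar> * norm h"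
      unfolding eventually_at dist_norm by (intro exI[of _ "1 :: real"]) simp
  qed
  ultimately show ?thesis
    by (simp add: has_derivative_at)
qed

lemma moll_continuous:
  assumes "locally_integrable v" "\<phi> \<in> test_functions UNIV"
  shows "continuous_on S (moll v \<phi>)"
  by (rule continuous_at_imp_continuous_on) (intro ballI has_derivative_continuous[OF moll_has_derivative[OF assms]])

text \<open>\<open>dmoll v y j \<phi> x\<close> is the \<open>j\<close>-th derivative at \<open>s = 0\<close> of \<open>moll v \<phi> (x + s y)\<close>.\<close>

primrec dmoll :: "(real ^ 'n::finite \<Rightarrow> 'v::euclidean_space) \<Rightarrow> real ^ 'n \<Rightarrow> nat \<Rightarrow> (real ^ 'n \<Rightarrow> real) \<Rightarrow> real ^ 'n \<Rightarrow> 'v"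
  where
  "dmoll v y 0 \<phi> x = moll v \<phi> x"
| "dmoll v y (Suc j) \<phi> x = (\<Sum>i\<in>UNIV. (- y $ i) *\<^sub>R dmoll v y j (partial i \<phi>) x)"

lemma dmoll_has_vector_derivative:
  assumes "locally_integrable v" "\<phi> \<in> test_functions UNIV"
  shows "((\<lambda>s. dmoll v y j \<phi> (x + s *\<^sub>R y)) has_vector_derivative dmoll v y (Suc j) \<phi> (x + s *\<^sub>R y)) (at s)"
  using assms(2)
proof (induction j arbitrary: \<phi>)
  case 0
  have "((\<lambda>s. moll v \<phi> (x + s *\<^sub>R y)) has_derivative
      (\<lambda>h. \<Sum>i\<in>UNIV. (- (h *\<^sub>R y) $ i) *\<^sub>R moll v (partial i \<phi>) (x + s *\<^sub>R y))) (at s)"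
    by (rule has_derivative_compose[OF _ moll_has_derivative[OF assms(1) 0]]) (auto intro!: derivative_eq_intros)
  then show ?case
    by (simp add: has_vector_derivative_def scaleR_sum_right sum_negf)
next
  case (Suc j)
  have "((\<lambda>s. \<Sum>i\<in>UNIV. (- y $ i) *\<^sub>R dmoll v y j (partial i \<phi>) (x + s *\<^sub>R y)) has_vector_derivative
      (\<Sum>i\<in>UNIV. (- y $ i) *\<^sub>R dmoll v y (Suc j) (partial i \<phi>) (x + s *\<^sub>R y))) (at s)"
    by (intro has_vector_derivative_sum
        bounded_linear.has_vector_derivative[OF bounded_linear_scaleR_right] Suc.IH test_functions_partial Suc.prems)
  then show ?case
    by simp
qed

text \<open>This homogeneity in the direction is what the dilation argument for the degree bound
  uses.\<close>

lemma dmoll_scale: "dmoll v (c *\<^sub>R y) j \<phi> x = c ^ j *\<^sub>R dmoll v y j \<phi> x"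
  by (induction j arbitrary: \<phi>) (simp_all add: scaleR_sum_right mult_ac)

lemma dmoll_continuous: "continuous_on S (\<lambda>y. dmoll v y j \<phi> x)"
  by (induction j arbitrary: \<phi>) (auto intro!: continuous_intros)

lemma dmoll_bounded:
  fixes v :: "real ^ 'n::finite \<Rightarrow> 'v::euclidean_space"
  assumes "locally_integrable v" "\<phi> \<in> test_functions UNIV"
  shows "\<exists>B\<ge>0. \<forall>x\<in>cball 0 r. \<forall>y\<in>cball 0 R. norm (dmoll v y j \<phi> x) \<le> B"
  using assms(2)
proof (induction j arbitrary: \<phi>)
  case 0
  have "bounded (moll v \<phi> ` cball 0 r)"
    by (intro compact_imp_bounded compact_continuous_image moll_continuous assms(1) 0 compact_cball)
  then obtain B where "\<forall>x\<in>cball 0 r. norm (moll v \<phi> x) \<le> B"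
    by (auto simp: bounded_iff)
  then show ?case
    by (intro exI[of _ "max 0 B"]) (auto simp: le_max_iff_disj)
next
  case (Suc j)
  have "\<forall>i. \<exists>B\<ge>0. \<forall>x\<in>cball 0 r. \<forall>y\<in>cball 0 R. norm (dmoll v y j (partial i \<phi>) x) \<le> B"
    using Suc.IH test_functions_partial[OF Suc.prems] by blast
  then obtain B where B: "\<And>i. B i \<ge> 0"
      "\<And>i x y. x \<in> cball 0 r \<Longrightarrow> y \<in> cball 0 R \<Longrightarrow> norm (dmoll v y j (partial i \<phi>) x) \<le> B i"
    by metis
  have "norm (dmoll v y (Suc j) \<phi> x) \<le> (\<Sum>i\<in>UNIV. \<bar>R\<bar> * B i)" if "x \<in> cball 0 r" "y \<in> cball 0 R" for x y
  proof -
    have "norm ((- y $ i) *\<^sub>R dmoll v y j (partial i \<phi>) x) \<le> \<bar>R\<bar> * B i" for i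
      using component_le_norm_cart[of y i] that B by (auto intro!: mult_mono)
    then show ?thesis
      unfolding dmoll.simps by (rule sum_norm_le)
  qed
  moreover have "0 \<le> (\<Sum>i\<in>UNIV. \<bar>R\<bar> * B i)"
    by (intro sum_nonneg) (simp add: B)
  ultimately show ?case
    by blast
qed

lemma moll_Taylor:
  fixes v :: "real ^ 'n::finite \<Rightarrow> 'v::euclidean_space"
  assumes "locally_integrable v" "\<phi> \<in> test_functions UNIV"
  shows "\<exists>s. \<bar>s\<bar> \<le> \<bar>t\<bar> \<and> moll v \<phi> (x + t *\<^sub>R y) \<bullet> b =
     (\<Sum>j<m. (dmoll v y j \<phi> x \<bullet> b) / fact j * t ^ j) + (dmoll v y m \<phi> (x + s *\<^sub>R y) \<bullet> b) / fact m * t ^ m"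
proof -
  have "DERIV (\<lambda>s. dmoll v y j \<phi> (x + s *\<^sub>R y) \<bullet> b) s :> dmoll v y (Suc j) \<phi> (x + s *\<^sub>R y) \<bullet> b" for j s
    using bounded_linear.has_vector_derivative[OF bounded_linear_inner_left dmoll_has_vector_derivative[OF assms]]
    by (simp add: has_real_derivative_iff_has_vector_derivative)
  then show ?thesis
    using Maclaurin_all_le[of "\<lambda>j s. dmoll v y j \<phi> (x + s *\<^sub>R y) \<bullet> b" "\<lambda>s. moll v \<phi> (x + s *\<^sub>R y) \<bullet> b" t m]
    by simp
qed

lemma moll_Taylor_remainder:
  fixes v :: "real ^ 'n::finite \<Rightarrow> 'v::euclidean_space"
  assumes "locally_integrable v" "\<phi> \<in> test_functions UNIV"
  obtains C where "C \<ge> 0" "\<And>t y. 0 \<le> t \<Longrightarrow> t \<le> 1 \<Longrightarrow> norm y \<le> R \<Longrightarrow>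
    norm (moll v \<phi> (x + t *\<^sub>R y) - (\<Sum>j<m. (t ^ j / fact j) *\<^sub>R dmoll v y j \<phi> x)) \<le> C * t ^ m"
proof -
  obtain B where B: "B \<ge> 0" "\<And>z y. norm z \<le> norm x + \<bar>R\<bar> \<Longrightarrow> norm y \<le> R \<Longrightarrow> norm (dmoll v y m \<phi> z) \<le> B"
    using dmoll_bounded[OF assms, of "norm x + \<bar>R\<bar>" R m] by auto
  show ?thesis
  proof (rule that[of "real DIM('v) * B"])
    fix t :: real and y :: "real ^ 'n" assume t: "0 \<le> t" "t \<le> 1" and y: "norm y \<le> R"
    \<comment> \<open>The intermediate point of the Lagrange remainder depends on the coordinate, so
      each coordinate is bounded separately; hence the factor \<open>DIM('v)\<close>.\<close>
    let ?r = "moll v \<phi> (x + t *\<^sub>R y) - (\<Sum>j<m. (t ^ j / fact j) *\<^sub>R dmoll v y j \<phi> x)"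
    have "\<bar>?r \<bullet> b\<bar> \<le> B * t ^ m" if b: "b \<in> Basis" for b
    proof -
      obtain s where s: "\<bar>s\<bar> \<le> \<bar>t\<bar>" "moll v \<phi> (x + t *\<^sub>R y) \<bullet> b =
         (\<Sum>j<m. (dmoll v y j \<phi> x \<bullet> b) / fact j * t ^ j) + (dmoll v y m \<phi> (x + s *\<^sub>R y) \<bullet> b) / fact m * t ^ m"
        using moll_Taylor[OF assms] by blast
      have "norm (s *\<^sub>R y) \<le> 1 * \<bar>R\<bar>"
        unfolding norm_scaleR using s(1) t y by (intro mult_mono) auto
      then have "norm (x + s *\<^sub>R y) \<le> norm x + \<bar>R\<bar>"
        using norm_triangle_ineq[of x "s *\<^sub>R y"] by linarith
      then have "\<bar>dmoll v y m \<phi> (x + s *\<^sub>R y) \<bullet> b\<bar> \<le> B"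
        using Basis_le_norm[OF b] B(2)[OF _ y] order_trans by blast
      then have "\<bar>dmoll v y m \<phi> (x + s *\<^sub>R y) \<bullet> b\<bar> / fact m \<le> B / 1"
        using B(1) by (intro frac_le) (auto simp: fact_ge_1)
      then have "\<bar>(dmoll v y m \<phi> (x + s *\<^sub>R y) \<bullet> b) / fact m * t ^ m\<bar> \<le> B * t ^ m"
        using t mult_right_mono[of "\<bar>dmoll v y m \<phi> (x + s *\<^sub>R y) \<bullet> b\<bar> / fact m" "B / 1" "t ^ m"]
        by (simp add: abs_mult)
      moreover have "?r \<bullet> b = (dmoll v y m \<phi> (x + s *\<^sub>R y) \<bullet> b) / fact m * t ^ m"
        by (simp add: inner_diff_left inner_sum_left s(2) mult_ac)
      ultimately show ?thesis
        by simp
    qed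
    then have "(\<Sum>b\<in>Basis. \<bar>?r \<bullet> b\<bar>) \<le> (\<Sum>b\<in>(Basis :: 'v set). B * t ^ m)"
      by (rule sum_mono)
    then show "norm ?r \<le> real DIM('v) * B * t ^ m"
      using norm_le_l1[of ?r] by (simp add: mult.assoc)
  qed (use B in simp)
qed


text \<open>The constant coefficient is the limit of the polynomial at 0 and so vanishes; dividing
  by \<open>t\<close> lowers both \<open>m\<close> and the indices by one.\<close>

lemma polynomial_small_imp_zero:
  fixes a :: "nat \<Rightarrow> 'w::real_normed_vector"
  assumes "\<And>t. 0 < t \<Longrightarrow> t \<le> 1 \<Longrightarrow> norm (\<Sum>j<m. t ^ j *\<^sub>R a j) \<le> C * t ^ m" and "j < m"
  shows "a j = 0"
  using assms
proof (induction m arbitrary: a j)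
  case (Suc m)
  let ?P = "\<lambda>t. \<Sum>j<Suc m. t ^ j *\<^sub>R a j"
  have "(?P \<longlongrightarrow> ?P 0) (at_right 0)"
    by (intro tendsto_intros)
  moreover have "(?P \<longlongrightarrow> 0) (at_right 0)"
  proof (rule Lim_null_comparison)
    show "\<forall>\<^sub>F t in at_right 0. norm (?P t) \<le> C * t ^ Suc m"
      using Suc.prems(1) by (intro eventually_at_rightI[of 0 1]) auto
    have "((\<lambda>t. C * t ^ Suc m) \<longlongrightarrow> C * 0 ^ Suc m) (at_right 0)"
      by (intro tendsto_intros)
    then show "((\<lambda>t. C * t ^ Suc m) \<longlongrightarrow> 0) (at_right 0)"
      by simp
  qed
  ultimately have "?P 0 = 0"
    using tendsto_unique trivial_limit_at_right_real by blast
  then have a0: "a 0 = 0"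
    by (simp add: sum.lessThan_Suc_shift del: sum.lessThan_Suc)
  have "norm (\<Sum>j<m. t ^ j *\<^sub>R a (Suc j)) \<le> C * t ^ m" if t: "0 < t" "t \<le> 1" for t
  proof -
    have "?P t = t *\<^sub>R (\<Sum>j<m. t ^ j *\<^sub>R a (Suc j))"
      by (simp add: sum.lessThan_Suc_shift a0 scaleR_sum_right del: sum.lessThan_Suc)
    then have "t * norm (\<Sum>j<m. t ^ j *\<^sub>R a (Suc j)) \<le> t * (C * t ^ m)"
      using Suc.prems(1)[OF t] t by (simp add: mult_ac del: sum.lessThan_Suc)
    then show ?thesis
      using t by simp
  qed
  from Suc.IH[OF this] a0 Suc.prems(2) show ?case
    by (cases j) auto
qed simp

text \<open>
  The Taylor coefficients along all lines through \<open>x\<close>, as functions of the direction, are again in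
  the kernel: \<open>y \<mapsto> moll v \<phi> (x + t y)\<close> is in the kernel for every \<open>t > 0\<close>, and testing its Taylor
  expansion in \<open>t\<close> makes each coefficient vanish.
\<close>

lemma dmoll_ker_op:
  fixes A :: "'n::finite \<Rightarrow> 'v::euclidean_space \<Rightarrow> 'w::euclidean_space"
  assumes A: "first_order_operator A" and v: "v \<in> ker_op A" and \<phi>: "\<phi> \<in> test_functions UNIV"
  shows "(\<lambda>y. dmoll v y j \<phi> x) \<in> ker_op A"
  unfolding ker_op_iff
proof (intro conjI ballI)
  note vl = ker_op_locally_integrable[OF v]
  have dl: "locally_integrable (\<lambda>y. dmoll v y j \<phi> x)" for j
    by (rule continuous_locally_integrable[OF dmoll_continuous])
  then show "locally_integrable (\<lambda>y. dmoll v y j \<phi> x)" .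
  fix \<psi> :: "real ^ 'n \<Rightarrow> real" assume \<psi>: "\<psi> \<in> test_functions UNIV"
  note p\<psi> = test_functions_partial[OF \<psi>]
  have bl: "bounded_linear (A i)" for i
    using A by (simp add: first_order_operator_def linear_conv_bounded_linear)
  note lin = bounded_linear.linear[OF bl]
  define F where "F = (\<lambda>w. \<Sum>i\<in>UNIV. A i (LINT y|lborel. partial i \<psi> y *\<^sub>R w y))"
  have int: "integrable lborel (\<lambda>y. partial i \<psi> y *\<^sub>R w y)" if "locally_integrable w" for i and w :: "real ^ 'n \<Rightarrow> 'b::euclidean_space"
    by (rule locally_integrable_test_integrable[OF that p\<psi>])
  \<comment> \<open>A mollification superposes the functions
    \<open>v (x + z + t *\<^sub>R y)\<close> over \<open>z\<close>, each in the kernel by affine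
    invariance; Fubini moves the weak equation inside the superposition.\<close>
  have zero: "F (\<lambda>y. moll v \<phi> (x + t *\<^sub>R y)) = 0" if t: "t \<noteq> 0" for t
  proof -
    have "F (\<lambda>y. moll v \<phi> (x + t *\<^sub>R y)) =
        (\<Sum>i\<in>UNIV. A i (LINT z|lborel. \<phi> z *\<^sub>R (LINT y|lborel. partial i \<psi> y *\<^sub>R v (x + t *\<^sub>R y + z))))"
      unfolding F_def moll_alt[OF vl \<phi>] by (subst Fubini_test_functions(1)[OF vl p\<psi> \<phi>]) (rule refl)
    also have "\<dots> = (\<Sum>i\<in>UNIV. (LINT z|lborel. A i (\<phi> z *\<^sub>R (LINT y|lborel. partial i \<psi> y *\<^sub>R v (x + t *\<^sub>R y + z)))))"
      by (intro sum.cong refl integral_bounded_linear[OF bl, symmetric] Fubini_test_functions(2)[OF vl p\<psi> \<phi>])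
    also have "\<dots> = (LINT z|lborel. (\<Sum>i\<in>UNIV. A i (\<phi> z *\<^sub>R (LINT y|lborel. partial i \<psi> y *\<^sub>R v (x + t *\<^sub>R y + z)))))"
      by (intro Bochner_Integration.integral_sum[symmetric] integrable_bounded_linear[OF bl]
          Fubini_test_functions(2)[OF vl p\<psi> \<phi>])
    also have "(\<lambda>z. \<Sum>i\<in>UNIV. A i (\<phi> z *\<^sub>R (LINT y|lborel. partial i \<psi> y *\<^sub>R v (x + t *\<^sub>R y + z)))) = (\<lambda>z. 0)"
    proof
      fix z
      have "(\<Sum>i\<in>UNIV. A i (LINT y|lborel. partial i \<psi> y *\<^sub>R v ((x + z) + t *\<^sub>R y))) = 0"
        using ker_op_affine[OF A v t, of "x + z"] \<psi> unfolding ker_op_iff by blast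
      moreover have "(x + z) + t *\<^sub>R y = x + t *\<^sub>R y + z" for y
        by simp
      ultimately have "(\<Sum>i\<in>UNIV. A i (LINT y|lborel. partial i \<psi> y *\<^sub>R v (x + t *\<^sub>R y + z))) = 0"
        by (simp only:)
      then show "(\<Sum>i\<in>UNIV. A i (\<phi> z *\<^sub>R (LINT y|lborel. partial i \<psi> y *\<^sub>R v (x + t *\<^sub>R y + z)))) = 0"
        by (simp add: linear_cmul[OF lin] scaleR_sum_right[symmetric])
    qed
    finally show ?thesis
      by simp
  qed
  obtain R where R: "R > 0" "\<And>y. norm y > R \<Longrightarrow> \<psi> y = 0"
    by (rule test_functions_support_ball[OF \<psi>]) blast
  have R': "partial i \<psi> y = 0" if "norm y > R" for i y
    by (rule partial_outside[of "cball 0 R"]) (use R(2) that in auto)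
  \<comment> \<open>The expansion stops right after the coefficient of interest, so that its index
    lies below the order of the remainder.\<close>
  define m where "m = Suc j"
  obtain C where C: "C \<ge> 0" "\<And>t y. 0 \<le> t \<Longrightarrow> t \<le> 1 \<Longrightarrow> norm y \<le> R \<Longrightarrow>
    norm (moll v \<phi> (x + t *\<^sub>R y) - (\<Sum>j<m. (t ^ j / fact j) *\<^sub>R dmoll v y j \<phi> x)) \<le> C * t ^ m"
    by (rule moll_Taylor_remainder[OF vl \<phi>, of R x m]) blast
  \<comment> \<open>Independent of \<open>t\<close>: the remainder bound \<open>C\<close> is uniform
    on the ball of radius \<open>R\<close>, outside which the derivatives of \<psi> vanish.\<close>
  define C' where "C' = (\<Sum>i\<in>UNIV. onorm (A i) * (LINT y|lborel. \<bar>partial i \<psi> y\<bar>) * C)"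
  have "norm (\<Sum>j<m. t ^ j *\<^sub>R ((1 / fact j) *\<^sub>R F (\<lambda>y. dmoll v y j \<phi> x))) \<le> C' * t ^ m" if t: "0 < t" "t \<le> 1" for t
  proof -
    define T where "T = (\<lambda>y. \<Sum>j<m. (t ^ j / fact j) *\<^sub>R dmoll v y j \<phi> x)"
    define r where "r = (\<lambda>y. moll v \<phi> (x + t *\<^sub>R y) - T y)"
    have mc: "continuous_on UNIV (\<lambda>y. moll v \<phi> (x + t *\<^sub>R y))"
      by (rule continuous_on_compose2[OF moll_continuous[OF vl \<phi>, of UNIV]]) (auto intro!: continuous_intros)
    have Tc: "continuous_on UNIV T"
      unfolding T_def by (intro continuous_intros dmoll_continuous)
    have rl: "locally_integrable r"
      unfolding r_def by (intro continuous_locally_integrable continuous_on_diff mc Tc)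
    have "F T = (\<Sum>j<m. t ^ j *\<^sub>R ((1 / fact j) *\<^sub>R F (\<lambda>y. dmoll v y j \<phi> x)))"
    proof -
      have "(LINT y|lborel. partial i \<psi> y *\<^sub>R T y) =
          (\<Sum>j<m. (t ^ j / fact j) *\<^sub>R (LINT y|lborel. partial i \<psi> y *\<^sub>R dmoll v y j \<phi> x))" for i
      proof -
        have "(LINT y|lborel. partial i \<psi> y *\<^sub>R T y) =
            (LINT y|lborel. (\<Sum>j<m. (t ^ j / fact j) *\<^sub>R (partial i \<psi> y *\<^sub>R dmoll v y j \<phi> x)))"
          unfolding T_def scaleR_sum_right by (simp add: mult.commute)
        also have "\<dots> = (\<Sum>j<m. (LINT y|lborel. (t ^ j / fact j) *\<^sub>R (partial i \<psi> y *\<^sub>R dmoll v y j \<phi> x)))"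
          by (intro Bochner_Integration.integral_sum integrable_scaleR_right int dl)
        finally show ?thesis
          by (simp only: integral_scaleR_right)
      qed
      then have "F T = (\<Sum>i\<in>UNIV. \<Sum>j<m. (t ^ j / fact j) *\<^sub>R A i (LINT y|lborel. partial i \<psi> y *\<^sub>R dmoll v y j \<phi> x))"
        unfolding F_def by (simp add: linear_sum[OF lin] linear_cmul[OF lin])
      also have "\<dots> = (\<Sum>j<m. \<Sum>i\<in>UNIV. (t ^ j / fact j) *\<^sub>R A i (LINT y|lborel. partial i \<psi> y *\<^sub>R dmoll v y j \<phi> x))"
        by (rule sum.swap)
      finally show ?thesis
        by (simp add: F_def scaleR_sum_right)
    qed
    moreover have "F (\<lambda>y. moll v \<phi> (x + t *\<^sub>R y)) = F T + F r"
    proof -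
      have "(LINT y|lborel. partial i \<psi> y *\<^sub>R moll v \<phi> (x + t *\<^sub>R y)) =
          (LINT y|lborel. partial i \<psi> y *\<^sub>R T y) + (LINT y|lborel. partial i \<psi> y *\<^sub>R r y)" for i
        using int[OF continuous_locally_integrable[OF Tc]] int[OF rl]
        by (subst Bochner_Integration.integral_add[symmetric]) (auto simp: r_def scaleR_diff_right)
      then show ?thesis
        unfolding F_def by (simp add: linear_add[OF lin] sum.distrib)
    qed
    moreover have "norm (F r) \<le> C' * t ^ m"
    proof -
      have "norm (A i (LINT y|lborel. partial i \<psi> y *\<^sub>R r y)) \<le> onorm (A i) * (LINT y|lborel. \<bar>partial i \<psi> y\<bar>) * C * t ^ m" for i
      proof -
        have ip: "integrable lborel (\<lambda>y. \<bar>partial i \<psi> y\<bar>)"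
          using integrable_norm[OF int[OF continuous_locally_integrable[OF continuous_on_const[of UNIV "1 :: real"]]]] by simp
        have "norm (LINT y|lborel. partial i \<psi> y *\<^sub>R r y) \<le> (LINT y|lborel. norm (partial i \<psi> y *\<^sub>R r y))"
          by (rule integral_norm_bound)
        also have "\<dots> \<le> (LINT y|lborel. \<bar>partial i \<psi> y\<bar> * (C * t ^ m))"
        proof (rule integral_mono[OF integrable_norm[OF int[OF rl]] integrable_mult_left[OF ip]])
          fix y
          show "norm (partial i \<psi> y *\<^sub>R r y) \<le> \<bar>partial i \<psi> y\<bar> * (C * t ^ m)"
          proof (cases "norm y \<le> R")
            case True
            then show ?thesis
              using C(2)[of t y] t by (auto simp: r_def T_def intro!: mult_left_mono)
          qed (simp add: R')
        qed
        also have "\<dots> = (LINT y|lborel. \<bar>partial i \<psi> y\<bar>) * (C * t ^ m)"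
          by simp
        finally have "onorm (A i) * norm (LINT y|lborel. partial i \<psi> y *\<^sub>R r y) \<le>
            onorm (A i) * ((LINT y|lborel. \<bar>partial i \<psi> y\<bar>) * (C * t ^ m))"
          by (rule mult_left_mono[OF _ onorm_pos_le[OF bl]])
        then show ?thesis
          using onorm[OF bl, of i "LINT y|lborel. partial i \<psi> y *\<^sub>R r y"] by (simp add: mult.assoc)
      qed
      then show ?thesis
        unfolding F_def C'_def sum_distrib_right by (rule sum_norm_le)
    qed
    ultimately show ?thesis
      using zero[of t] t by (metis add_eq_0_iff norm_minus_cancel less_irrefl)
  qed
  from polynomial_small_imp_zero[OF this, of j] have "F (\<lambda>y. dmoll v y j \<phi> x) = 0"
    by (simp add: m_def)
  then show "(\<Sum>i\<in>UNIV. A i (LINT y|lborel. partial i \<psi> y *\<^sub>R dmoll v y j \<phi> x)) = 0"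
    by (simp add: F_def)
qed

section \<open>Seminorms on finite-dimensional spaces\<close>

text \<open>Makes functions a real vector space, so that \<open>subspace\<close> and the abstract
  comparison of seminorms apply to \<open>ker_op A\<close>.\<close>

instantiation "fun" :: (type, real_vector) real_vector
begin

definition scaleR_fun_def: "c *\<^sub>R f = (\<lambda>x. c *\<^sub>R f x)"

instance
  by standard (auto simp: scaleR_fun_def plus_fun_def fun_eq_iff scaleR_add_right scaleR_add_left)

end

definition is_seminorm :: "'a::real_vector set \<Rightarrow> ('a \<Rightarrow> real) \<Rightarrow> bool" where
  "is_seminorm W N \<longleftrightarrow> (\<forall>u\<in>W. \<forall>c. N (c *\<^sub>R u) = \<bar>c\<bar> * N u) \<and> (\<forall>u\<in>W. \<forall>w\<in>W. N (u + w) \<le> N u + N w)"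

lemma is_seminormD:
  assumes "is_seminorm W N" "subspace W" "u \<in> W" "w \<in> W"
  shows "N (c *\<^sub>R u) = \<bar>c\<bar> * N u" "N (u + w) \<le> N u + N w" "0 \<le> N u" "N (u - w) \<le> N u + N w"
proof -
  have W: "(- 1) *\<^sub>R u \<in> W" "(- 1) *\<^sub>R w \<in> W"
    using assms by (auto intro: subspace_scale subspace_neg)
  have sc: "N (c *\<^sub>R x) = \<bar>c\<bar> * N x" if "x \<in> W" for c x
    using assms(1) that by (auto simp: is_seminorm_def)
  have ad: "N (x + y) \<le> N x + N y" if "x \<in> W" "y \<in> W" for x y
    using assms(1) that by (auto simp: is_seminorm_def)
  show "N (c *\<^sub>R u) = \<bar>c\<bar> * N u" "N (u + w) \<le> N u + N w"
    using sc ad assms by auto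
  have "N (u + (- 1) *\<^sub>R u) \<le> N u + N ((- 1) *\<^sub>R u)"
    by (rule ad[OF assms(3) W(1)])
  moreover have "N (u + (- 1) *\<^sub>R u) = 0"
    using sc[of u 0] assms(3) by simp
  ultimately show "0 \<le> N u"
    using sc[OF assms(3), of "- 1"] by simp
  show "N (u - w) \<le> N u + N w"
    using ad[OF assms(3) W(2)] sc[OF assms(4), of "- 1"] by simp
qed

lemma is_seminorm_subset: "is_seminorm W N \<Longrightarrow> V \<subseteq> W \<Longrightarrow> is_seminorm V N"
  unfolding is_seminorm_def by blast

text \<open>
  Induction on the number of functionals. Restricting to the kernel of one of them keeps the
  hypotheses, and completeness of that kernel makes the functional bounded for \<open>N\<close>.
\<close>

lemma seminorm_complete_and_dominates:
  fixes W :: "'a::real_vector set" and N L :: "'a \<Rightarrow> real"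
  assumes "finite E" "subspace W" "is_seminorm W N" "is_seminorm W L"
    and "\<And>e u w. e \<in> E \<Longrightarrow> u \<in> W \<Longrightarrow> w \<in> W \<Longrightarrow> e (u + w) = e u + (e w :: real)"
    and "\<And>e u c. e \<in> E \<Longrightarrow> u \<in> W \<Longrightarrow> e (c *\<^sub>R u) = c * e u"
    and "\<And>u. u \<in> W \<Longrightarrow> (\<And>e. e \<in> E \<Longrightarrow> e u = 0) \<Longrightarrow> N u = 0 \<and> L u = 0"
    and "\<And>u e. u \<in> W \<Longrightarrow> N u = 0 \<Longrightarrow> e \<in> E \<Longrightarrow> e u = 0"
  shows "(\<forall>f::nat \<Rightarrow> 'a. (\<forall>k. f k \<in> W) \<longrightarrow> (\<forall>\<epsilon>>0. \<exists>K. \<forall>m\<ge>K. \<forall>n\<ge>K. N (f m - f n) < \<epsilon>) \<longrightarrow>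
            (\<exists>u\<in>W. (\<lambda>k. N (f k - u)) \<longlonglongrightarrow> 0)) \<and>
         (\<exists>\<kappa>\<ge>0. \<forall>u\<in>W. L u \<le> \<kappa> * N u)"
  using assms
proof (induction E arbitrary: W rule: finite_induct)
  case empty
  have z: "N u = 0" "L u = 0" if "u \<in> W" for u
    using empty.prems(6)[OF that] by auto
  have "(\<lambda>k. N (f k - 0)) \<longlonglongrightarrow> 0" if "\<forall>k. f k \<in> W" for f :: "nat \<Rightarrow> 'a"
    using that z(1) by simp
  then have "\<forall>f::nat \<Rightarrow> 'a. (\<forall>k. f k \<in> W) \<longrightarrow> (\<exists>u\<in>W. (\<lambda>k. N (f k - u)) \<longlonglongrightarrow> 0)"
    using subspace_0[OF empty.prems(1)] by blast
  moreover have "\<forall>u\<in>W. L u \<le> 0 * N u"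
    using z by simp
  ultimately show ?case
    by blast
next
  case (insert e E)
  note W = insert.prems(1) and N = insert.prems(2) and L = insert.prems(3)
  have eadd: "e (u + w) = e u + e w" and esc: "e (c *\<^sub>R u) = c * e u" if "u \<in> W" "w \<in> W" for u w c
    using insert.prems(4,5)[of e] that by auto
  have ediff: "e (u - w) = e u - e w" if "u \<in> W" "w \<in> W" for u w
    using eadd[of u "(- 1) *\<^sub>R w"] esc[OF that(2,2), of "- 1"] that subspace_neg[OF W] by simp
  note Wsimps = subspace_add[OF W] subspace_diff[OF W] subspace_scale[OF W]
  let ?V = "{u \<in> W. e u = 0}"
  have V: "subspace ?V"
    unfolding subspace_def using Wsimps eadd esc subspace_0[OF W] esc[of 0 0 0] by auto
  have IH: "(\<forall>f::nat \<Rightarrow> 'a. (\<forall>k. f k \<in> ?V) \<longrightarrow> (\<forall>\<epsilon>>0. \<exists>K. \<forall>m\<ge>K. \<forall>n\<ge>K. N (f m - f n) < \<epsilon>) \<longrightarrow>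
            (\<exists>u\<in>?V. (\<lambda>k. N (f k - u)) \<longlonglongrightarrow> 0)) \<and>
         (\<exists>\<kappa>\<ge>0. \<forall>u\<in>?V. L u \<le> \<kappa> * N u)"
  proof (rule insert.IH[OF V])
    show "is_seminorm ?V N" "is_seminorm ?V L"
      by (rule is_seminorm_subset[OF N] is_seminorm_subset[OF L], blast)+
    show "N u = 0 \<and> L u = 0" if "u \<in> ?V" "\<And>e. e \<in> E \<Longrightarrow> e u = 0" for u
      using insert.prems(6)[of u] that by auto
  qed (use insert.prems(4,5,7) in auto)
  show ?case
  proof (cases "\<exists>w\<in>W. e w \<noteq> 0")
    case False
    then have "?V = W"
      by auto
    then show ?thesis
      using IH by simp
  next
    case True
    then obtain w where w: "w \<in> W" "e w \<noteq> 0"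
      by blast
    define w0 where "w0 = inverse (e w) *\<^sub>R w"
    have w0: "w0 \<in> W" "e w0 = 1"
      unfolding w0_def using w Wsimps esc[OF w(1) w(1)] by auto
    \<comment> \<open>If \<open>e\<close> is unbounded for \<open>N\<close>, normalising gives
      \<open>h k\<close> with \<open>e (h k) = 1\<close> and \<open>N (h k)\<close> tending to 0.
      The sequence \<open>h k - h 0\<close> is Cauchy in the kernel of \<open>e\<close>; its limit
      \<open>z\<close> yields \<open>h 0 + z\<close> with \<open>N\<close> equal to 0 but
      \<open>e\<close> equal to 1.\<close>
    have "\<exists>B>0. \<forall>u\<in>W. \<bar>e u\<bar> \<le> B * N u"
    proof (rule ccontr)
      assume "\<not> ?thesis"
      then have "\<exists>u\<in>W. \<bar>e u\<bar> > real (Suc k) * N u" for k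
        using of_nat_0_less_iff[of "Suc k"] not_le by blast
      then obtain g where g: "\<And>k. g k \<in> W" "\<And>k. \<bar>e (g k)\<bar> > real (Suc k) * N (g k)"
        by metis
      have gpos: "\<bar>e (g k)\<bar> > 0" for k
        using g(2)[of k] is_seminormD(3)[OF N W g(1) g(1), of k] by (smt (verit) mult_nonneg_nonneg of_nat_0_le_iff)
      define h where "h = (\<lambda>k. inverse (e (g k)) *\<^sub>R g k)"
      have h: "h k \<in> W" "e (h k) = 1" for k
        unfolding h_def using g(1)[of k] gpos[of k] Wsimps esc[OF g(1) g(1)] by auto
      have hN: "N (h k) \<le> inverse (real (Suc k))" for k
      proof -
        have "N (h k) = N (g k) / \<bar>e (g k)\<bar>"
          unfolding h_def is_seminormD(1)[OF N W g(1) g(1)] by (simp add: field_simps)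
        also have "\<dots> \<le> inverse (real (Suc k))"
          using g(2)[of k] gpos[of k] by (simp add: field_simps)
        finally show ?thesis .
      qed
      have hlim: "(\<lambda>k. N (h k)) \<longlonglongrightarrow> 0"
        by (rule tendsto_sandwich[OF _ _ tendsto_const LIMSEQ_inverse_real_of_nat])
           (use hN is_seminormD(3)[OF N W h(1) h(1)] in auto)
      have cauchy: "\<exists>K. \<forall>m\<ge>K. \<forall>n\<ge>K. N ((h m - h 0) - (h n - h 0)) < \<epsilon>" if "\<epsilon> > 0" for \<epsilon>
      proof -
        obtain K where K: "\<And>k. k \<ge> K \<Longrightarrow> N (h k) < \<epsilon> / 2"
          using order_tendstoD(2)[OF hlim, of "\<epsilon> / 2"] \<open>\<epsilon> > 0\<close> by (auto simp: eventually_sequentially)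
        have "N ((h m - h 0) - (h n - h 0)) < \<epsilon>" if "m \<ge> K" "n \<ge> K" for m n
          using is_seminormD(4)[OF N W h(1)[of m] h(1)[of n]] K[OF that(1)] K[OF that(2)] by simp
        then show ?thesis by blast
      qed
      have "h k - h 0 \<in> ?V" for k
        using h ediff Wsimps by auto
      then obtain z where z: "z \<in> ?V" "(\<lambda>k. N (h k - h 0 - z)) \<longlonglongrightarrow> 0"
        using IH[THEN conjunct1, rule_format, of "\<lambda>k. h k - h 0"] cauchy by blast
      then have zW: "z \<in> W" and hz: "h 0 + z \<in> W"
        using h Wsimps by auto
      have "N (h 0 + z) \<le> N (h k) + N (h k - h 0 - z)" for k
      proof -
        have "h 0 + z = h k - (h k - h 0 - z)"
          by simp
        moreover have "h k - h 0 - z \<in> W"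
          using h zW Wsimps by auto
        ultimately show ?thesis
          using is_seminormD(4)[OF N W h(1)[of k], of "h k - h 0 - z"] by (simp add: add.commute)
      qed
      moreover have "(\<lambda>k. N (h k) + N (h k - h 0 - z)) \<longlonglongrightarrow> 0 + 0"
        by (intro tendsto_add hlim z(2))
      ultimately have "N (h 0 + z) \<le> 0"
        using LIMSEQ_le_const[of "\<lambda>k. N (h k) + N (h k - h 0 - z)" 0 "N (h 0 + z)"] by auto
      then have "N (h 0 + z) = 0"
        using is_seminormD(3)[OF N W hz hz] by simp
      then have "e (h 0 + z) = 0"
        using insert.prems(7)[OF hz] by simp
      then show False
        using eadd[OF h(1)[of 0] zW] h(2)[of 0] z(1) by simp
    qed
    then obtain B where B: "B > 0" "\<And>u. u \<in> W \<Longrightarrow> \<bar>e u\<bar> \<le> B * N u"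
      by blast
    \<comment> \<open>The projection onto the kernel of \<open>e\<close> along \<open>w0\<close>.
      The bound on \<open>e\<close> makes it bounded for \<open>N\<close>, so completeness and
      domination transfer from the kernel to \<open>W\<close>.\<close>
    define P where "P = (\<lambda>u. u - e u *\<^sub>R w0)"
    have P: "P u \<in> ?V" if "u \<in> W" for u
      unfolding P_def using that w0 Wsimps ediff esc[OF w0(1) w0(1)] by auto
    have PN: "N (P u) \<le> (1 + B * N w0) * N u" if u: "u \<in> W" for u
    proof -
      have "N (P u) \<le> N u + \<bar>e u\<bar> * N w0"
        unfolding P_def using is_seminormD(4)[OF N W u, of "e u *\<^sub>R w0"] is_seminormD(1)[OF N W w0(1) w0(1)]
          Wsimps w0 by simp
      also have "\<dots> \<le> N u + B * N u * N w0"
        using B(2)[OF u] is_seminormD(3)[OF N W w0(1) w0(1)] by (simp add: mult_right_mono)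
      finally show ?thesis
        by (simp add: algebra_simps)
    qed
    show ?thesis
    proof (intro conjI allI impI)
      fix f :: "nat \<Rightarrow> 'a"
      assume fW: "\<forall>k. f k \<in> W" and cf: "\<forall>\<epsilon>>0. \<exists>K. \<forall>m\<ge>K. \<forall>n\<ge>K. N (f m - f n) < \<epsilon>"
      have "Cauchy (\<lambda>k. e (f k))"
      proof (rule metric_CauchyI)
        fix \<epsilon> :: real assume "\<epsilon> > 0"
        then have "\<epsilon> / B > 0"
          using B(1) by simp
        then obtain K where K: "\<forall>m\<ge>K. \<forall>n\<ge>K. N (f m - f n) < \<epsilon> / B"
          using cf by blast
        have "dist (e (f m)) (e (f n)) < \<epsilon>" if "m \<ge> K" "n \<ge> K" for m n
        proof -
          have "\<bar>e (f m - f n)\<bar> \<le> B * N (f m - f n)"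
            by (intro B(2) Wsimps) (use fW in auto)
          also have "\<dots> < \<epsilon>"
            using K that B(1) by (auto simp: field_simps)
          finally show ?thesis
            using fW ediff by (simp add: dist_real_def)
        qed
        then show "\<exists>K. \<forall>m\<ge>K. \<forall>n\<ge>K. dist (e (f m)) (e (f n)) < \<epsilon>"
          by blast
      qed
      then obtain a where a: "(\<lambda>k. e (f k)) \<longlonglongrightarrow> a"
        using Cauchy_convergent_iff convergent_def by blast
      have PP: "P (f m) - P (f n) = P (f m - f n)" for m n
      proof -
        have *: "e (f m - f n) = e (f m) - e (f n)"
          using fW by (intro ediff) auto
        show ?thesis
          unfolding P_def * scaleR_diff_left by simp
      qed
      have "\<exists>K. \<forall>m\<ge>K. \<forall>n\<ge>K. N (P (f m) - P (f n)) < \<epsilon>" if "\<epsilon> > 0" for \<epsilon>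
      proof -
        let ?D = "1 + B * N w0"
        have D: "?D > 0"
          using B(1) is_seminormD(3)[OF N W w0(1) w0(1)] by (smt (verit) mult_nonneg_nonneg)
        then have "\<epsilon> / ?D > 0"
          using \<open>\<epsilon> > 0\<close> by simp
        then obtain K where K: "\<forall>m\<ge>K. \<forall>n\<ge>K. N (f m - f n) < \<epsilon> / ?D"
          using cf by blast
        have "N (P (f m) - P (f n)) < \<epsilon>" if "m \<ge> K" "n \<ge> K" for m n
        proof -
          have "N (P (f m) - P (f n)) \<le> ?D * N (f m - f n)"
            unfolding PP using fW by (intro PN Wsimps) auto
          also have "\<dots> < \<epsilon>"
            using K that D by (auto simp: field_simps)
          finally show ?thesis .
        qed
        then show ?thesis by blast
      qed
      then obtain z where z: "z \<in> ?V" "(\<lambda>k. N (P (f k) - z)) \<longlonglongrightarrow> 0"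
        using IH[THEN conjunct1, rule_format, of "\<lambda>k. P (f k)"] P fW by blast
      have zW: "z \<in> W" and zaW: "z + a *\<^sub>R w0 \<in> W"
        using z(1) w0 Wsimps by auto
      have "(\<lambda>k. N (f k - (z + a *\<^sub>R w0))) \<longlonglongrightarrow> 0"
      proof (rule tendsto_sandwich[OF _ _ tendsto_const])
        have "N (f k - (z + a *\<^sub>R w0)) \<le> N (P (f k) - z) + \<bar>e (f k) - a\<bar> * N w0" for k
        proof -
          have eq: "f k - (z + a *\<^sub>R w0) = (P (f k) - z) + (e (f k) - a) *\<^sub>R w0"
            by (simp add: P_def algebra_simps)
          have "P (f k) - z \<in> W" "(e (f k) - a) *\<^sub>R w0 \<in> W"
            using P fW zW w0 Wsimps by auto
          then show ?thesis
            unfolding eq using is_seminormD(2)[OF N W, of "P (f k) - z" "(e (f k) - a) *\<^sub>R w0"]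
              is_seminormD(1)[OF N W w0(1) w0(1), of "e (f k) - a"] by simp
        qed
        then show "\<forall>\<^sub>F k in sequentially. N (f k - (z + a *\<^sub>R w0)) \<le> N (P (f k) - z) + \<bar>e (f k) - a\<bar> * N w0"
          by simp
        have "(\<lambda>k. N (P (f k) - z) + \<bar>e (f k) - a\<bar> * N w0) \<longlonglongrightarrow> 0 + \<bar>a - a\<bar> * N w0"
          by (intro tendsto_intros z(2) a)
        then show "(\<lambda>k. N (P (f k) - z) + \<bar>e (f k) - a\<bar> * N w0) \<longlonglongrightarrow> 0"
          by simp
        show "\<forall>\<^sub>F k in sequentially. 0 \<le> N (f k - (z + a *\<^sub>R w0))"
        proof (intro always_eventually allI)
          fix k
          have "f k - (z + a *\<^sub>R w0) \<in> W"
            using fW zaW by (intro subspace_diff[OF W]) auto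
          then show "0 \<le> N (f k - (z + a *\<^sub>R w0))"
            by (rule is_seminormD(3)[OF N W _ w0(1)])
        qed
      qed
      then show "\<exists>u\<in>W. (\<lambda>k. N (f k - u)) \<longlonglongrightarrow> 0"
        using zaW by blast
    next
      obtain \<kappa> where \<kappa>: "\<kappa> \<ge> 0" "\<And>u. u \<in> ?V \<Longrightarrow> L u \<le> \<kappa> * N u"
        using IH by blast
      let ?k = "\<kappa> * (1 + B * N w0) + B * L w0"
      have nn: "0 \<le> N w0" "0 \<le> L w0"
        using is_seminormD(3)[OF N W w0(1) w0(1)] is_seminormD(3)[OF L W w0(1) w0(1)] .
      have "L u \<le> ?k * N u" if u: "u \<in> W" for u
      proof -
        have "u = P u + e u *\<^sub>R w0"
          by (simp add: P_def)
        moreover have "P u \<in> W" "e u *\<^sub>R w0 \<in> W"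
          using P[OF u] w0 Wsimps by auto
        ultimately have "L u \<le> L (P u) + \<bar>e u\<bar> * L w0"
          using is_seminormD(2)[OF L W, of "P u" "e u *\<^sub>R w0"] is_seminormD(1)[OF L W w0(1) w0(1), of "e u"] by simp
        also have "\<dots> \<le> \<kappa> * ((1 + B * N w0) * N u) + B * N u * L w0"
          using \<kappa>(2)[OF P[OF u]] mult_left_mono[OF PN[OF u] \<kappa>(1)] mult_right_mono[OF B(2)[OF u] nn(2)]
          by linarith
        finally show ?thesis
          by (simp add: algebra_simps)
      qed
      moreover have "?k \<ge> 0"
        using \<kappa>(1) B(1) nn by simp
      ultimately show "\<exists>\<kappa>\<ge>0. \<forall>u\<in>W. L u \<le> \<kappa> * N u"
        by blast
    qed
  qed
qed


section \<open>Homogeneous kernel functions have bounded degree\<close>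

text \<open>
  For a homogeneous \<open>f\<close> of degree \<open>k\<close>, dilation by \<open>l > 1\<close> shows that the part of \<open>\<Omega>\<close> which the dilation
  keeps inside \<open>\<Omega>\<close> carries at most a fraction \<open>l\<^sup>-\<^sup>k\<close> of the integral of \<open>f\<close>. For large \<open>k\<close>
  the mass therefore sits on the remaining small set, which the bound of the \<open>L\<^sup>p\<close> norm by the \<open>L\<^sup>1\<close> norm forbids.
\<close>

lemma homogeneous_degree_bound:
  fixes \<Omega> :: "(real ^ 'n::finite) set" and x0 :: "real ^ 'n"
  assumes \<Omega>: "open \<Omega>" "bounded \<Omega>" and p: "p > 1" and C: "C > 0"
  shows "\<exists>k0. \<forall>k\<ge>k0. \<forall>f. continuous_on UNIV f \<longrightarrow> (\<forall>x. 0 \<le> f x) \<longrightarrow>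
     (\<forall>l>0. \<forall>x. f (x0 + l *\<^sub>R (x - x0)) = l ^ k * f x) \<longrightarrow>
     (LINT x:\<Omega>|lborel. f x powr p) \<le> (C * (LINT x:\<Omega>|lborel. f x)) powr p \<longrightarrow>
     (LINT x:\<Omega>|lborel. f x) = (0 :: real)"
proof -
  have \<Omega>b[measurable]: "\<Omega> \<in> sets borel"
    using \<Omega> by simp
  have \<Omega>fin: "emeasure lborel \<Omega> < \<infinity>"
    using \<Omega>(2) emeasure_bounded_finite by blast
  define T where "T = (\<lambda>l x. x0 + l *\<^sub>R (x - x0))"
  have T: "T l x = (x0 - l *\<^sub>R x0) + l *\<^sub>R x" for l x
    by (simp add: T_def algebra_simps)
  define S where "S = (\<lambda>l. \<Omega> \<inter> T l -` \<Omega>)"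
  have Sb[measurable]: "S l \<in> sets borel" for l
  proof -
    have "continuous_on UNIV (T l)"
      unfolding T_def by (intro continuous_intros)
    then have "open (T l -` \<Omega>)"
      using \<Omega>(1) open_vimage by blast
    then show ?thesis
      unfolding S_def using \<Omega>(1) by simp
  qed
  define lam where "lam = (\<lambda>m. 1 + inverse (real (Suc m)))"
  have lam: "lam m > 1" for m
    by (simp add: lam_def)
  have lam_lim: "lam \<longlonglongrightarrow> 1"
    unfolding lam_def using tendsto_add[OF tendsto_const LIMSEQ_inverse_real_of_nat, of "1 :: real"] by simp
  define M where "M = (4 * C powr p) powr (1 / (p - 1))"
  have M: "M > 0" "M powr (1 - p) * C powr p = 1 / 4"
  proof -
    have "1 / (p - 1) * (1 - p) = - 1"
      using p by (simp add: divide_eq_eq)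
    then have "M powr (1 - p) = (4 * C powr p) powr (- 1)"
      unfolding M_def powr_powr by simp
    then show "M powr (1 - p) * C powr p = 1 / 4"
      using C by (simp add: powr_minus field_simps)
    show "M > 0"
      unfolding M_def using C by simp
  qed
  \<comment> \<open>Since \<Omega> is open, a dilation with factor close to 1 keeps a given point
    inside; by dominated convergence the set of lost points has small measure.\<close>
  have "(\<lambda>m. LINT x|lborel. indicator (\<Omega> - S (lam m)) x) \<longlonglongrightarrow> (LINT x::real ^ 'n|lborel. (0 :: real))"
  proof (rule integral_dominated_convergence[where w="indicator \<Omega>"])
    show "integrable lborel (indicator \<Omega> :: _ \<Rightarrow> real)"
      using \<Omega>fin by simp
    show "AE x in lborel. (\<lambda>m. indicator (\<Omega> - S (lam m)) x) \<longlonglongrightarrow> (0 :: real)"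
    proof (intro AE_I2)
      fix x
      show "(\<lambda>m. indicator (\<Omega> - S (lam m)) x) \<longlonglongrightarrow> (0 :: real)"
      proof (cases "x \<in> \<Omega>")
        case True
        have "(\<lambda>m. T (lam m) x) \<longlonglongrightarrow> T 1 x"
          unfolding T_def by (intro tendsto_intros lam_lim)
        then have "\<forall>\<^sub>F m in sequentially. T (lam m) x \<in> \<Omega>"
          using topological_tendstoD[OF _ \<Omega>(1)] True by (simp add: T_def)
        then have "\<forall>\<^sub>F m in sequentially. (0 :: real) = indicator (\<Omega> - S (lam m)) x"
          by eventually_elim (simp add: S_def True)
        then show ?thesis
          by (rule Lim_transform_eventually[OF tendsto_const])
      qed simp
    qed
  qed (auto simp: indicator_def)
  then have "(\<lambda>m. measure lborel (\<Omega> - S (lam m))) \<longlonglongrightarrow> 0"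
    by simp
  then have "\<forall>\<^sub>F m in sequentially. measure lborel (\<Omega> - S (lam m)) < 1 / (4 * M)"
    using M(1) by (intro order_tendstoD(2)) auto
  then obtain m where m: "measure lborel (\<Omega> - S (lam m)) < 1 / (4 * M)"
    by (auto simp: eventually_sequentially)
  define l where "l = lam m"
  have l: "l > 1"
    unfolding l_def by (rule lam)
  define E where "E = \<Omega> - S l"
  have Eb[measurable]: "E \<in> sets borel"
    unfolding E_def by simp
  have Efin: "emeasure lborel E < \<infinity>"
    using \<Omega>fin emeasure_mono[of E \<Omega> lborel] by (auto simp: E_def intro: le_less_trans)
  have EM: "M * measure lborel E < 1 / 4"
    using m M(1) by (simp add: E_def l_def field_simps)
  \<comment> \<open>The factor \<open>l\<close> depends only on \<Omega>, \<open>x0\<close>,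
    \<open>p\<close> and \<open>C\<close>, hence so does the degree \<open>k0\<close>.\<close>
  obtain k0 where k0: "2 < l ^ k0"
    using real_arch_pow[OF l] by blast
  show ?thesis
  proof (intro exI[of _ k0] allI impI)
    fix k and f :: "real ^ 'n \<Rightarrow> real"
    assume k: "k0 \<le> k" and fc: "continuous_on UNIV f" and f0: "\<forall>x. 0 \<le> f x"
      and hom: "\<forall>l>0. \<forall>x. f (x0 + l *\<^sub>R (x - x0)) = l ^ k * f x"
      and rev: "(LINT x:\<Omega>|lborel. f x powr p) \<le> (C * (LINT x:\<Omega>|lborel. f x)) powr p"
    have [measurable]: "f \<in> borel_measurable borel"
      using fc by (rule borel_measurable_continuous_onI)
    have int: "integrable lborel (\<lambda>x. indicator B x * f x)" if "B \<subseteq> \<Omega>" "B \<in> sets borel" for B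
    proof -
      have "set_integrable lborel B f"
        by (rule locally_integrable_set_integrable[OF continuous_locally_integrable[OF fc]])
           (use that \<Omega> bounded_subset in auto)
      then show ?thesis
        by (simp add: set_integrable_def)
    qed
    have intp: "integrable lborel (\<lambda>x. indicator \<Omega> x * f x powr p)"
    proof -
      have "continuous_on UNIV (\<lambda>x. f x powr p)"
        using fc f0 p by (intro continuous_on_powr') auto
      then have "set_integrable lborel \<Omega> (\<lambda>x. f x powr p)"
        using \<Omega> by (intro locally_integrable_set_integrable continuous_locally_integrable) auto
      then show ?thesis
        by (simp add: set_integrable_def)
    qed
    define I where "I = (LINT x|lborel. indicator \<Omega> x * f x)"
    have Idef: "(LINT x:\<Omega>|lborel. f x) = I"
      by (simp add: I_def set_lebesgue_integral_def)
    have "I \<ge> 0"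
      unfolding I_def using f0 by (intro integral_nonneg_AE) auto
    have False if "I > 0"
    proof -
      have MI: "M * I > 0"
        using M(1) that by simp
      \<comment> \<open>On \<open>E\<close> either \<open>f x \<le> M * I\<close>, or
        \<open>f x\<close> is larger and its power with the negative exponent \<open>1 - p\<close>
        is at most \<open>(M * I) powr (1 - p)\<close>. Each term will integrate to at most
        \<open>I / 4\<close>.\<close>
      have "indicator E x * f x \<le> M * I * indicator E x + (M * I) powr (1 - p) * (indicator \<Omega> x * f x powr p)" for x
      proof (cases "x \<in> E")
        case True
        then have "x \<in> \<Omega>"
          by (simp add: E_def)
        show ?thesis
        proof (cases "f x \<le> M * I")
          case True
          then show ?thesis
            using \<open>x \<in> E\<close> \<open>x \<in> \<Omega>\<close> by (simp add: add_increasing2)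
        next
          case False
          then have fp: "f x > 0"
            using MI by linarith
          have "f x powr (1 - p) \<le> (M * I) powr (1 - p)"
            using False MI p by (intro powr_mono2') auto
          then have "f x powr (1 - p) * f x powr p \<le> (M * I) powr (1 - p) * f x powr p"
            by (rule mult_right_mono) simp
          then have "f x \<le> (M * I) powr (1 - p) * f x powr p"
            using fp by (simp add: powr_add[symmetric])
          then show ?thesis
            using MI \<open>x \<in> E\<close> \<open>x \<in> \<Omega>\<close> by simp
        qed
      qed simp
      then have "(LINT x|lborel. indicator E x * f x) \<le>
          (LINT x|lborel. M * I * indicator E x + (M * I) powr (1 - p) * (indicator \<Omega> x * f x powr p))"
        using Efin by (intro integral_mono int Bochner_Integration.integrable_add integrable_mult_right intp) (auto simp: E_def)
      also have "\<dots> = M * I * measure lborel E + (M * I) powr (1 - p) * (LINT x:\<Omega>|lborel. f x powr p)"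
        using Efin intp by (simp add: set_lebesgue_integral_def)
      also have "\<dots> \<le> M * I * measure lborel E + (M * I) powr (1 - p) * (C * I) powr p"
        using rev unfolding Idef by (intro add_left_mono mult_left_mono) auto
      also have "(M * I) powr (1 - p) * (C * I) powr p = (M powr (1 - p) * C powr p) * (I powr (1 - p) * I powr p)"
        using M(1) C that by (simp add: powr_mult)
      also have "\<dots> = I / 4"
        unfolding M(2) using that by (simp add: powr_add[symmetric])
      also have "M * I * measure lborel E \<le> I / 4"
        using EM that mult_right_mono[of "M * measure lborel E" "1 / 4" I] by (simp add: mult_ac)
      finally have onE: "(LINT x|lborel. indicator E x * f x) \<le> I / 2"
        by simp
      have lk: "l ^ k > 2"
        using k0 power_increasing[OF k, of l] l by linarith
      have fT: "f (T l x) = l ^ k * f x" for x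
        using hom l unfolding T_def by auto
      have ST: "indicator (S l) x * f (T l x) \<le> indicator \<Omega> (T l x) * f (T l x)" for x
        using f0 by (auto simp: S_def indicator_def)
      have iT: "integrable lborel (\<lambda>x. indicator \<Omega> (T l x) * f (T l x))"
        unfolding T by (rule lborel_integrable_affine) (use l int in auto)
      have iS: "integrable lborel (\<lambda>x. indicator (S l) x * f x)"
        by (rule int[OF _ Sb]) (simp add: S_def)
      \<comment> \<open>Homogeneity turns the factor \<open>l ^ k\<close> into a dilation of the
        argument; the change of variables then costs \<open>1 / l ^ CARD('n)\<close>, which is at
        most 1. So \<open>S l\<close> carries less than half of \<open>I\<close>, and
        \<open>E\<close> at most half.\<close>
      have "l ^ k * (LINT x|lborel. indicator (S l) x * f x) = (LINT x|lborel. indicator (S l) x * f (T l x))"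
        by (simp add: fT mult.left_commute)
      also have "\<dots> \<le> (LINT x|lborel. indicator \<Omega> (T l x) * f (T l x))"
      proof (rule integral_mono[OF _ iT ST])
        have "integrable lborel (\<lambda>x. l ^ k * (indicator (S l) x * f x))"
          using iS by simp
        then show "integrable lborel (\<lambda>x. indicator (S l) x * f (T l x))"
          by (simp add: fT mult.left_commute)
      qed
      also have "\<dots> \<le> I"
      proof -
        have "I = l ^ CARD('n) * (LINT x|lborel. indicator \<Omega> (T l x) * f (T l x))"
          unfolding I_def T using l by (subst lborel_integral_affine[where c=l and a="x0 - l *\<^sub>R x0"]) auto
        moreover have "0 \<le> (LINT x|lborel. indicator \<Omega> (T l x) * f (T l x))"
          using f0 by (intro integral_nonneg_AE) auto
        moreover have "1 \<le> l ^ CARD('n)"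
          using l by simp
        ultimately show ?thesis
          using mult_right_mono[of 1 "l ^ CARD('n)"] by simp
      qed
      finally have a: "l ^ k * (LINT x|lborel. indicator (S l) x * f x) \<le> I" .
      have "2 * (LINT x|lborel. indicator (S l) x * f x) < I"
      proof (cases "(LINT x|lborel. indicator (S l) x * f x) > 0")
        case True
        then show ?thesis
          using a lk mult_strict_right_mono[OF lk True] by linarith
      qed (use that in linarith)
      moreover have "I = (LINT x|lborel. indicator E x * f x) + (LINT x|lborel. indicator (S l) x * f x)"
      proof -
        have "indicator \<Omega> x * f x = indicator E x * f x + indicator (S l) x * f x" for x
          by (auto simp: E_def S_def indicator_def)
        then show ?thesis
          unfolding I_def using int[of E] iS by (simp add: E_def)
      qed
      ultimately show False
        using onE by linarith
    qed
    with \<open>I \<ge> 0\<close> show "(LINT x:\<Omega>|lborel. f x) = 0"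
      unfolding Idef by force
  qed
qed

section \<open>Norms as integrals, and the degree bound on the kernel\<close>

lemma Lp_norm_eq:
  assumes "set_integrable lborel \<Omega> (\<lambda>x. norm (u x) powr p)"
  shows "Lp_norm p \<Omega> u = ennreal ((LINT x:\<Omega>|lborel. norm (u x) powr p) powr (1 / p))"
proof -
  have "(\<integral>\<^sup>+x\<in>\<Omega>. ennreal (norm (u x) powr p) \<partial>lborel) = (\<integral>\<^sup>+x. ennreal (indicator \<Omega> x *\<^sub>R norm (u x) powr p) \<partial>lborel)"
    by (intro nn_integral_cong) (simp add: indicator_def)
  also have "\<dots> = ennreal (LINT x|lborel. indicator \<Omega> x *\<^sub>R norm (u x) powr p)"
    using assms by (intro nn_integral_eq_integral) (auto simp: set_integrable_def)
  finally show ?thesis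
    by (simp add: Lp_norm_def Let_def set_lebesgue_integral_def integral_nonneg_AE)
qed

lemma L1_norm_eq:
  assumes "set_integrable lborel \<Omega> u"
  shows "Lp_norm 1 \<Omega> u = ennreal (LINT x:\<Omega>|lborel. norm (u x))"
proof -
  have "set_integrable lborel \<Omega> (\<lambda>x. norm (u x) powr 1)"
    using set_integrable_norm[OF assms] by simp
  moreover have "0 \<le> (LINT x:\<Omega>|lborel. norm (u x))"
    by (auto simp: set_lebesgue_integral_def intro!: integral_nonneg_AE)
  ultimately show ?thesis
    by (simp add: Lp_norm_eq)
qed

lemma continuous_zero_of_integral_zero:
  fixes f :: "real ^ 'n::finite \<Rightarrow> real"
  assumes "open \<Omega>" "bounded \<Omega>" "continuous_on UNIV f" "\<And>x. 0 \<le> f x" "(LINT x:\<Omega>|lborel. f x) = 0" "x \<in> \<Omega>"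
  shows "f x = 0"
proof (rule ccontr)
  assume "f x \<noteq> 0"
  let ?U = "\<Omega> \<inter> {x. f x \<noteq> 0}"
  have "open {x. f x \<noteq> 0}"
    using assms(3) by (intro open_Collect_neq) auto
  then have U: "open ?U" "?U \<noteq> {}"
    using assms(1,6) \<open>f x \<noteq> 0\<close> by auto
  have "set_integrable lborel \<Omega> f"
    using assms(1,2) by (intro locally_integrable_set_integrable continuous_locally_integrable assms(3)) auto
  then have "AE x in lborel. indicator \<Omega> x *\<^sub>R f x = 0"
    using assms(4,5) integral_nonneg_eq_0_iff_AE[of lborel "\<lambda>x. indicator \<Omega> x *\<^sub>R f x"]
    by (auto simp: set_integrable_def set_lebesgue_integral_def)
  then have "AE x in lborel. x \<notin> ?U"
    by (rule AE_mp) (auto intro!: AE_I2)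
  then have "?U \<in> null_sets lborel"
    using U(1) by (subst AE_iff_null_sets) auto
  then have "negligible ?U"
    by (simp add: negligible_iff_null_sets null_sets_completionI)
  then show False
    using open_not_negligible[OF U] by blast
qed

definition kernel_reverse_Holder :: "(real ^ 'n::finite) set \<Rightarrow> ('n \<Rightarrow> 'v::euclidean_space \<Rightarrow> 'w::euclidean_space) \<Rightarrow> real \<Rightarrow> real \<Rightarrow> bool" where
  "kernel_reverse_Holder \<Omega> A p C \<longleftrightarrow> (\<forall>w\<in>ker_op A. Lp_norm p \<Omega> w \<le> ennreal C * Lp_norm 1 \<Omega> w)"

lemma kernel_degree_bound:
  fixes A :: "'n::finite \<Rightarrow> 'v::euclidean_space \<Rightarrow> 'w::euclidean_space"
  assumes A: "first_order_operator A" and \<Omega>: "open \<Omega>" "bounded \<Omega>" "x0 \<in> \<Omega>"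
    and p: "p > 1" and C: "C > 0" and rev: "kernel_reverse_Holder \<Omega> A p C"
  obtains k0 where "\<And>k v \<phi> x y. k0 \<le> k \<Longrightarrow> v \<in> ker_op A \<Longrightarrow> \<phi> \<in> test_functions UNIV \<Longrightarrow> dmoll v y k \<phi> x = 0"
proof -
  obtain k0 where k0: "\<forall>k\<ge>k0. \<forall>f. continuous_on UNIV f \<longrightarrow> (\<forall>x. 0 \<le> f x) \<longrightarrow>
     (\<forall>l>0. \<forall>x. f (x0 + l *\<^sub>R (x - x0)) = l ^ k * f x) \<longrightarrow>
     (LINT x:\<Omega>|lborel. f x powr p) \<le> (C * (LINT x:\<Omega>|lborel. f x)) powr p \<longrightarrow>
     (LINT x:\<Omega>|lborel. f x) = (0 :: real)"
    using homogeneous_degree_bound[OF \<Omega>(1,2) p C] by blast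
  show ?thesis
  proof (rule that)
    fix k v and \<phi> :: "real ^ 'n \<Rightarrow> real" and x y :: "real ^ 'n"
    assume k: "k0 \<le> k" and v: "v \<in> ker_op A" and \<phi>: "\<phi> \<in> test_functions UNIV"
    define q where "q = (\<lambda>y. dmoll v y k \<phi> x)"
    \<comment> \<open>Translation puts the centre of homogeneity at \<open>x0\<close>, inside
      \<Omega>; vanishing on \<Omega> then means vanishing near the centre, and scaling extends this
      to every direction.\<close>
    define w where "w = (\<lambda>y. q (y - x0))"
    define f where "f = (\<lambda>y. norm (w y))"
    have q: "q \<in> ker_op A"
      unfolding q_def by (rule dmoll_ker_op[OF A v \<phi>])
    have w: "w \<in> ker_op A"
      using ker_op_affine[OF A q, of 1 "- x0"] by (simp add: w_def)
    have qc: "continuous_on S q" for S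
      unfolding q_def by (rule dmoll_continuous)
    have wc: "continuous_on UNIV w"
      unfolding w_def by (rule continuous_on_compose2[OF qc[of UNIV]]) (auto intro!: continuous_intros)
    have fc: "continuous_on UNIV f"
      unfolding f_def by (intro continuous_intros wc)
    have qs: "q (l *\<^sub>R y) = l ^ k *\<^sub>R q y" for l y
      unfolding q_def by (rule dmoll_scale)
    have wi: "set_integrable lborel \<Omega> w"
      using \<Omega> by (intro locally_integrable_set_integrable continuous_locally_integrable wc) auto
    have "continuous_on UNIV (\<lambda>x. norm (w x) powr p)"
      using wc p by (intro continuous_on_powr' continuous_intros) auto
    then have wpi: "set_integrable lborel \<Omega> (\<lambda>x. norm (w x) powr p)"
      using \<Omega> by (intro locally_integrable_set_integrable continuous_locally_integrable) auto
    let ?I = "LINT x:\<Omega>|lborel. f x" and ?J = "LINT x:\<Omega>|lborel. f x powr p"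
    have nn: "?I \<ge> 0" "?J \<ge> 0"
      by (auto simp: set_lebesgue_integral_def f_def intro!: integral_nonneg_AE)
    have "ennreal (?J powr (1 / p)) \<le> ennreal C * ennreal ?I"
      using rev[unfolded kernel_reverse_Holder_def, rule_format, OF w]
      unfolding Lp_norm_eq[OF wpi] L1_norm_eq[OF wi] f_def .
    then have "?J powr (1 / p) \<le> C * ?I"
      using C nn by (simp add: ennreal_mult[symmetric])
    then have "(?J powr (1 / p)) powr p \<le> (C * ?I) powr p"
      using p by (intro powr_mono2) auto
    then have "?J \<le> (C * ?I) powr p"
      using p nn by (simp add: powr_powr)
    moreover have "f (x0 + l *\<^sub>R (z - x0)) = l ^ k * f z" if "l > 0" for l z
      using that by (simp add: f_def w_def qs)
    moreover have "\<forall>x. 0 \<le> f x"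
      by (simp add: f_def)
    ultimately have "?I = 0"
      using k0[rule_format, OF k fc] by blast
    then have zero: "w z = 0" if "z \<in> \<Omega>" for z
      using continuous_zero_of_integral_zero[OF \<Omega>(1,2) fc _ _ that] by (simp add: f_def)
    obtain r where r: "r > 0" "ball x0 r \<subseteq> \<Omega>"
      using \<Omega> open_contains_ball by blast
    define l where "l = r / (norm y + 1) / 2"
    have l: "l > 0"
      using r by (simp add: l_def add_nonneg_pos)
    have "norm (l *\<^sub>R y) < r"
    proof -
      have "norm y / (norm y + 1) \<le> 1"
        by (simp add: divide_le_eq add_nonneg_pos)
      then have "r * (norm y / (norm y + 1)) \<le> r"
        using r by (intro mult_left_le) auto
      moreover have "X \<le> r \<Longrightarrow> X / 2 < r" for X
        using r(1) by simp
      ultimately have "r * (norm y / (norm y + 1)) / 2 < r"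
        by blast
      moreover have "norm (l *\<^sub>R y) = r * (norm y / (norm y + 1)) / 2"
        using l r by (simp add: l_def)
      ultimately show ?thesis
        by (simp only:)
    qed
    then have "x0 + l *\<^sub>R y \<in> \<Omega>"
      using r(2) by (auto simp: dist_norm)
    then have "q (l *\<^sub>R y) = 0"
      using zero by (force simp: w_def)
    then have "q y = 0"
      using l by (simp add: qs)
    then show "dmoll v y k \<phi> x = 0"
      by (simp add: q_def)
  qed
qed

section \<open>Functions that are polynomial along lines\<close>

lemma polynomial_zero_of_roots:
  fixes a :: "nat \<Rightarrow> 'v::euclidean_space" and T :: "real set"
  assumes "finite T" "card T \<ge> m" "\<And>t. t \<in> T \<Longrightarrow> (\<Sum>j<m. t ^ j *\<^sub>R a j) = 0"
  shows "(\<Sum>j<m. t ^ j *\<^sub>R a j) = 0"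
proof (cases m)
  case (Suc n)
  have "a j = 0" if j: "j \<le> n" for j
  proof (rule euclidean_eqI)
    fix b :: 'v assume "b \<in> Basis"
    have "a j \<bullet> b = 0"
    proof (rule ccontr)
      assume "a j \<bullet> b \<noteq> 0"
      then have "\<exists>k\<le>n. a k \<bullet> b \<noteq> 0"
        using j by blast
      then have *: "finite {z. (\<Sum>i\<le>n. (a i \<bullet> b) * z ^ i) = 0}" "card {z. (\<Sum>i\<le>n. (a i \<bullet> b) * z ^ i) = 0} \<le> n"
        using polyfun_rootbound[of n "\<lambda>k. a k \<bullet> b"] by auto
      have "T \<subseteq> {z. (\<Sum>i\<le>n. (a i \<bullet> b) * z ^ i) = 0}"
      proof
        fix t assume "t \<in> T"
        then have "(\<Sum>j<Suc n. t ^ j *\<^sub>R a j) \<bullet> b = 0"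
          using assms(3) Suc by simp
        then show "t \<in> {z. (\<Sum>i\<le>n. (a i \<bullet> b) * z ^ i) = 0}"
          unfolding lessThan_Suc_atMost by (simp add: inner_sum_left mult.commute)
      qed
      then have "card T \<le> n"
        by (rule order_trans[OF card_mono[OF *(1)] *(2)])
      then show False
        using assms(2) Suc by simp
    qed
    then show "a j \<bullet> b = 0 \<bullet> b"
      by simp
  qed
  then show ?thesis
    by (intro sum.neutral) (auto simp: Suc)
qed simp

text \<open>The coefficient of order \<open>m\<close> vanishes at every base point, in particular at
  the unknown intermediate point of the Lagrange remainder.\<close>

lemma moll_line_polynomial:
  fixes v :: "real ^ 'n::finite \<Rightarrow> 'v::euclidean_space"
  assumes "locally_integrable v" "\<phi> \<in> test_functions UNIV" "\<And>y x. dmoll v y m \<phi> x = 0"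
  shows "moll v \<phi> (x + t *\<^sub>R y) = (\<Sum>j<m. t ^ j *\<^sub>R ((1 / fact j) *\<^sub>R dmoll v y j \<phi> x))"
proof (rule euclidean_eqI)
  fix b :: 'v assume "b \<in> Basis"
  obtain s where "moll v \<phi> (x + t *\<^sub>R y) \<bullet> b =
     (\<Sum>j<m. (dmoll v y j \<phi> x \<bullet> b) / fact j * t ^ j) + (dmoll v y m \<phi> (x + s *\<^sub>R y) \<bullet> b) / fact m * t ^ m"
    using moll_Taylor[OF assms(1,2)] by blast
  then show "moll v \<phi> (x + t *\<^sub>R y) \<bullet> b = (\<Sum>j<m. t ^ j *\<^sub>R ((1 / fact j) *\<^sub>R dmoll v y j \<phi> x)) \<bullet> b"
    by (simp add: assms(3) inner_sum_left mult_ac)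
qed

text \<open>With \<open>m\<close> nodes per coordinate axis, enough to determine a function whose
  restriction to each line is a polynomial of degree below \<open>m\<close>.\<close>

definition grid :: "nat \<Rightarrow> (real ^ 'n::finite) set" where
  "grid m = {\<gamma>. \<forall>i. \<gamma> $ i \<in> real ` {..<m}}"

lemma finite_grid: "finite (grid m :: (real ^ 'n::finite) set)"
proof -
  have "grid m \<subseteq> (\<lambda>f. \<chi> i. f i) ` (PiE (UNIV :: 'n set) (\<lambda>_. real ` {..<m}))"
  proof
    fix \<gamma> :: "real ^ 'n" assume "\<gamma> \<in> grid m"
    then have "(\<lambda>i. \<gamma> $ i) \<in> PiE UNIV (\<lambda>_. real ` {..<m})"
      by (auto simp: grid_def)
    moreover have "\<gamma> = (\<chi> i. \<gamma> $ i)"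
      by simp
    ultimately show "\<gamma> \<in> (\<lambda>f. \<chi> i. f i) ` (PiE (UNIV :: 'n set) (\<lambda>_. real ` {..<m}))"
      by blast
  qed
  then show ?thesis
    by (rule finite_subset) (intro finite_imageI finite_PiE; simp)
qed

lemma grid_norm_le:
  assumes "\<gamma> \<in> (grid m :: (real ^ 'n::finite) set)"
  shows "norm \<gamma> \<le> real CARD('n) * real m"
proof -
  have "\<bar>\<gamma> $ i\<bar> \<le> real m" for i
  proof -
    have "\<gamma> $ i \<in> real ` {..<m}"
      using assms by (simp add: grid_def)
    then show ?thesis
      by auto
  qed
  then have "(\<Sum>i\<in>UNIV. \<bar>\<gamma> $ i\<bar>) \<le> (\<Sum>i\<in>(UNIV :: 'n set). real m)"
    by (intro sum_mono)
  then show ?thesis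
    using norm_le_l1_cart[of \<gamma>] by simp
qed

text \<open>Induction on the set \<open>J\<close> of coordinates that may lie off the nodes: moving
  one of them through its \<open>m\<close> nodes gives \<open>m\<close> roots of a polynomial of
  degree below \<open>m\<close>.\<close>

lemma zero_of_grid_zero:
  fixes g :: "real ^ 'n::finite \<Rightarrow> 'v::euclidean_space"
  assumes line: "\<And>x y. \<exists>a. \<forall>t. g (x + t *\<^sub>R y) = (\<Sum>j<m. t ^ j *\<^sub>R a j)"
    and s: "s \<noteq> 0" and grid: "\<And>\<gamma>. \<gamma> \<in> grid m \<Longrightarrow> g (x0 + s *\<^sub>R \<gamma>) = 0"
  shows "g x = 0"
proof -
  have "g x = 0" if "finite J" "\<forall>i. i \<notin> J \<longrightarrow> (x $ i - x0 $ i) / s \<in> real ` {..<m}" for J :: "'n set" and x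
    using that
  proof (induction J arbitrary: x rule: finite_induct)
    case empty
    let ?\<gamma> = "\<chi> i. (x $ i - x0 $ i) / s"
    have "?\<gamma> \<in> grid m"
      using empty by (simp add: grid_def)
    moreover have "x0 + s *\<^sub>R ?\<gamma> = x"
      using s by (simp add: vec_eq_iff)
    ultimately show ?case
      using grid by metis
  next
    case (insert i J)
    obtain a where a: "\<And>t. g (x + t *\<^sub>R axis i 1) = (\<Sum>j<m. t ^ j *\<^sub>R a j)"
      using line by blast
    \<comment> \<open>The displacement that brings coordinate \<open>i\<close> of \<open>x\<close>
      to its node number \<open>l\<close>.\<close>
    let ?f = "\<lambda>l. x0 $ i + s * real l - x $ i"
    have root: "(\<Sum>j<m. t ^ j *\<^sub>R a j) = 0" if t: "t \<in> ?f ` {..<m}" for t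
    proof -
      obtain l where l: "l < m" "t = ?f l"
        using t by blast
      have "g (x + t *\<^sub>R axis i 1) = 0"
      proof (rule insert.IH, intro allI impI)
        fix k assume "k \<notin> J"
        show "((x + t *\<^sub>R axis i 1) $ k - x0 $ k) / s \<in> real ` {..<m}"
        proof (cases "k = i")
          case True
          then have "((x + t *\<^sub>R axis i 1) $ k - x0 $ k) / s = real l"
            using l s by (simp add: axis_def)
          then show ?thesis
            using l by simp
        next
          case False
          then show ?thesis
            using insert.prems \<open>k \<notin> J\<close> by (simp add: axis_def)
        qed
      qed
      then show ?thesis
        using a by simp
    qed
    have "inj_on ?f {..<m}"
      using s by (auto simp: inj_on_def)
    then have "m \<le> card (?f ` {..<m})"
      by (simp add: card_image)
    then have "(\<Sum>j<m. 0 ^ j *\<^sub>R a j) = 0"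
      using polynomial_zero_of_roots[OF finite_imageI[OF finite_lessThan] _ root] by blast
    then show ?case
      using a[of 0] by simp
  qed
  note * = this
  show ?thesis
    by (rule *[of UNIV x]) auto
qed


section \<open>Finitely many functionals separate the kernel\<close>

text \<open>
  If \<open>v\<close> averaged against the dilates \<open>\<eta>(\<cdot> / t)\<close> vanishes for enough \<open>t\<close>, then for every \<open>\<phi>\<close> the
  polynomial \<open>t \<mapsto> \<integral> \<eta>(h) moll v \<phi> (x + t h) dh\<close> has enough roots to vanish at \<open>t = 0\<close>.
\<close>

lemma kernel_zero_of_mollifications:
  fixes v :: "real ^ 'n::finite \<Rightarrow> 'v::euclidean_space"
  assumes v: "locally_integrable v"
    and deg: "\<And>\<phi> x y. \<phi> \<in> test_functions UNIV \<Longrightarrow> dmoll v y m \<phi> x = 0"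
    and \<eta>: "\<eta> \<in> test_functions UNIV" "(LINT h|lborel. \<eta> h) \<noteq> 0"
    and T: "finite T" "card T \<ge> m" "0 \<notin> T" and s: "s \<noteq> 0"
    and zero: "\<And>t \<gamma>. t \<in> T \<Longrightarrow> \<gamma> \<in> grid m \<Longrightarrow> moll v (\<lambda>z. \<eta> ((1 / t) *\<^sub>R z)) (x0 + s *\<^sub>R \<gamma>) = 0"
  shows "AE x in lborel. v x = 0"
proof (rule AE_zero_of_test_functions[OF v])
  have \<eta>t: "(\<lambda>z. \<eta> ((1 / t) *\<^sub>R z)) \<in> test_functions UNIV" if "t \<in> T" for t
  proof -
    have "1 / t \<noteq> 0"
      using that T(3) by auto
    from test_functions_affine[OF \<eta>(1) this, of 0] show ?thesis
      by simp
  qed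
  \<comment> \<open>Each dilated mollification is polynomial along lines, so its zeros on the grid
    force it to vanish everywhere.\<close>
  have mz: "moll v (\<lambda>z. \<eta> ((1 / t) *\<^sub>R z)) x = 0" if t: "t \<in> T" for t x
  proof -
    let ?g = "moll v (\<lambda>z. \<eta> ((1 / t) *\<^sub>R z))"
    have line: "\<exists>a. \<forall>r. ?g (x + r *\<^sub>R y) = (\<Sum>j<m. r ^ j *\<^sub>R a j)" for x y
      using moll_line_polynomial[OF v \<eta>t[OF t] deg[OF \<eta>t[OF t]]] by (intro exI allI)
    show ?thesis
      by (rule zero_of_grid_zero[of ?g m s x0 x, OF line s zero[OF t]])
  qed
  note [measurable] = locally_integrable_borel_measurable[OF v] test_functions_measurable[OF \<eta>(1)]
  fix \<phi> :: "real ^ 'n \<Rightarrow> real" assume \<phi>: "\<phi> \<in> test_functions UNIV"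
  define a where "a = (\<lambda>j. LINT h|lborel. \<eta> h *\<^sub>R ((1 / fact j) *\<^sub>R dmoll v h j \<phi> 0))"
  have poly: "(LINT h|lborel. \<eta> h *\<^sub>R moll v \<phi> (0 + t *\<^sub>R h)) = (\<Sum>j<m. t ^ j *\<^sub>R a j)" for t
  proof -
    have int: "integrable lborel (\<lambda>h. \<eta> h *\<^sub>R ((1 / fact j) *\<^sub>R dmoll v h j \<phi> 0))" for j
      by (intro locally_integrable_test_integrable[OF _ \<eta>(1)] continuous_locally_integrable
          continuous_on_scaleR continuous_on_const dmoll_continuous)
    have "\<eta> h *\<^sub>R moll v \<phi> (0 + t *\<^sub>R h) = (\<Sum>j<m. t ^ j *\<^sub>R (\<eta> h *\<^sub>R ((1 / fact j) *\<^sub>R dmoll v h j \<phi> 0)))" for h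
      unfolding moll_line_polynomial[OF v \<phi> deg[OF \<phi>]] scaleR_sum_right by (simp add: mult_ac)
    then have "(LINT h|lborel. \<eta> h *\<^sub>R moll v \<phi> (0 + t *\<^sub>R h)) =
        (LINT h|lborel. (\<Sum>j<m. t ^ j *\<^sub>R (\<eta> h *\<^sub>R ((1 / fact j) *\<^sub>R dmoll v h j \<phi> 0))))"
      by (simp only:)
    also have "\<dots> = (\<Sum>j<m. (LINT h|lborel. t ^ j *\<^sub>R (\<eta> h *\<^sub>R ((1 / fact j) *\<^sub>R dmoll v h j \<phi> 0))))"
      by (intro Bochner_Integration.integral_sum integrable_scaleR_right int)
    finally show ?thesis
      by (simp only: integral_scaleR_right a_def)
  qed
  have root: "(\<Sum>j<m. t ^ j *\<^sub>R a j) = 0" if t: "t \<in> T" for t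
  proof -
    have t0: "t \<noteq> 0"
      using t T(3) by auto
    have inner: "(LINT h|lborel. \<eta> h *\<^sub>R v (0 + t *\<^sub>R h + z)) = 0" for z
    proof -
      have "0 = (LINT w|lborel. \<eta> ((1 / t) *\<^sub>R w) *\<^sub>R v (z + w))"
        using mz[OF t, of z] moll_alt[OF v \<eta>t[OF t]] by simp
      also have "\<dots> = \<bar>t\<bar> ^ CARD('n) *\<^sub>R (LINT h|lborel. \<eta> ((1 / t) *\<^sub>R (0 + t *\<^sub>R h)) *\<^sub>R v (z + (0 + t *\<^sub>R h)))"
        by (rule lborel_integral_affine[OF t0]) measurable
      finally show ?thesis
        using t0 by (simp add: add.commute)
    qed
    have "(\<Sum>j<m. t ^ j *\<^sub>R a j) = (LINT h|lborel. \<eta> h *\<^sub>R (LINT z|lborel. \<phi> z *\<^sub>R v (0 + t *\<^sub>R h + z)))"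
      unfolding poly[symmetric] moll_alt[OF v \<phi>] ..
    also have "\<dots> = (LINT z|lborel. \<phi> z *\<^sub>R (LINT h|lborel. \<eta> h *\<^sub>R v (0 + t *\<^sub>R h + z)))"
      by (rule Fubini_test_functions(1)[OF v \<eta>(1) \<phi>])
    also have "\<dots> = 0"
      unfolding inner by simp
    finally show ?thesis .
  qed
  \<comment> \<open>At \<open>t = 0\<close> the dilates have collapsed to a point, and the integral
    is that of \<eta> times the pairing of \<open>v\<close> with \<phi>.\<close>
  have "(LINT h|lborel. \<eta> h *\<^sub>R moll v \<phi> (0 + 0 *\<^sub>R h)) = 0"
    unfolding poly by (rule polynomial_zero_of_roots[OF T(1,2) root])
  moreover have "integrable lborel \<eta>"
    using locally_integrable_test_integrable[OF continuous_locally_integrable[OF continuous_on_const[of UNIV "1 :: real"]] \<eta>(1)]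
    by simp
  ultimately have "(LINT h|lborel. \<eta> h) *\<^sub>R moll v \<phi> 0 = 0"
    by simp
  then show "(LINT x|lborel. \<phi> x *\<^sub>R v x) = 0"
    using \<eta>(2) by (simp add: moll_def)
qed

text \<open>Otherwise the constant 1 would annihilate all test functions and hence vanish almost
  everywhere.\<close>

lemma exists_test_function_integral_nonzero:
  "\<exists>\<eta>\<in>test_functions UNIV. (LINT x|lborel. \<eta> (x :: real ^ 'n::finite)) \<noteq> 0"
proof (rule ccontr)
  assume "\<not> ?thesis"
  then have "AE x :: real ^ 'n in lborel. (1 :: real) = 0"
    by (intro AE_zero_of_test_functions continuous_locally_integrable) auto
  then have "(UNIV :: (real ^ 'n) set) \<in> null_sets lborel"
    using AE_iff_null_sets[of "UNIV :: (real ^ 'n) set" lborel] by simp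
  then show False
    by (simp add: null_sets_def)
qed

section \<open>The kernel as a vector space with two seminorms\<close>

lemma ker_op_subspace:
  assumes "first_order_operator A"
  shows "subspace (ker_op A)"
  unfolding subspace_def
proof (intro conjI allI ballI)
  have lin: "linear (A i)" for i
    using assms by (simp add: first_order_operator_def)
  have "locally_integrable (\<lambda>x. 0)"
    by (rule continuous_locally_integrable) simp
  then show "0 \<in> ker_op A"
    by (simp add: ker_op_iff zero_fun_def linear_0[OF lin])
  show "u + w \<in> ker_op A" if "u \<in> ker_op A" "w \<in> ker_op A" for u w
    using ker_op_lincomb[OF assms that, of 1 1] by (simp add: plus_fun_def)
  show "c *\<^sub>R u \<in> ker_op A" if "u \<in> ker_op A" for u c
    using ker_op_lincomb[OF assms that that, of c 0] by (simp add: scaleR_fun_def)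
qed

lemma set_integral_norm_seminorm:
  fixes W :: "('a::euclidean_space \<Rightarrow> 'b::euclidean_space) set"
  assumes "\<And>u. u \<in> W \<Longrightarrow> set_integrable lborel \<Omega> u"
  shows "is_seminorm W (\<lambda>u. LINT x:\<Omega>|lborel. norm (u x))"
  unfolding is_seminorm_def
proof (intro conjI ballI allI)
  show "(LINT x:\<Omega>|lborel. norm ((c *\<^sub>R u) x)) = \<bar>c\<bar> * (LINT x:\<Omega>|lborel. norm (u x))" for c u
    by (simp add: scaleR_fun_def)
  fix u w assume "u \<in> W" "w \<in> W"
  note i = assms[OF this(1)] assms[OF this(2)]
  have "(LINT x:\<Omega>|lborel. norm ((u + w) x)) \<le> (LINT x:\<Omega>|lborel. norm (u x) + norm (w x))"
    unfolding plus_fun_def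
    by (rule set_integral_mono[OF set_integrable_norm[OF set_integral_add(1)[OF i]]
          set_integral_add(1)[OF set_integrable_norm[OF i(1)] set_integrable_norm[OF i(2)]]])
       (rule norm_triangle_ineq)
  also have "\<dots> = (LINT x:\<Omega>|lborel. norm (u x)) + (LINT x:\<Omega>|lborel. norm (w x))"
    by (intro set_integral_add set_integrable_norm i)
  finally show "(LINT x:\<Omega>|lborel. norm ((u + w) x)) \<le> (LINT x:\<Omega>|lborel. norm (u x)) + (LINT x:\<Omega>|lborel. norm (w x))" .
qed

lemma moll_add:
  assumes "locally_integrable u" "locally_integrable w" "\<phi> \<in> test_functions UNIV"
  shows "moll (u + w) \<phi> x = moll u \<phi> x + moll w \<phi> x"
  unfolding moll_def plus_fun_def scaleR_add_right
  by (intro Bochner_Integration.integral_add locally_integrable_test_integrable[OF _ test_functions_translate] assms)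

lemma moll_scaleR: "moll (c *\<^sub>R u) \<phi> x = c *\<^sub>R moll u \<phi> x"
  by (simp add: moll_def scaleR_fun_def scaleR_left_commute[of _ c] del: scaleR_scaleR)

text \<open>The separating functionals are the coordinates of averages of \<open>w\<close> against
  dilates of \<eta> centred at grid points. They determine \<open>w\<close>, and since their
  supports lie in \<Omega>, they vanish whenever \<open>w\<close> vanishes almost everywhere on
  \<Omega>, in particular when \<open>N w = 0\<close>.\<close>

lemma kernel_norm_domination:
  fixes A :: "'n::finite \<Rightarrow> 'v::euclidean_space \<Rightarrow> 'w::euclidean_space"
  assumes A: "first_order_operator A" and \<Omega>: "open \<Omega>" "bounded \<Omega>" "x0 \<in> \<Omega>"
    and p: "p > 1" and C: "C > 0" and rev: "kernel_reverse_Holder \<Omega> A p C"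
    and N: "is_seminorm (ker_op A) N"
    and null: "\<And>w. w \<in> ker_op A \<Longrightarrow> ae_eq_on \<Omega> w (\<lambda>x. 0) \<Longrightarrow> N w = 0"
    and sep: "\<And>w. w \<in> ker_op A \<Longrightarrow> N w = 0 \<Longrightarrow> ae_eq_on \<Omega> w (\<lambda>x. 0)"
  obtains \<kappa> where "\<kappa> \<ge> 0" "\<And>w. w \<in> ker_op A \<Longrightarrow> (LINT x:\<Omega>|lborel. norm (w x)) \<le> \<kappa> * N w"
proof -
  obtain m where m: "\<And>k v \<phi> x y. m \<le> k \<Longrightarrow> v \<in> ker_op A \<Longrightarrow> \<phi> \<in> test_functions UNIV \<Longrightarrow> dmoll v y k \<phi> x = 0"
    by (rule kernel_degree_bound[OF A \<Omega> p C rev]) blast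
  obtain \<eta> :: "real ^ 'n \<Rightarrow> real" where \<eta>: "\<eta> \<in> test_functions UNIV" "(LINT x|lborel. \<eta> x) \<noteq> 0"
    using exists_test_function_integral_nonzero by blast
  obtain R where R: "R > 0" "\<And>x. norm x > R \<Longrightarrow> \<eta> x = 0"
    by (rule test_functions_support_ball[OF \<eta>(1)]) blast
  obtain r where r: "r > 0" "ball x0 r \<subseteq> \<Omega>"
    using \<Omega> open_contains_ball by blast
  \<comment> \<open>The largest dilation factor is at most \<open>\<tau> * real (Suc m)\<close>, so
    every dilated support has radius at most \<open>r / 3\<close>.\<close>
  define \<tau> where "\<tau> = r / (3 * real (Suc m) * R)"
  have \<tau>: "\<tau> > 0"
    unfolding \<tau>_def using r(1) R(1) by simp
  define T where "T = (\<lambda>l. \<tau> * real (Suc l)) ` {..<m}"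
  have T: "finite T" "card T \<ge> m" "0 \<notin> T"
    unfolding T_def using \<tau> by (auto simp: card_image inj_on_def)
  have tR: "0 < t" "t * R \<le> r / 3" if "t \<in> T" for t
  proof -
    obtain l where l: "l < m" "t = \<tau> * real (Suc l)"
      using \<open>t \<in> T\<close> by (auto simp: T_def)
    then show "0 < t"
      using \<tau> by simp
    have "t * R \<le> \<tau> * real (Suc m) * R"
      unfolding l(2) using l(1) \<tau> R(1) by (intro mult_right_mono mult_left_mono) auto
    also have "\<dots> = r / 3"
      unfolding \<tau>_def using R(1) by (simp add: field_simps del: of_nat_Suc)
    finally show "t * R \<le> r / 3" .
  qed
  \<comment> \<open>Grid points are displaced from \<open>x0\<close> by at most
    \<open>r / 3\<close>, so centre and support together stay within \<open>ball x0 r\<close>. The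
    summand 1 keeps the denominator positive for \<open>m = 0\<close>.\<close>
  define s where "s = r / (3 * (real CARD('n) * real m + 1))"
  have s: "s > 0"
    unfolding s_def using r(1) by (simp add: add_nonneg_pos)
  have s\<gamma>: "norm (s *\<^sub>R \<gamma>) \<le> r / 3" if "\<gamma> \<in> grid m" for \<gamma> :: "real ^ 'n"
  proof -
    have "norm (s *\<^sub>R \<gamma>) \<le> s * (real CARD('n) * real m + 1)"
      using grid_norm_le[OF that] s by simp
    also have "\<dots> = r / 3"
    proof -
      have *: "d > 0 \<Longrightarrow> r / (3 * d) * d = r / 3" for d
        by (simp add: field_simps)
      show ?thesis
        unfolding s_def by (rule *) (simp add: add_nonneg_pos)
    qed
    finally show ?thesis .
  qed
  define e where "e = (\<lambda>(t, \<gamma>, b) w. moll w (\<lambda>z. \<eta> ((1 / t) *\<^sub>R z)) (x0 + s *\<^sub>R \<gamma>) \<bullet> (b :: 'v))"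
  let ?E = "e ` (T \<times> grid m \<times> Basis)"
  let ?L = "\<lambda>w :: real ^ 'n \<Rightarrow> 'v. LINT x:\<Omega>|lborel. norm (w x)"
  note li = ker_op_locally_integrable
  have \<eta>t: "(\<lambda>z. \<eta> ((1 / t) *\<^sub>R z)) \<in> test_functions UNIV" if "t \<in> T" for t
    using test_functions_affine[OF \<eta>(1), of "1 / t" 0] tR(1)[OF that] by simp
  have "(\<forall>f::nat \<Rightarrow> real ^ 'n \<Rightarrow> 'v. (\<forall>k. f k \<in> ker_op A) \<longrightarrow> (\<forall>\<epsilon>>0. \<exists>K. \<forall>m\<ge>K. \<forall>n\<ge>K. N (f m - f n) < \<epsilon>) \<longrightarrow>
            (\<exists>u\<in>ker_op A. (\<lambda>k. N (f k - u)) \<longlonglongrightarrow> 0)) \<and>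
         (\<exists>\<kappa>\<ge>0. \<forall>u\<in>ker_op A. ?L u \<le> \<kappa> * N u)"
  proof (rule seminorm_complete_and_dominates[where E="?E"])
    show "finite ?E"
      by (intro finite_imageI finite_cartesian_product T(1) finite_grid finite_Basis)
    show "subspace (ker_op A)"
      by (rule ker_op_subspace[OF A])
    show "is_seminorm (ker_op A) N"
      by (rule N)
    show "is_seminorm (ker_op A) ?L"
      by (rule set_integral_norm_seminorm, rule locally_integrable_set_integrable[OF li]) (use \<Omega> in auto)
    show "f (u + w) = f u + f w" if f: "f \<in> ?E" and uw: "u \<in> ker_op A" "w \<in> ker_op A" for f u w
    proof -
      obtain t \<gamma> b where "t \<in> T" and f: "f = e (t, \<gamma>, b)"
        using f by auto
      then show ?thesis
        unfolding f e_def using moll_add[OF li[OF uw(1)] li[OF uw(2)] \<eta>t] by (simp add: inner_add_left)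
    qed
    show "f (c *\<^sub>R u) = c * f u" if "f \<in> ?E" "u \<in> ker_op A" for f u c
      using that by (auto simp: e_def moll_scaleR)
    show "N u = 0 \<and> ?L u = 0" if u: "u \<in> ker_op A" and z: "\<And>f. f \<in> ?E \<Longrightarrow> f u = 0" for u
    proof -
      have "AE x in lborel. u x = 0"
      proof (rule kernel_zero_of_mollifications[OF li[OF u] m[OF order_refl u] \<eta> T])
        show "s \<noteq> 0"
          using s by simp
        show "moll u (\<lambda>z. \<eta> ((1 / t) *\<^sub>R z)) (x0 + s *\<^sub>R \<gamma>) = 0" if "t \<in> T" "\<gamma> \<in> grid m" for t \<gamma>
        proof (rule euclidean_eqI)
          fix b :: 'v assume "b \<in> Basis"
          then have "e (t, \<gamma>, b) u = 0"
            using that by (intro z imageI) auto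
          then show "moll u (\<lambda>z. \<eta> ((1 / t) *\<^sub>R z)) (x0 + s *\<^sub>R \<gamma>) \<bullet> b = 0 \<bullet> b"
            by (simp add: e_def)
        qed
      qed
      then have ae: "ae_eq_on \<Omega> u (\<lambda>x. 0)" and ae': "AE x in lborel. indicator \<Omega> x *\<^sub>R norm (u x) = 0"
        unfolding ae_eq_on_def by auto
      from ae' have "?L u = 0"
        unfolding set_lebesgue_integral_def by (rule integral_eq_zero_AE)
      then show ?thesis
        using null[OF u ae] by simp
    qed
    show "f u = 0" if u: "u \<in> ker_op A" and Nu: "N u = 0" and f: "f \<in> ?E" for u f
    proof -
      obtain t \<gamma> b where tg: "t \<in> T" "\<gamma> \<in> grid m" and f: "f = e (t, \<gamma>, b)"
        using f by auto
      have supp: "z \<in> \<Omega>" if "\<eta> ((1 / t) *\<^sub>R (z - (x0 + s *\<^sub>R \<gamma>))) \<noteq> 0" for z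
      proof -
        have "norm ((1 / t) *\<^sub>R (z - (x0 + s *\<^sub>R \<gamma>))) \<le> R"
          using R(2) that not_le by blast
        then have "norm (z - (x0 + s *\<^sub>R \<gamma>)) \<le> t * R"
          using tR(1)[OF tg(1)] unfolding norm_scaleR by (simp add: divide_le_eq mult.commute)
        then have "norm (z - (x0 + s *\<^sub>R \<gamma>)) + norm (s *\<^sub>R \<gamma>) < r"
          using tR(2)[OF tg(1)] s\<gamma>[OF tg(2)] r(1) by linarith
        then have "norm (z - x0) < r"
          using norm_triangle_ineq[of "z - (x0 + s *\<^sub>R \<gamma>)" "s *\<^sub>R \<gamma>"] by simp
        then show ?thesis
          using r(2) by (auto simp: dist_norm norm_minus_commute)
      qed
      have "AE z in lborel. \<eta> ((1 / t) *\<^sub>R (z - (x0 + s *\<^sub>R \<gamma>))) *\<^sub>R u z = 0"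
        using sep[OF u Nu] unfolding ae_eq_on_def by (rule AE_mp) (auto intro!: AE_I2 dest: supp)
      then have "moll u (\<lambda>z. \<eta> ((1 / t) *\<^sub>R z)) (x0 + s *\<^sub>R \<gamma>) = 0"
        unfolding moll_def by (rule integral_eq_zero_AE)
      then show ?thesis
        by (simp add: f e_def)
    qed
  qed
  then show ?thesis
    using that by blast
qed


section \<open>The characterisation\<close>

lemma ae_eq_zero_of_Lp_norm_zero:
  assumes "p > 0" "set_integrable lborel \<Omega> u" "Lp_norm p \<Omega> u = 0"
  shows "ae_eq_on \<Omega> u (\<lambda>x. 0)"
proof -
  have [measurable]: "(\<lambda>x. indicator \<Omega> x *\<^sub>R u x) \<in> borel_measurable lborel"
    using assms(2) borel_measurable_integrable unfolding set_integrable_def by blast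
  have eq: "ennreal (norm (u x) powr p) * indicator \<Omega> x = ennreal (norm (indicator \<Omega> x *\<^sub>R u x) powr p)" for x
    using assms(1) by (simp add: indicator_def)
  let ?I = "\<integral>\<^sup>+x\<in>\<Omega>. ennreal (norm (u x) powr p) \<partial>lborel"
  have "?I \<noteq> \<infinity>"
    using assms(3) by (auto simp: Lp_norm_def Let_def)
  then have "enn2real ?I powr (1 / p) \<le> 0"
    using assms(3) by (simp add: Lp_norm_def Let_def ennreal_eq_0_iff)
  then have "?I = 0"
    using \<open>?I \<noteq> \<infinity>\<close> by (simp add: enn2real_eq_0_iff)
  moreover have "(\<lambda>x. ennreal (norm (indicator \<Omega> x *\<^sub>R u x) powr p)) \<in> borel_measurable lborel"
    by measurable
  ultimately have "AE x in lborel. ennreal (norm (indicator \<Omega> x *\<^sub>R u x) powr p) = 0"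
    unfolding eq using nn_integral_0_iff_AE by blast
  then show ?thesis
    unfolding ae_eq_on_def by (rule AE_mp) (auto intro!: AE_I2 simp: ennreal_eq_0_iff)
qed

lemma total_variation_finite:
  assumes "u \<in> BV \<Omega> A"
  shows "total_variation \<Omega> A u < \<infinity>"
proof -
  have "variation (restrict_space borel \<Omega>) \<mu> < \<infinity>" if "op_measure \<Omega> A u \<mu>" for \<mu>
    using that by (simp add: op_measure_def finite_vector_measure_def)
  moreover have "\<exists>\<mu>. op_measure \<Omega> A u \<mu>"
    using assms by (simp add: BV_def)
  ultimately show ?thesis
    unfolding total_variation_def by (rule someI2_ex[rotated])
qed

theorem proposition2p12:
  fixes \<Omega> :: "(real ^ 'n::finite) set"
    and A :: "'n \<Rightarrow> 'v::euclidean_space \<Rightarrow> 'w::euclidean_space"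
    and N :: "(real ^ 'n \<Rightarrow> 'v) \<Rightarrow> real"
    and p :: real
  assumes "CARD('n) \<ge> 2"
    and "p = real CARD('n) / (real CARD('n) - 1)"
    and "open \<Omega>" and "bounded \<Omega>"
    and "first_order_operator A" and "C_elliptic A"
    and "\<exists>C>0. \<forall>u\<in>BV \<Omega> A.
           Lp_norm p \<Omega> u \<le> ennreal C * (Lp_norm 1 \<Omega> u + total_variation \<Omega> A u) \<and>
           (INF \<rho>\<in>ker_op A. Lp_norm 1 \<Omega> (\<lambda>x. u x - \<rho> x)) \<le> ennreal C * total_variation \<Omega> A u"
    and "seminorm_on \<Omega> (BV \<Omega> A) N" and "BV_continuous \<Omega> A N"
  shows "(\<exists>c>0. \<forall>u\<in>BV \<Omega> A. Lp_norm p \<Omega> u \<le> ennreal c * (ennreal (N u) + total_variation \<Omega> A u))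
         \<longleftrightarrow> norm_on \<Omega> (ker_restrict \<Omega> A) N"
proof
  note \<Omega> = assms(3,4) and A = assms(5) and N = assms(8)
  have p: "p > 1"
    using assms(1,2) by (simp add: less_divide_eq)
  have kBV: "ker_restrict \<Omega> A \<subseteq> BV \<Omega> A"
    by (rule ker_restrict_BV[OF \<Omega>])
  {
    assume "\<exists>c>0. \<forall>u\<in>BV \<Omega> A. Lp_norm p \<Omega> u \<le> ennreal c * (ennreal (N u) + total_variation \<Omega> A u)"
    then obtain c where c: "\<And>u. u \<in> BV \<Omega> A \<Longrightarrow> Lp_norm p \<Omega> u \<le> ennreal c * (ennreal (N u) + total_variation \<Omega> A u)"
      by blast
    have "ae_eq_on \<Omega> u (\<lambda>x. 0)" if u: "u \<in> ker_restrict \<Omega> A" and "N u = 0" for u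
    proof (rule ae_eq_zero_of_Lp_norm_zero)
      show "Lp_norm p \<Omega> u = 0"
        using c[of u] u kBV \<open>N u = 0\<close> total_variation_ker_restrict[OF \<Omega>(1) u] by auto
    qed (use p ker_restrict_set_integrable[OF \<Omega> u] in auto)
    moreover have "seminorm_on \<Omega> (ker_restrict \<Omega> A) N"
      using N kBV unfolding seminorm_on_def by (meson subsetD)
    ultimately show "norm_on \<Omega> (ker_restrict \<Omega> A) N"
      by (simp add: norm_on_def)
  }
  assume nrm: "norm_on \<Omega> (ker_restrict \<Omega> A) N"
  show "\<exists>c>0. \<forall>u\<in>BV \<Omega> A. Lp_norm p \<Omega> u \<le> ennreal c * (ennreal (N u) + total_variation \<Omega> A u)"
  proof (cases "\<Omega> = {}")
    case True
    then have "Lp_norm p \<Omega> u = 0" for u :: "real ^ 'n \<Rightarrow> 'v"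
      by (simp add: Lp_norm_def)
    then show ?thesis
      by (intro exI[of _ 1]) simp
  next
    case False
    then obtain x0 where x0: "x0 \<in> \<Omega>"
      by blast
    obtain C where C: "C > 0"
      "\<And>u. u \<in> BV \<Omega> A \<Longrightarrow> Lp_norm p \<Omega> u \<le> ennreal C * (Lp_norm 1 \<Omega> u + total_variation \<Omega> A u)"
      "\<And>u. u \<in> BV \<Omega> A \<Longrightarrow> (INF \<rho>\<in>ker_op A. Lp_norm 1 \<Omega> (\<lambda>x. u x - \<rho> x)) \<le> ennreal C * total_variation \<Omega> A u"
      using assms(7) by blast
    obtain K where K: "K > 0"
      "\<And>u. u \<in> BV \<Omega> A \<Longrightarrow> ennreal (N u) \<le> ennreal K * (Lp_norm 1 \<Omega> u + total_variation \<Omega> A u)"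
      using assms(9) unfolding BV_continuous_def by blast
    have kk: "w \<in> ker_restrict \<Omega> A" if "w \<in> ker_op A" for w
      using that ker_op_subset_ker_restrict by blast
    have kB: "w \<in> BV \<Omega> A" if "w \<in> ker_op A" for w
      using kk[OF that] kBV by blast
    have Nsc: "N (\<lambda>x. c *\<^sub>R u x) = \<bar>c\<bar> * N u" and Nnn: "0 \<le> N u" if "u \<in> BV \<Omega> A" for u c
      using N that by (auto simp: seminorm_on_def)
    have Nadd: "N (\<lambda>x. u x + w x) \<le> N u + N w" if "u \<in> BV \<Omega> A" "w \<in> BV \<Omega> A" for u w
      using N that by (auto simp: seminorm_on_def)
    have rev: "kernel_reverse_Holder \<Omega> A p C"
      unfolding kernel_reverse_Holder_def
      using C(2)[OF kB] total_variation_ker_restrict[OF \<Omega>(1) kk] by fastforce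
    have Nk: "is_seminorm (ker_op A) N"
      unfolding is_seminorm_def scaleR_fun_def plus_fun_def using Nsc Nadd kB by blast
    have null: "N w = 0" if w: "w \<in> ker_op A" "ae_eq_on \<Omega> w (\<lambda>x. 0)" for w
    proof -
      have "(\<lambda>x. 0) \<in> BV \<Omega> A"
        using kB[OF subspace_0[OF ker_op_subspace[OF A]]] by (simp add: zero_fun_def)
      then have "N w = N (\<lambda>x. 0)"
        using N kB[OF w(1)] w(2) unfolding seminorm_on_def by blast
      also have "N (\<lambda>x. 0) = 0"
        using Nsc[OF kB[OF w(1)], of 0] by simp
      finally show ?thesis .
    qed
    have sep: "ae_eq_on \<Omega> w (\<lambda>x. 0)" if "w \<in> ker_op A" "N w = 0" for w
      using nrm kk[OF that(1)] that(2) by (simp add: norm_on_def)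
    obtain \<kappa> where \<kappa>: "\<kappa> \<ge> 0" "\<And>w. w \<in> ker_op A \<Longrightarrow> (LINT x:\<Omega>|lborel. norm (w x)) \<le> \<kappa> * N w"
      by (rule kernel_norm_domination[OF A \<Omega> x0 p C(1) rev Nk null sep]) blast+
    \<comment> \<open>The bound below has coefficient \<open>C * \<kappa>\<close> on
      \<open>N u\<close> and \<open>C * (C + 1 + \<kappa> * K * (C + 1))\<close> on the total
      variation; \<open>c\<close> is their sum, hence dominates both.\<close>
    define c where "c = C * (C + 1 + \<kappa> + \<kappa> * K * (C + 1))"
    have "c > 0"
      unfolding c_def using C(1) K(1) \<kappa>(1) by (intro mult_pos_pos add_pos_nonneg) auto
    have "Lp_norm p \<Omega> u \<le> ennreal c * (ennreal (N u) + total_variation \<Omega> A u)" if u: "u \<in> BV \<Omega> A" for u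
    proof -
      define \<tau> where "\<tau> = enn2real (total_variation \<Omega> A u)"
      have \<tau>: "total_variation \<Omega> A u = ennreal \<tau>" "\<tau> \<ge> 0"
        using total_variation_finite[OF u] by (simp_all add: \<tau>_def)
      have ui: "set_integrable lborel \<Omega> u"
        using u by (simp add: BV_def)
      \<comment> \<open>The factor with which the slack \<open>q\<close> in the choice of \<rho>
        enters the final bound; taking \<open>q = e / Y\<close> makes its contribution exactly
        \<open>e\<close>.\<close>
      define Y where "Y = C * (1 + \<kappa> * K)"
      have Y: "Y > 0"
        unfolding Y_def using C(1) K(1) \<kappa>(1) by (intro mult_pos_pos add_pos_nonneg) auto
      have main: "Lp_norm p \<Omega> u \<le> ennreal (c * (N u + \<tau>)) + ennreal e" if e: "e > 0" for e
      proof -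
        define q where "q = e / Y"
        have q: "q > 0" "Y * q = e"
          unfolding q_def using e Y by auto
        define \<delta> where "\<delta> = C * \<tau> + q"
        have \<delta>: "C * \<tau> < \<delta>" "0 \<le> \<delta>"
          unfolding \<delta>_def using q(1) C(1) \<tau>(2) by auto
        have "(INF \<rho>\<in>ker_op A. Lp_norm 1 \<Omega> (\<lambda>x. u x - \<rho> x)) \<le> ennreal (C * \<tau>)"
          using C(3)[OF u] C(1) \<tau> by (simp add: ennreal_mult)
        also have "\<dots> < ennreal \<delta>"
          using \<delta> C(1) \<tau>(2) by (simp add: ennreal_less_iff)
        finally obtain \<rho> where \<rho>: "\<rho> \<in> ker_op A" and lt: "Lp_norm 1 \<Omega> (\<lambda>x. u x - \<rho> x) < ennreal \<delta>"
          by (auto simp: INF_less_iff)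
        have \<rho>i: "set_integrable lborel \<Omega> \<rho>"
          by (rule ker_restrict_set_integrable[OF \<Omega> kk[OF \<rho>]])
        have di: "set_integrable lborel \<Omega> (\<lambda>x. u x - \<rho> x)"
          by (intro set_integral_diff ui \<rho>i)
        have opeq: "op_measure \<Omega> A (\<lambda>x. u x - \<rho> x) = op_measure \<Omega> A u"
          by (rule op_measure_diff_kernel[OF A \<Omega> ui \<rho>])
        have dBV: "(\<lambda>x. u x - \<rho> x) \<in> BV \<Omega> A"
          using u di by (simp add: BV_def opeq)
        have dTV: "total_variation \<Omega> A (\<lambda>x. u x - \<rho> x) = ennreal \<tau>"
          using \<tau>(1) by (simp add: total_variation_def opeq)
        let ?d = "LINT x:\<Omega>|lborel. norm (u x - \<rho> x)"
        let ?r = "LINT x:\<Omega>|lborel. norm (\<rho> x)"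
        let ?u = "LINT x:\<Omega>|lborel. norm (u x)"
        have nn: "?d \<ge> 0" "?u \<ge> 0"
          by (auto simp: set_lebesgue_integral_def intro!: integral_nonneg_AE)
        have d: "?d \<le> \<delta>"
          using lt \<delta>(2) nn(1) unfolding L1_norm_eq[OF di] by (simp add: ennreal_less_iff)
        \<comment> \<open>Here continuity of \<open>N\<close> enters: the part of \<open>u\<close>
          outside the kernel is small in \<open>L^1\<close> and has the same total variation, so
          \<open>N\<close> controls \<rho> up to a multiple of that variation.\<close>
        have Nd: "N (\<lambda>x. u x - \<rho> x) \<le> K * (?d + \<tau>)"
          using K(2)[OF dBV] K(1) \<tau>(2) nn(1) Nnn[OF dBV] unfolding L1_norm_eq[OF di] dTV
          by (simp add: ennreal_plus[symmetric] ennreal_mult[symmetric] del: ennreal_plus)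
        have "N \<rho> \<le> N u + N (\<lambda>x. u x - \<rho> x)"
        proof -
          have "N (\<lambda>x. u x + (- 1) *\<^sub>R (u x - \<rho> x)) \<le> N u + N (\<lambda>x. (- 1) *\<^sub>R (u x - \<rho> x))"
            by (rule Nadd[OF u BV_uminus[OF A dBV]])
          then show ?thesis
            using Nsc[OF dBV, of "- 1"] by simp
        qed
        also have "\<dots> \<le> N u + K * (\<delta> + \<tau>)"
          using Nd mult_left_mono[of "?d + \<tau>" "\<delta> + \<tau>" K] d K(1) by linarith
        finally have N\<rho>: "\<kappa> * N \<rho> \<le> \<kappa> * (N u + K * (\<delta> + \<tau>))"
          by (rule mult_left_mono[OF _ \<kappa>(1)])
        have "?u \<le> (LINT x:\<Omega>|lborel. norm (u x - \<rho> x) + norm (\<rho> x))"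
          by (rule set_integral_mono[OF set_integrable_norm[OF ui]
                set_integral_add(1)[OF set_integrable_norm[OF di] set_integrable_norm[OF \<rho>i]]])
             (metis diff_add_cancel norm_triangle_ineq)
        also have "\<dots> = ?d + ?r"
          by (rule set_integral_add(2)[OF set_integrable_norm[OF di] set_integrable_norm[OF \<rho>i]])
        also have "\<dots> \<le> \<delta> + \<kappa> * (N u + K * (\<delta> + \<tau>))"
          using d \<kappa>(2)[OF \<rho>] N\<rho> by linarith
        finally have "C * (?u + \<tau>) \<le> C * (\<delta> + \<kappa> * (N u + K * (\<delta> + \<tau>)) + \<tau>)"
          using C(1) by simp
        also have "\<dots> = C * (C * \<tau> + \<kappa> * (N u + K * (C * \<tau> + \<tau>)) + \<tau>) + Y * q"
          by (simp add: \<delta>_def Y_def algebra_simps)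
        also have "Y * q = e"
          by (rule q(2))
        also have "C * (C * \<tau> + \<kappa> * (N u + K * (C * \<tau> + \<tau>)) + \<tau>) \<le> c * (N u + \<tau>)"
        proof -
          have "0 \<le> C * \<kappa> * \<tau>" "0 \<le> C * (C + 1 + \<kappa> * K * (C + 1)) * N u"
            using C(1) K(1) \<kappa>(1) \<tau>(2) Nnn[OF u] by (auto intro!: mult_nonneg_nonneg add_nonneg_nonneg)
          then show ?thesis
            by (simp add: c_def algebra_simps)
        qed
        finally have "C * (?u + \<tau>) \<le> c * (N u + \<tau>) + e"
          by simp
        then have "ennreal (C * (?u + \<tau>)) \<le> ennreal (c * (N u + \<tau>)) + ennreal e"
          using \<open>c > 0\<close> Nnn[OF u] \<tau>(2) e by (simp add: ennreal_plus[symmetric] ennreal_leI del: ennreal_plus)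
        moreover have "Lp_norm p \<Omega> u \<le> ennreal (C * (?u + \<tau>))"
          using C(2)[OF u] C(1) nn(2) \<tau> unfolding L1_norm_eq[OF ui]
          by (simp add: ennreal_plus[symmetric] ennreal_mult[symmetric] del: ennreal_plus)
        ultimately show ?thesis
          by (rule order_trans[rotated])
      qed
      have "Lp_norm p \<Omega> u \<le> ennreal (c * (N u + \<tau>))"
        by (rule ennreal_le_epsilon) (rule main)
      then show ?thesis
        using \<open>c > 0\<close> Nnn[OF u] \<tau> by (simp add: ennreal_mult ennreal_plus)
    qed
    then show ?thesis
      using \<open>c > 0\<close> by blast
  qed
qed

end
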